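(* Let $\rho$ be the genuine irreducible smooth representation of $\widetilde{T^1}$ with central character $\chi$, where $\chi$ is primitive mod $m$. For $0\le i<\underline n$ let $V_i=\mathrm{Ind}_{\widetilde{B^1}\cap\widetilde{K^1}}^{\widetilde{K^1}}\chi_i$ and for $l>m$ let $\widetilde W_{i,l}=V_i^{K^1_l}/V_i^{K^1_{l-1}}$; each $\widetilde W_{i,l}$ is a direct sum of two irreducible representations of $\widetilde{K^1}$. (1) For each $0\le i<\underline n$ and $l>m$ there is a way of decomposing $\widetilde W_{i,l}$ into irreducibles as $\widetilde W_{i,l}^+\oplus\widetilde W_{i,l}^-$ such that, for all $l>m$ and all $0\le i,j<\underline n$, $\widetilde W_{i,l}^+\cong\widetilde W_{j,l}^+$ and $\widetilde W_{i,l}^-\cong\widetilde W_{j,l}^-$. (2) The representations $V_i^{K^1_m}$, $0\le i<\underline n$, are mutually inequivalent, except when $m=1$ and $\chi_0|_{(T^1\cap K^1)^2}=\epsilon\circ\vartheta_{(\mathcal O^\times)^2}^{-j}$ for some $0\le j<\underline n$, in which case, for $i\ne k$, $V_i^{K^1_1}\cong V_k^{K^1_1}$ exactly when $i+k\equiv j\pmod{\underline n}$.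
   Context: Let $\mathbb F$ be a non-Archimedean local field with ring of integers $\mathcal O$, maximal ideal $\mathfrak p$, residue field $\kappa=\mathcal O/\mathfrak p$ of cardinality $q$, fixed uniformizer $\varpi$ and valuation $\mathrm{val}$. Let $n\ge 2$ be an integer with $n\mid q-1$; $\mathbb F$ contains the group $\mu_n$ of $n$-th roots of unity (identified by reduction with the $n$-th roots of unity in $\kappa^\times$). Put $\underline n=n$ if $n$ is odd, $\underline n=n/2$ if $n$ is even. The $n$-th Hilbert symbol is $(a,b)_n=\overline c^{(q-1)/n}$, $c=(-1)^{\mathrm{val}(a)\mathrm{val}(b)}a^{\mathrm{val}(b)}/b^{\mathrm{val}(a)}$, $\overline c$ the image of $c$ in $\kappa^\times$. $G^1=\mathrm{SL}_2(\mathbb F)$; $B^1$ is the upper triangular Borel subgroup, $N^1$ its unipotent radical, $T^1$ the diagonal torus, $K^1=\mathrm{SL}_2(\mathcal O)$, $K^1_j=\{g\in K^1: g\equiv I_2 \bmod \mathfrak p^j\}$ for $j\ge1$. The covering group $\widetilde{G^1}$ is the set $G^1\times\mu_n$ with multiplication $(g_1,\zeta_1)(g_2,\zeta_2)=(g_1g_2,\beta(g_1,g_2)\zeta_1\zeta_2)$, where $\beta(g_1,g_2)=\left(\frac{X(g_1g_2)}{X(g_1)},\frac{X(g_1g_2)}{X(g_2)}\right)_n$ and $X\begin{pmatrix}a&b\\c&d\end{pmatrix}=c$ if $c\ne0$, $=d$ otherwise. For a subgroup $H\le G^1$, $\widetilde H$ is its full inverse image in $\widetilde{G^1}$. Write $\mathrm{dg}(t)=\mathrm{diag}(t,t^{-1})$.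 The subgroups $N^1$, $K^1_j$ ($j\ge 1$), $T^1\cap K^1$, $B^1\cap K^1$ are identified with subgroups of $\widetilde{G^1}$ via $h\mapsto(h,1)$. Fix a faithful character $\epsilon:\mu_n\to\mathbb C^\times$; "genuine" means $\mu_n$ acts by $\epsilon$. One has $Z(\widetilde{T^1})=\{(\mathrm{dg}(t),\zeta): t\in(\mathbb F^{\times})^{\underline n},\zeta\in\mu_n\}$, and $A^1=\{(\mathrm{dg}(a),\zeta): \underline n\mid\mathrm{val}(a),\ \zeta\in\mu_n\}$ is a maximal abelian subgroup of $\widetilde{T^1}$. A genuine smooth character $\chi$ of $Z(\widetilde{T^1})$ determines a unique irreducible representation $\rho\cong\mathrm{Ind}_{A^1}^{\widetilde{T^1}}\chi_0$ of $\widetilde{T^1}$ with central character $\chi$, where $\chi_0$ is a fixed extension of $\chi$ to $A^1$. Let $\vartheta(a)=(\varpi,a)_n$ and $\vartheta_{(\mathcal O^\times)^2}=\vartheta|_{(\mathcal O^\times)^2}$. For $0\le i<\underline n$ let $\chi_i(\mathrm{dg}(a\varpi^{\underline n r}),\zeta)=\chi_0(\mathrm{dg}(a\varpi^{\underline n r}),\vartheta(a)^{2i}\zeta)$ ($a\in\mathcal O^\times$, $r\in\mathbb Z$, $\zeta\in\mu_n$), a character of $A^1$; also write $\chi_i$ for its restriction to $\widetilde{T^1}\cap\widetilde{K^1}$, extended trivially on $N^1\cap K^1$ to $\widetilde{B^1}\cap\widetilde{K^1}$. $\chi$ is primitive mod $m$ if $m$ is the smallest strictly positive integer such that $\chi$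 is trivial on $Z(\widetilde{T^1})\cap K^1_m$. $(T^1\cap K^1)^2=\{\mathrm{dg}(t^2): t\in\mathcal O^\times\}$, whose characters are regarded as characters of $(\mathcal O^\times)^2$ via $\mathrm{dg}(s)\leftrightarrow s$. $\mathrm{Ind}$ is smooth non-normalized induction, and $V^{K^1_l}$ denotes $K^1_l$-fixed vectors. The $V_i^{K^1_m}$ and the $\widetilde W_{i,l}$ ($l>m$) are the pieces, with direct sum over $0\le i<\underline n$, of the restriction to $\widetilde{K^1}$ of the principal series $\mathrm{Ind}_{\widetilde{B^1}}^{\widetilde{G^1}}\rho$, where $\rho$ is extended trivially over $N^1$ to $\widetilde{B^1}=\widetilde{T^1}\ltimes N^1$.
   Formalization: The residue field cardinality q is assumed odd; for even q the assertion that each W_{i,l} (l>m) is a direct sum of two irreducibles is false (e.g. q=4, n=3, m=1, l=2, where W_{i,2} is irreducible). *)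

theory Defs
  imports "HOL-Analysis.Analysis" "HOL-Algebra.Algebra" "HOL-Number_Theory.Cong"
begin

section \<open>Non-Archimedean local fields\<close>

text \<open>
  The field is the whole type; the valuation is integer-valued and its value at 0 is
  irrelevant (val 0 = infinity is encoded by treating 0 separately).
\<close>

definition frac_ideal :: "('a::field \<Rightarrow> int) \<Rightarrow> int \<Rightarrow> 'a set" where
  "frac_ideal val k = {x. x = 0 \<or> k \<le> val x}"

definition int_ring :: "('a::field \<Rightarrow> int) \<Rightarrow> 'a ring" where
  "int_ring val = \<lparr>carrier = frac_ideal val 0, mult = (*), one = 1, ring.zero = 0, ring.add = (+)\<rparr>"

definition int_units :: "('a::field \<Rightarrow> int) \<Rightarrow> 'a set" where
  "int_units val = {x. x \<noteq> 0 \<and> val x = 0}"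

definition residue_field :: "('a::field \<Rightarrow> int) \<Rightarrow> 'a set ring" where
  "residue_field val = int_ring val Quot frac_ideal val 1"

definition residue_card :: "('a::field \<Rightarrow> int) \<Rightarrow> nat" where
  "residue_card val = card (carrier (residue_field val))"

definition reduction :: "('a::field \<Rightarrow> int) \<Rightarrow> 'a \<Rightarrow> 'a set" where
  "reduction val x = frac_ideal val 1 +>\<^bsub>int_ring val\<^esub> x"

locale nonarch_local_field =
  fixes val :: "'a::field \<Rightarrow> int" and \<omega> :: 'a
  assumes val_mult: "x \<noteq> 0 \<Longrightarrow> y \<noteq> 0 \<Longrightarrow> val (x * y) = val x + val y"
    and val_add: "x \<noteq> 0 \<Longrightarrow> y \<noteq> 0 \<Longrightarrow> x + y \<noteq> 0 \<Longrightarrow> min (val x) (val y) \<le> val (x + y)"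
    and uniformizer: "\<omega> \<noteq> 0" "val \<omega> = 1"
    and complete:
      "(\<forall>k. \<exists>N. \<forall>i\<ge>N. \<forall>j\<ge>N. s i - s j \<in> frac_ideal val k) \<Longrightarrow>
       \<exists>L. \<forall>k. \<exists>N::nat. \<forall>i\<ge>N. s i - L \<in> frac_ideal val k"
    and finite_residue_field: "finite (carrier (residue_field val))"

definition roots_of_unity :: "nat \<Rightarrow> 'a::field set" where
  "roots_of_unity n = {z. z ^ n = 1}"

text \<open>
  The value in the residue field is transported to the field by the inverse of the reduction
  map on n-th roots of unity (bijective when n divides q - 1).
\<close>

definition hilbert :: "('a::field \<Rightarrow> int) \<Rightarrow> nat \<Rightarrow> 'a \<Rightarrow> 'a \<Rightarrow> 'a" where
  "hilbert val n a b =
     (let c = (- 1) powi (val a * val b) * (a powi val b / b powi val a)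
      in THE z. z \<in> roots_of_unity n \<and>
           reduction val z = reduction val c [^]\<^bsub>residue_field val\<^esub> ((residue_card val - 1) div n))"

section \<open>The covering group of SL(2)\<close>

type_synonym 'a mat2 = "'a ^ 2 ^ 2"
type_synonym 'a cov = "'a mat2 \<times> 'a"

definition SL2 :: "'a::field mat2 set" where
  "SL2 = {g. det g = 1}"

definition dg :: "'a::field \<Rightarrow> 'a mat2" where
  "dg t = vector [vector [t, 0], vector [0, inverse t]]"

definition torus :: "'a::field mat2 set" where
  "torus = dg ` (UNIV - {0})"

definition borel :: "'a::field mat2 set" where
  "borel = {g \<in> SL2. g $ 2 $ 1 = 0}"

definition SL2_int :: "('a::field \<Rightarrow> int) \<Rightarrow> 'a mat2 set" where
  "SL2_int val = {g \<in> SL2. \<forall>i j. g $ i $ j \<in> frac_ideal val 0}"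

definition congr_subgroup :: "('a::field \<Rightarrow> int) \<Rightarrow> nat \<Rightarrow> 'a mat2 set" where
  "congr_subgroup val r =
     {g \<in> SL2_int val. \<forall>i j. g $ i $ j - mat 1 $ i $ j \<in> frac_ideal val (int r)}"

definition kubota_X :: "'a::field mat2 \<Rightarrow> 'a" where
  "kubota_X g = (if g $ 2 $ 1 \<noteq> 0 then g $ 2 $ 1 else g $ 2 $ 2)"

definition kubota :: "('a::field \<Rightarrow> int) \<Rightarrow> nat \<Rightarrow> 'a mat2 \<Rightarrow> 'a mat2 \<Rightarrow> 'a" where
  "kubota val n g h =
     hilbert val n (kubota_X (g ** h) / kubota_X g) (kubota_X (g ** h) / kubota_X h)"

definition cover :: "('a::field \<Rightarrow> int) \<Rightarrow> nat \<Rightarrow> 'a cov monoid" where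
  "cover val n =
     \<lparr>carrier = SL2 \<times> roots_of_unity n,
      mult = (\<lambda>(g, z) (h, w). (g ** h, kubota val n g h * z * w)),
      one = (mat 1, 1)\<rparr>"

definition preim :: "nat \<Rightarrow> 'a::field mat2 set \<Rightarrow> 'a cov set" where
  "preim n H = H \<times> roots_of_unity n"

definition cover_sub :: "('a::field \<Rightarrow> int) \<Rightarrow> nat \<Rightarrow> 'a mat2 set \<Rightarrow> 'a cov monoid" where
  "cover_sub val n H = (cover val n)\<lparr>carrier := preim n H\<rparr>"

definition emb :: "'a::field mat2 \<Rightarrow> 'a cov" where
  "emb h = (h, 1)"

text \<open>
  The images of the principal congruence subgroups form a basis of open neighbourhoods of the
  identity of the covering group; all smoothness conditions below refer to this family.
\<close>

definition congr_basis :: "('a::field \<Rightarrow> int) \<Rightarrow> 'a cov set set" where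
  "congr_basis val = {emb ` congr_subgroup val r | r. r \<ge> 1}"

definition group_center :: "('g, 'h) monoid_scheme \<Rightarrow> 'g set" where
  "group_center G = {z \<in> carrier G. \<forall>x \<in> carrier G. z \<otimes>\<^bsub>G\<^esub> x = x \<otimes>\<^bsub>G\<^esub> z}"

definition n_red :: "nat \<Rightarrow> nat" where
  "n_red n = (if odd n then n else n div 2)"

definition torus_center :: "('a::field \<Rightarrow> int) \<Rightarrow> nat \<Rightarrow> 'a cov set" where
  "torus_center val n = group_center (cover_sub val n torus)"

definition torus_maxab :: "('a::field \<Rightarrow> int) \<Rightarrow> nat \<Rightarrow> 'a cov set" where
  "torus_maxab val n = preim n {dg a | a. a \<noteq> 0 \<and> int (n_red n) dvd val a}"

section \<open>Complex representations\<close>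

definition complex_ring :: "complex ring" where
  "complex_ring = \<lparr>carrier = UNIV, mult = (*), one = 1, ring.zero = 0, ring.add = (+)\<rparr>"

definition complex_units :: "complex monoid" where
  "complex_units = \<lparr>carrier = UNIV - {0}, mult = (*), one = 1\<rparr>"

text \<open>
  A representation is a complex module together with an action of group elements. (The ring
  multiplication fields that the library's module record inherits are not used.)
\<close>

record ('g, 'v) rep = "(complex, 'v) module" +
  act :: "'g \<Rightarrow> 'v \<Rightarrow> 'v"

definition linear_between ::
    "(complex, 'v, 'x) module_scheme \<Rightarrow> (complex, 'w, 'y) module_scheme \<Rightarrow> ('v \<Rightarrow> 'w) \<Rightarrow> bool" where
  "linear_between V W f \<longleftrightarrow>
     f \<in> carrier V \<rightarrow> carrier W \<and>
     (\<forall>u \<in> carrier V. \<forall>v \<in> carrier V. f (u \<oplus>\<^bsub>V\<^esub> v) = f u \<oplus>\<^bsub>W\<^esub> f v) \<and>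
     (\<forall>c. \<forall>v \<in> carrier V. f (c \<odot>\<^bsub>V\<^esub> v) = c \<odot>\<^bsub>W\<^esub> f v)"

definition representation :: "('g, 'h) monoid_scheme \<Rightarrow> ('g, 'v) rep \<Rightarrow> bool" where
  "representation G V \<longleftrightarrow>
     Module.module complex_ring V \<and>
     (\<forall>g \<in> carrier G. linear_between V V (act V g)) \<and>
     (\<forall>v \<in> carrier V. act V \<one>\<^bsub>G\<^esub> v = v) \<and>
     (\<forall>g \<in> carrier G. \<forall>h \<in> carrier G. \<forall>v \<in> carrier V.
        act V (g \<otimes>\<^bsub>G\<^esub> h) v = act V g (act V h v))"

definition smooth_rep :: "('g, 'h) monoid_scheme \<Rightarrow> 'g set set \<Rightarrow> ('g, 'v) rep \<Rightarrow> bool" where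
  "smooth_rep G N V \<longleftrightarrow>
     (\<forall>v \<in> carrier V. \<exists>U \<in> N. \<forall>k \<in> U \<inter> carrier G. act V k v = v)"

definition invariant_subspace ::
    "('g, 'h) monoid_scheme \<Rightarrow> ('g, 'v) rep \<Rightarrow> 'v set \<Rightarrow> bool" where
  "invariant_subspace G V U \<longleftrightarrow>
     submodule U complex_ring V \<and> (\<forall>g \<in> carrier G. \<forall>u \<in> U. act V g u \<in> U)"

definition sub_rep :: "('g, 'v) rep \<Rightarrow> 'v set \<Rightarrow> ('g, 'v) rep" where
  "sub_rep V U = V\<lparr>carrier := U\<rparr>"

definition irreducible_rep :: "('g, 'h) monoid_scheme \<Rightarrow> ('g, 'v) rep \<Rightarrow> bool" where
  "irreducible_rep G V \<longleftrightarrow>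
     representation G V \<and> carrier V \<noteq> {\<zero>\<^bsub>V\<^esub>} \<and>
     (\<forall>U. invariant_subspace G V U \<longrightarrow> U = {\<zero>\<^bsub>V\<^esub>} \<or> U = carrier V)"

definition rep_equiv ::
    "('g, 'h) monoid_scheme \<Rightarrow> ('g, 'v) rep \<Rightarrow> ('g, 'w) rep \<Rightarrow> bool" where
  "rep_equiv G V W \<longleftrightarrow>
     (\<exists>f. bij_betw f (carrier V) (carrier W) \<and> linear_between V W f \<and>
        (\<forall>g \<in> carrier G. \<forall>v \<in> carrier V. f (act V g v) = act W g (f v)))"

definition internal_direct_sum ::
    "('g, 'h) monoid_scheme \<Rightarrow> ('g, 'v) rep \<Rightarrow> 'v set \<Rightarrow> 'v set \<Rightarrow> bool" where
  "internal_direct_sum G V P Q \<longleftrightarrow>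
     invariant_subspace G V P \<and> invariant_subspace G V Q \<and>
     P <+>\<^bsub>V\<^esub> Q = carrier V \<and> P \<inter> Q = {\<zero>\<^bsub>V\<^esub>}"

definition fixed_rep :: "('g, 'v) rep \<Rightarrow> 'g set \<Rightarrow> ('g, 'v) rep" where
  "fixed_rep V H = sub_rep V {v \<in> carrier V. \<forall>h \<in> H. act V h v = v}"

text \<open>
  Quotient by an invariant subspace: the vectors are cosets. Scalars and group elements act
  through representatives; the union below is over equal cosets.
\<close>

definition quot_rep :: "('g, 'v) rep \<Rightarrow> 'v set \<Rightarrow> ('g, 'v set) rep" where
  "quot_rep V U =
     \<lparr>carrier = a_rcosets\<^bsub>V\<^esub> U, mult = undefined, one = undefined,
      ring.zero = U, ring.add = set_add V,
      smult = (\<lambda>c S. \<Union>v\<in>S. U +>\<^bsub>V\<^esub> (c \<odot>\<^bsub>V\<^esub> v)),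
      act = (\<lambda>g S. \<Union>v\<in>S. U +>\<^bsub>V\<^esub> act V g v)\<rparr>"

text \<open>
  Smooth non-normalized induction of a character, by right translation. Functions on the group
  are represented by functions on the type vanishing outside the carrier.
\<close>

definition smooth_ind ::
    "('g, 'h) monoid_scheme \<Rightarrow> 'g set set \<Rightarrow> 'g set \<Rightarrow> ('g \<Rightarrow> complex) \<Rightarrow> ('g, 'g \<Rightarrow> complex) rep" where
  "smooth_ind G N H \<psi> =
     \<lparr>carrier = {f. (\<forall>x. x \<notin> carrier G \<longrightarrow> f x = 0) \<and>
                   (\<forall>h \<in> H. \<forall>x \<in> carrier G. f (h \<otimes>\<^bsub>G\<^esub> x) = \<psi> h * f x) \<and>
                   (\<exists>U \<in> N. \<forall>k \<in> U \<inter> carrier G. \<forall>x \<in> carrier G. f (x \<otimes>\<^bsub>G\<^esub> k) = f x)},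
      mult = undefined, one = undefined,
      ring.zero = (\<lambda>_. 0), ring.add = (\<lambda>f g x. f x + g x),
      smult = (\<lambda>c f x. c * f x),
      act = (\<lambda>g f x. if x \<in> carrier G then f (x \<otimes>\<^bsub>G\<^esub> g) else 0)\<rparr>"

section \<open>Genuine characters and principal series\<close>

definition faithful_character :: "nat \<Rightarrow> ('a::field \<Rightarrow> complex) \<Rightarrow> bool" where
  "faithful_character n \<epsilon> \<longleftrightarrow>
     \<epsilon> \<in> hom \<lparr>carrier = roots_of_unity n, mult = (*), one = 1\<rparr> complex_units \<and>
     inj_on \<epsilon> (roots_of_unity n)"

definition genuine_character ::
    "('a::field \<Rightarrow> int) \<Rightarrow> nat \<Rightarrow> ('a \<Rightarrow> complex) \<Rightarrow> 'a cov set \<Rightarrow> ('a cov \<Rightarrow> complex) \<Rightarrow> bool" where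
  "genuine_character val n \<epsilon> H \<psi> \<longleftrightarrow>
     \<psi> \<in> hom ((cover val n)\<lparr>carrier := H\<rparr>) complex_units \<and>
     (\<forall>z \<in> roots_of_unity n. \<psi> (mat 1, z) = \<epsilon> z)"

definition smooth_character ::
    "('a::field \<Rightarrow> int) \<Rightarrow> 'a cov set \<Rightarrow> ('a cov \<Rightarrow> complex) \<Rightarrow> bool" where
  "smooth_character val H \<psi> \<longleftrightarrow> (\<exists>U \<in> congr_basis val. \<forall>k \<in> U \<inter> H. \<psi> k = 1)"

definition primitive_mod ::
    "('a::field \<Rightarrow> int) \<Rightarrow> nat \<Rightarrow> ('a cov \<Rightarrow> complex) \<Rightarrow> nat \<Rightarrow> bool" where
  "primitive_mod val n \<psi> m \<longleftrightarrow>
     m \<ge> 1 \<and> (\<forall>k \<in> torus_center val n \<inter> emb ` congr_subgroup val m. \<psi> k = 1) \<and>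
     (\<forall>r \<ge> 1. (\<forall>k \<in> torus_center val n \<inter> emb ` congr_subgroup val r. \<psi> k = 1) \<longrightarrow> m \<le> r)"

definition has_central_character ::
    "('g, 'h) monoid_scheme \<Rightarrow> ('g, 'v) rep \<Rightarrow> ('g \<Rightarrow> complex) \<Rightarrow> bool" where
  "has_central_character G V \<psi> \<longleftrightarrow>
     (\<forall>z \<in> group_center G. \<forall>v \<in> carrier V. act V z v = \<psi> z \<odot>\<^bsub>V\<^esub> v)"

definition genuine_rep :: "nat \<Rightarrow> ('a::field \<Rightarrow> complex) \<Rightarrow> ('a cov, 'v) rep \<Rightarrow> bool" where
  "genuine_rep n \<epsilon> V \<longleftrightarrow>
     (\<forall>z \<in> roots_of_unity n. \<forall>v \<in> carrier V. act V (mat 1, z) v = \<epsilon> z \<odot>\<^bsub>V\<^esub> v)"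

definition theta :: "('a::field \<Rightarrow> int) \<Rightarrow> 'a \<Rightarrow> nat \<Rightarrow> 'a \<Rightarrow> 'a" where
  "theta val \<omega> n a = hilbert val n \<omega> a"

text \<open>For g = dg t, the unit part of t is a = t / \<omega>^(val t).\<close>

definition chi_twist ::
    "('a::field \<Rightarrow> int) \<Rightarrow> 'a \<Rightarrow> nat \<Rightarrow> ('a cov \<Rightarrow> complex) \<Rightarrow> nat \<Rightarrow> 'a cov \<Rightarrow> complex" where
  "chi_twist val \<omega> n chi0 i = (\<lambda>(g, z).
     let t = g $ 1 $ 1; a = t / \<omega> powi val t
     in chi0 (g, theta val \<omega> n a ^ (2 * i) * z))"

text \<open>
  For u in the unipotent radical, (dg t, z)(u, 1) = (dg t ** u, z), since the Hilbert symbol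
  occurring in the cocycle has first argument 1; so the extension of a character of the torus
  that is trivial on the unipotent radical just reads off the diagonal.
\<close>

definition extend_borel :: "('a::field cov \<Rightarrow> complex) \<Rightarrow> 'a cov \<Rightarrow> complex" where
  "extend_borel \<psi> = (\<lambda>(b, z). \<psi> (dg (b $ 1 $ 1), z))"

definition K_cover :: "('a::field \<Rightarrow> int) \<Rightarrow> nat \<Rightarrow> 'a cov monoid" where
  "K_cover val n = cover_sub val n (SL2_int val)"

definition V_rep ::
    "('a::field \<Rightarrow> int) \<Rightarrow> 'a \<Rightarrow> nat \<Rightarrow> ('a cov \<Rightarrow> complex) \<Rightarrow> nat \<Rightarrow> ('a cov, 'a cov \<Rightarrow> complex) rep" where
  "V_rep val \<omega> n chi0 i =
     smooth_ind (K_cover val n) (congr_basis val) (preim n (borel \<inter> SL2_int val))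
       (extend_borel (chi_twist val \<omega> n chi0 i))"

definition V_fixed ::
    "('a::field \<Rightarrow> int) \<Rightarrow> 'a \<Rightarrow> nat \<Rightarrow> ('a cov \<Rightarrow> complex) \<Rightarrow> nat \<Rightarrow> nat \<Rightarrow>
     ('a cov, 'a cov \<Rightarrow> complex) rep" where
  "V_fixed val \<omega> n chi0 i l = fixed_rep (V_rep val \<omega> n chi0 i) (emb ` congr_subgroup val l)"

definition W_rep ::
    "('a::field \<Rightarrow> int) \<Rightarrow> 'a \<Rightarrow> nat \<Rightarrow> ('a cov \<Rightarrow> complex) \<Rightarrow> nat \<Rightarrow> nat \<Rightarrow>
     ('a cov, ('a cov \<Rightarrow> complex) set) rep" where
  "W_rep val \<omega> n chi0 i l =
     quot_rep (V_fixed val \<omega> n chi0 i l) (carrier (V_fixed val \<omega> n chi0 i (l - 1)))"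

text \<open>The restriction of chi0 to squares of integral torus elements is the character
  a |-> \<epsilon> (theta a)^(-j) of the group of squares of units.\<close>

definition squares_match ::
    "('a::field \<Rightarrow> int) \<Rightarrow> 'a \<Rightarrow> nat \<Rightarrow> ('a \<Rightarrow> complex) \<Rightarrow> ('a cov \<Rightarrow> complex) \<Rightarrow> nat \<Rightarrow> bool" where
  "squares_match val \<omega> n \<epsilon> chi0 j \<longleftrightarrow>
     (\<forall>t \<in> int_units val. chi0 (emb (dg (t\<^sup>2))) = \<epsilon> (theta val \<omega> n (t\<^sup>2) powi (- int j)))"

end

theory Submission
  imports Defs
begin

text \<open>
  Over \<open>SL2(O)\<close> the tame Kubota cocycle is the coboundary of \<open>s(g) = (c,d)_n\<close> (for \<open>c \<noteq> 0\<close>, \<open>val c > 0\<close>,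
  and \<open>s(g) = 1\<close> otherwise), so \<open>V_i\<close> becomes the space of functions on \<open>SL2(O)\<close> that transform on the left
  by the character \<open>\<eta>_i(t) = chi0(dg t) \<epsilon>(\<theta>(t))^(2i)\<close> of the Borel subgroup.

  On level \<open>l = L + 1\<close>, left translation by the lower unipotents with entry in \<open>p^L\<close> decomposes a
  function into components indexed by characters \<open>s\<close> of the residue field; the torus multiplies \<open>s\<close> by
  squares. The component \<open>s = 0\<close> is the space of level \<open>L\<close>, and the square and the non-square \<open>s\<close> give the
  two summands of the quotient. Weighting the component \<open>s = \<delta> r^2\<close> by \<open>\<alpha>(r)\<close> intertwines the summands for
  \<open>\<eta>\<close> and \<open>\<eta> \<alpha>\<close>. Each summand is irreducible: by averaging, an invariant subspace contains a
  vector supported on \<open>c \<in> p\<close> which is an eigenvector of the lower unipotents; the torus moves it to all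
  other such eigenvectors, Fourier inversion on \<open>O / p^L\<close> yields every vector supported on \<open>c \<in> p\<close>, and
  translates of these span.

  For the level \<open>m\<close> pieces, the image of a Borel eigenvector under an intertwining map forces
  \<open>\<eta>_i = \<eta>_k\<close> or \<open>\<eta>_i \<eta>_k = 1\<close>; the latter needs \<open>m = 1\<close>, where the standard intertwining operator, whose
  square is \<open>q \<eta>(-1)\<close>, realises the equivalence.
\<close>

section \<open>Integers, units and residue systems\<close>

text \<open>The decomposition of level L + 1 rests on a gap: functions have level L + 1, while every
  character \<eta>_i has level m <= L. Moving a lower unipotent with entry in p^L past a Borel
  element leaves units congruent modulo p^L, which \<eta>_i cannot separate, and errors in p^(2L),
  which level L + 1 cannot see. The weight \<alpha>(r) on s = \<delta> r^2 is well defined only if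
  \<alpha>(-1) = 1, since r is known up to sign; this is where the exponent 2i, and not i, in the
  twist is decisive. Primitivity of \<chi> speaks about the centre of the torus, but diag(t, 1/t)
  with t in 1 + p is central because the tame symbol is trivial there, so m governs chi0 on the
  units as well. Odd residue characteristic gives exactly two square classes, lifts square roots
  from p to p^L, and makes every element of 1 + p^(m-1) a square modulo p^m when m >= 2, which rules
  out \<eta>_i \<eta>_k = 1 at such m. The quotient is never split by hand: the two projections onto
  square classes of s have the space of level L as common kernel and are jointly onto.\<close>

context nonarch_local_field
begin

text \<open>Levels are written \<open>1\<close> and \<open>L + 1\<close>; rewriting \<open>1\<close>
  to \<open>Suc 0\<close> would hide them from the facts about \<open>pid 1\<close> and
  \<open>cg 1\<close>.\<close>

declare One_nat_def [simp del]

text \<open>The power p^k of the maximal ideal with a natural exponent; \<open>pid 0\<close> is the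
  ring of integers.\<close>

definition pid :: "nat \<Rightarrow> 'a set" where
  "pid k = frac_ideal val (int k)"

text \<open>Congruence modulo p^k on the whole field; integrality is a separate hypothesis wherever
  products are formed.\<close>

definition cg :: "nat \<Rightarrow> 'a \<Rightarrow> 'a \<Rightarrow> bool" where
  "cg k x y \<longleftrightarrow> x - y \<in> pid k"

abbreviation units :: "'a set" where
  "units \<equiv> int_units val"

section \<open>Arithmetic of the valuation, of the ideals p^k and of units\<close>

lemma pid_iff: "x \<in> pid k \<longleftrightarrow> x = 0 \<or> int k \<le> val x"
  by (simp add: pid_def frac_ideal_def)

lemma units_iff: "x \<in> units \<longleftrightarrow> x \<noteq> 0 \<and> val x = 0"
  by (simp add: int_units_def)

lemma val_one [simp]: "val 1 = 0"
  using val_mult[of 1 1] by simp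

lemma val_uminus [simp]: "val (- x) = val x"
proof (cases "x = 0")
  case False
  have "val (-1) = 0"
    using val_mult[of "-1" "-1"] by simp
  then show ?thesis
    using val_mult[of "-1" x] False by simp
qed simp

lemma val_inverse: "x \<noteq> 0 \<Longrightarrow> val (inverse x) = - val x"
  using val_mult[of x "inverse x"] by simp

lemma val_divide: "x \<noteq> 0 \<Longrightarrow> y \<noteq> 0 \<Longrightarrow> val (x / y) = val x - val y"
  by (simp add: divide_inverse val_mult val_inverse)

lemma val_power: "x \<noteq> 0 \<Longrightarrow> val (x ^ k) = int k * val x"
  by (induction k) (simp_all add: val_mult algebra_simps)

lemma val_powi: "x \<noteq> 0 \<Longrightarrow> val (x powi k) = k * val x"
  by (simp add: power_int_def val_power val_inverse)

lemma pid_0 [simp]: "0 \<in> pid k"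
  by (simp add: pid_iff)

lemma pid_one [simp]: "1 \<in> pid 0"
  by (simp add: pid_iff)

lemma pid_uminus [simp]: "- x \<in> pid k \<longleftrightarrow> x \<in> pid k"
  by (simp add: pid_iff)

lemma pid_add: "x \<in> pid k \<Longrightarrow> y \<in> pid k \<Longrightarrow> x + y \<in> pid k"
  using val_add[of x y] unfolding pid_iff by fastforce

lemma pid_diff: "x \<in> pid k \<Longrightarrow> y \<in> pid k \<Longrightarrow> x - y \<in> pid k"
  using pid_add[of x k "- y"] by simp

lemma pid_mult: "x \<in> pid i \<Longrightarrow> y \<in> pid j \<Longrightarrow> x * y \<in> pid (i + j)"
  unfolding pid_iff using val_mult[of x y] by (cases "x = 0 \<or> y = 0") auto

lemma pid_mono: "x \<in> pid j \<Longrightarrow> i \<le> j \<Longrightarrow> x \<in> pid i"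
  by (auto simp: pid_iff)

lemma pid_int: "x \<in> pid j \<Longrightarrow> x \<in> pid 0"
  by (rule pid_mono) auto

lemma pid_mult0: "x \<in> pid 0 \<Longrightarrow> y \<in> pid 0 \<Longrightarrow> x * y \<in> pid 0"
  using pid_mult[of x 0 y 0] by simp

lemma pid_multL: "x \<in> pid 0 \<Longrightarrow> y \<in> pid j \<Longrightarrow> x * y \<in> pid j"
  using pid_mult[of x 0 y j] by simp

lemma pid_multR: "x \<in> pid j \<Longrightarrow> y \<in> pid 0 \<Longrightarrow> x * y \<in> pid j"
  using pid_mult[of x j y 0] by simp

lemma pid_power: "x \<in> pid 0 \<Longrightarrow> x ^ k \<in> pid 0"
  by (induction k) (auto intro: pid_mult0)

lemma pid_power_ideal: "x \<in> pid 1 \<Longrightarrow> x ^ k \<in> pid k"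
proof (induction k)
  case (Suc k)
  then show ?case using pid_mult[of x 1 "x ^ k" k] by (simp add: Suc_eq_plus1_left[symmetric])
qed simp

lemma pid_of_nat: "of_nat k \<in> pid 0"
  by (induction k) (auto intro: pid_add)

lemma pid_numeral [simp]: "numeral k \<in> pid 0"
  using pid_of_nat[of "numeral k"] by simp

lemma unif_pid: "\<omega> ^ k \<in> pid k"
  using uniformizer by (simp add: pid_iff val_power)

lemma unif_pid': "\<omega> ^ k \<in> pid 0"
  using unif_pid by (rule pid_int)

lemma unif_mult_pid_iff: "\<omega> ^ j * x \<in> pid (j + k) \<longleftrightarrow> x \<in> pid k"
proof (cases "x = 0")
  case False
  then show ?thesis
    using uniformizer val_mult[of "\<omega> ^ j" x] by (simp add: pid_iff val_power)
qed simp

lemma pid_unif_E: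
  assumes "x \<in> pid k"
  obtains y where "y \<in> pid 0" "x = \<omega> ^ k * y"
proof
  show "x = \<omega> ^ k * (x / \<omega> ^ k)" using uniformizer by simp
  then show "x / \<omega> ^ k \<in> pid 0"
    using assms unif_mult_pid_iff[of k _ 0] by (metis add.right_neutral)
qed

lemma units_pid [simp]: "x \<in> units \<Longrightarrow> x \<in> pid 0"
  by (simp add: pid_iff units_iff)

lemma units_iff_pid: "x \<in> pid 0 \<Longrightarrow> x \<in> units \<longleftrightarrow> x \<notin> pid 1"
  by (auto simp: pid_iff units_iff)

lemma units_nonzero: "x \<in> units \<Longrightarrow> x \<noteq> 0"
  by (simp add: units_iff)

lemma units_mult: "x \<in> units \<Longrightarrow> y \<in> units \<Longrightarrow> x * y \<in> units"
  by (simp add: units_iff val_mult)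

lemma units_mult_iff: "x \<in> pid 0 \<Longrightarrow> y \<in> pid 0 \<Longrightarrow> x * y \<in> units \<longleftrightarrow> x \<in> units \<and> y \<in> units"
  by (cases "x = 0 \<or> y = 0") (auto simp: units_iff val_mult pid_iff)

lemma units_inverse: "x \<in> units \<Longrightarrow> inverse x \<in> units"
  by (simp add: units_iff val_inverse)

lemma units_divide: "x \<in> units \<Longrightarrow> y \<in> units \<Longrightarrow> x / y \<in> units"
  by (simp add: units_iff val_divide)

lemma units_power: "x \<in> units \<Longrightarrow> x ^ k \<in> units"
  by (simp add: units_iff val_power)

lemma units_one [simp]: "1 \<in> units"
  by (simp add: units_iff)

lemma units_uminus [simp]: "- x \<in> units \<longleftrightarrow> x \<in> units"
  by (simp add: units_iff)

section \<open>Congruences modulo p^k\<close>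

lemma cg_refl [simp]: "cg k x x"
  by (simp add: cg_def)

lemma cg_sym: "cg k x y \<Longrightarrow> cg k y x"
  unfolding cg_def using pid_uminus[of "x - y" k] by simp

lemma cg_trans [trans]: "cg k x y \<Longrightarrow> cg k y z \<Longrightarrow> cg k x z"
  unfolding cg_def using pid_add[of "x - y" k "y - z"] by simp

lemma cg_0_iff: "cg k x 0 \<longleftrightarrow> x \<in> pid k"
  by (simp add: cg_def)

lemma cg_mono: "cg j x y \<Longrightarrow> i \<le> j \<Longrightarrow> cg i x y"
  unfolding cg_def by (rule pid_mono)

lemma cg_add: "cg k x y \<Longrightarrow> cg k x' y' \<Longrightarrow> cg k (x + x') (y + y')"
  unfolding cg_def using pid_add[of "x - y" k "x' - y'"] by (simp add: algebra_simps)

lemma cg_uminus: "cg k x y \<Longrightarrow> cg k (- x) (- y)"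
  unfolding cg_def using pid_uminus[of "x - y" k] by (simp add: algebra_simps)

lemma cg_diff: "cg k x y \<Longrightarrow> cg k x' y' \<Longrightarrow> cg k (x - x') (y - y')"
  using cg_add[of k x y "- x'" "- y'"] cg_uminus by simp

lemma cg_mult:
  assumes "cg k x y" "cg k x' y'" "y \<in> pid 0" "x' \<in> pid 0"
  shows "cg k (x * x') (y * y')"
proof -
  have "x * x' - y * y' = (x - y) * x' + y * (x' - y')"
    by (simp add: algebra_simps)
  then show ?thesis
    using assms unfolding cg_def by (simp add: pid_add pid_multR pid_multL)
qed

lemma cg_multL: "cg k x y \<Longrightarrow> z \<in> pid 0 \<Longrightarrow> cg k (z * x) (z * y)"
  unfolding cg_def right_diff_distrib[symmetric] by (rule pid_multL)

lemma cg_multR: "cg k x y \<Longrightarrow> z \<in> pid 0 \<Longrightarrow> cg k (x * z) (y * z)"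
  using cg_multL[of k x y z] by (simp add: mult.commute)

lemma cg_pid: "cg k x y \<Longrightarrow> y \<in> pid k \<Longrightarrow> x \<in> pid k"
  unfolding cg_def using pid_add[of "x - y" k y] by simp

lemma cg_pid0: "cg k x y \<Longrightarrow> y \<in> pid 0 \<Longrightarrow> x \<in> pid 0"
  using cg_pid[of 0 x y] cg_mono by blast

lemma cg_power: "cg k x y \<Longrightarrow> x \<in> pid 0 \<Longrightarrow> y \<in> pid 0 \<Longrightarrow> cg k (x ^ j) (y ^ j)"
  by (induction j) (auto intro!: cg_mult pid_power)

lemma cg_sum: "(\<And>i. i \<in> I \<Longrightarrow> cg k (f i) (g i)) \<Longrightarrow> cg k (sum f I) (sum g I)"
  by (induction I rule: infinite_finite_induct) (auto intro: cg_add)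

lemma cg_units: "cg k x y \<Longrightarrow> 1 \<le> k \<Longrightarrow> y \<in> units \<Longrightarrow> x \<in> units"
  by (metis cg_pid0 cg_mono cg_pid cg_sym units_iff_pid units_pid)

lemma cg_inverse:
  assumes "cg k x y" "x \<in> units" "y \<in> units"
  shows "cg k (inverse x) (inverse y)"
proof -
  have "inverse x - inverse y = - (inverse x * (x - y) * inverse y)"
    using assms by (simp add: units_iff field_simps)
  then show ?thesis
    using assms unfolding cg_def
    by (simp only: pid_uminus) (intro pid_multR pid_multL units_pid units_inverse)
qed

lemma cg_divide:
  "cg k x y \<Longrightarrow> cg k x' y' \<Longrightarrow> y \<in> pid 0 \<Longrightarrow> x' \<in> units \<Longrightarrow> y' \<in> units \<Longrightarrow> cg k (x / x') (y / y')"
  unfolding divide_inverse by (intro cg_mult cg_inverse) (auto intro: units_inverse units_pid)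

lemma cg_cancelL: "cg k (z * x) (z * y) \<Longrightarrow> z \<in> units \<Longrightarrow> cg k x y"
  using cg_multL[of k "z * x" "z * y" "inverse z"] units_inverse[of z]
  by (auto simp: units_nonzero mult.assoc[symmetric])

lemma cg_unif: "cg (j + k) (\<omega> ^ j * x) (\<omega> ^ j * y) \<longleftrightarrow> cg k x y"
  unfolding cg_def right_diff_distrib[symmetric] by (rule unif_mult_pid_iff)

lemma cg_unif': "cg k x y \<Longrightarrow> cg (j + k) (\<omega> ^ j * x) (\<omega> ^ j * y)"
  by (simp add: cg_unif)

lemma units_add_pid: "x \<in> units \<Longrightarrow> y \<in> pid 1 \<Longrightarrow> x + y \<in> units"
  by (rule cg_units[of 1 _ x]) (auto simp: cg_def)

lemma one_add_pid_units: "y \<in> pid k \<Longrightarrow> 1 \<le> k \<Longrightarrow> 1 + y \<in> units"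
  by (meson units_add_pid units_one pid_mono)

section \<open>Complete residue systems modulo p^k, the finite substitute for integration over O /
  p^k\<close>

definition crs :: "nat \<Rightarrow> 'a set \<Rightarrow> bool" where
  "crs k S \<longleftrightarrow> finite S \<and> S \<subseteq> pid 0 \<and> (\<forall>x \<in> pid 0. \<exists>!s. s \<in> S \<and> cg k x s)"

lemma crs_finite: "crs k S \<Longrightarrow> finite S"
  by (simp add: crs_def)

lemma crs_int: "crs k S \<Longrightarrow> s \<in> S \<Longrightarrow> s \<in> pid 0"
  by (auto simp: crs_def)

lemma crs_inj: "crs k S \<Longrightarrow> s \<in> S \<Longrightarrow> t \<in> S \<Longrightarrow> cg k s t \<Longrightarrow> s = t"
  unfolding crs_def by (metis cg_refl subsetD)

lemma crs_ex: "crs k S \<Longrightarrow> x \<in> pid 0 \<Longrightarrow> \<exists>s\<in>S. cg k x s"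
  unfolding crs_def by blast

lemma crs_card_pos: "crs k S \<Longrightarrow> card S > 0"
  by (metis card_gt_0_iff crs_ex crs_finite empty_iff pid_0)

text \<open>The map \<open>\<sigma>\<close> need not send representatives to representatives.
  Rounding its values to \<open>S\<close> gives an injection of a finite set into itself, hence a
  permutation.\<close>

lemma crs_bij_betw:
  assumes S: "crs k S" and \<sigma>: "\<And>s. s \<in> S \<Longrightarrow> \<sigma> s \<in> pid 0"
    and inj: "\<And>s t. s \<in> S \<Longrightarrow> t \<in> S \<Longrightarrow> cg k (\<sigma> s) (\<sigma> t) \<Longrightarrow> s = t"
  obtains \<tau> where "bij_betw \<tau> S S" "\<And>s. s \<in> S \<Longrightarrow> cg k (\<sigma> s) (\<tau> s)"
proof -
  define \<tau> where "\<tau> s = (SOME t. t \<in> S \<and> cg k (\<sigma> s) t)" for s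
  have *: "\<tau> s \<in> S \<and> cg k (\<sigma> s) (\<tau> s)" if "s \<in> S" for s
    unfolding \<tau>_def using crs_ex[OF S \<sigma>[OF that]] by (metis (mono_tags, lifting) someI_ex)
  have "inj_on \<tau> S"
    by (rule inj_onI) (metis * inj cg_trans cg_sym)
  then have "bij_betw \<tau> S S"
    using * by (metis S bij_betw_def crs_finite endo_inj_surj image_subsetI)
  then show ?thesis
    using that * by blast
qed

text \<open>The finite form of a measure-preserving change of variables; translations and scalings
  by units are its two instances below.\<close>

lemma crs_sum_reindex:
  fixes g :: "'a \<Rightarrow> 'b::comm_monoid_add"
  assumes S: "crs k S" and \<sigma>: "\<And>s. s \<in> S \<Longrightarrow> \<sigma> s \<in> pid 0"
    and inj: "\<And>s t. s \<in> S \<Longrightarrow> t \<in> S \<Longrightarrow> cg k (\<sigma> s) (\<sigma> t) \<Longrightarrow> s = t"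
    and g: "\<And>x y. x \<in> pid 0 \<Longrightarrow> y \<in> pid 0 \<Longrightarrow> cg k x y \<Longrightarrow> g x = g y"
  shows "(\<Sum>s\<in>S. g (\<sigma> s)) = (\<Sum>s\<in>S. g s)"
proof -
  obtain \<tau> where \<tau>: "bij_betw \<tau> S S" "\<And>s. s \<in> S \<Longrightarrow> cg k (\<sigma> s) (\<tau> s)"
    by (rule crs_bij_betw[OF S, of \<sigma>]) (use \<sigma> inj in auto)
  have "(\<Sum>s\<in>S. g (\<sigma> s)) = (\<Sum>s\<in>S. g (\<tau> s))"
    using \<tau> \<sigma> by (intro sum.cong refl g) (auto dest: bij_betwE intro: crs_int[OF S])
  then show ?thesis
    using sum.reindex_bij_betw[OF \<tau>(1), of g] by simp
qed

lemma crs_sum_shift: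
  fixes g :: "'a \<Rightarrow> 'b::comm_monoid_add"
  assumes "crs k S" "z \<in> pid 0"
    and "\<And>x y. x \<in> pid 0 \<Longrightarrow> y \<in> pid 0 \<Longrightarrow> cg k x y \<Longrightarrow> g x = g y"
  shows "(\<Sum>s\<in>S. g (s + z)) = (\<Sum>s\<in>S. g s)"
  by (rule crs_sum_reindex[OF assms(1) _ _ assms(3)])
    (auto intro: pid_add crs_int[OF assms(1)] assms(2) crs_inj[OF assms(1)] simp: cg_def)

lemma crs_sum_scale:
  fixes g :: "'a \<Rightarrow> 'b::comm_monoid_add"
  assumes "crs k S" "u \<in> units"
    and "\<And>x y. x \<in> pid 0 \<Longrightarrow> y \<in> pid 0 \<Longrightarrow> cg k x y \<Longrightarrow> g x = g y"
  shows "(\<Sum>s\<in>S. g (u * s)) = (\<Sum>s\<in>S. g s)"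
  by (rule crs_sum_reindex[OF assms(1) _ _ assms(3)])
    (auto intro: pid_mult0 crs_int[OF assms(1)] units_pid[OF assms(2)] crs_inj[OF assms(1)] dest: cg_cancelL[OF _ assms(2)])

lemma crs_sum_single:
  fixes g :: "'a \<Rightarrow> 'b::comm_monoid_add"
  assumes S: "crs k S" and "x \<in> pid 0"
  shows "(\<Sum>s\<in>S. if cg k x s then c else 0) = c"
proof -
  obtain s where s: "s \<in> S" "cg k x s" using crs_ex[OF assms] by blast
  have "(\<Sum>t\<in>S. if cg k x t then c else 0) = (\<Sum>t\<in>S. if t = s then c else 0)"
    using s by (intro sum.cong refl if_cong) (metis crs_inj[OF S] cg_trans cg_sym)
  then show ?thesis
    using s crs_finite[OF S] by simp
qed

text \<open>Digit expansion: a system modulo p^(k+1) consists of s + \<omega>^k r, where the new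
  digit r is the residue of (x - s) / \<omega>^k modulo p.\<close>

lemma crs_power_exists:
  assumes R: "crs 1 R"
  shows "\<exists>S. crs k S"
proof (induction k)
  case 0
  have "crs 0 {0}"
    by (auto simp: crs_def cg_0_iff)
  then show ?case by blast
next
  case (Suc k)
  then obtain S where S: "crs k S" by blast
  define S' where "S' = (\<lambda>(s, r). s + \<omega> ^ k * r) ` (S \<times> R)"
  have "crs (Suc k) S'"
    unfolding crs_def
  proof (intro conjI ballI)
    show "finite S'"
      using crs_finite S R by (auto simp: S'_def)
    show "S' \<subseteq> pid 0"
      using crs_int[OF S] crs_int[OF R] unif_pid' by (auto simp: S'_def intro!: pid_add pid_mult0)
    fix x assume x: "x \<in> pid 0"
    obtain s where s: "s \<in> S" "cg k x s" using crs_ex[OF S x] by blast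
    then obtain y where y: "y \<in> pid 0" "x - s = \<omega> ^ k * y"
      using pid_unif_E[of "x - s" k] by (auto simp: cg_def)
    obtain r where r: "r \<in> R" "cg 1 y r" using crs_ex[OF R y(1)] by blast
    show "\<exists>!t. t \<in> S' \<and> cg (Suc k) x t"
    proof (rule ex1I[of _ "s + \<omega> ^ k * r"])
      have "cg (k + 1) (\<omega> ^ k * y) (\<omega> ^ k * r)"
        using r by (simp only: cg_unif)
      then show "s + \<omega> ^ k * r \<in> S' \<and> cg (Suc k) x (s + \<omega> ^ k * r)"
        using s r y unfolding S'_def cg_def by (auto simp: algebra_simps Suc_eq_plus1_left)
      fix t assume t: "t \<in> S' \<and> cg (Suc k) x t"
      then obtain s' r' where t': "s' \<in> S" "r' \<in> R" "t = s' + \<omega> ^ k * r'"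
        by (auto simp: S'_def)
      have "cg k (s' + \<omega> ^ k * r') s'"
        using t' crs_int[OF R] unif_pid by (auto simp: cg_def intro: pid_multR)
      moreover have "cg k x t" using t cg_mono by (metis le_SucI le_refl)
      ultimately have "cg k x s'" using t' cg_trans by blast
      then have ss: "s' = s" using s t' crs_inj[OF S] by (metis cg_sym cg_trans)
      then have "cg (k + 1) (\<omega> ^ k * y) (\<omega> ^ k * r')"
        using t t' y unfolding cg_def by (auto simp: algebra_simps Suc_eq_plus1_left)
      then have "cg 1 y r'"
        by (simp only: cg_unif)
      then have "r' = r"
        using r t' crs_inj[OF R] by (metis cg_sym cg_trans)
      then show "t = s + \<omega> ^ k * r" using t' ss by simp
    qed
  qed
  then show ?case by blast
qed

end

section \<open>The residue field and Teichmueller representatives\<close>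

context nonarch_local_field
begin

abbreviation "q \<equiv> residue_card val"

section \<open>The quotient ring of the definitions expressed by congruences\<close>

lemma reduction_eq: "reduction val x = {y. cg 1 y x}"
proof -
  have "reduction val x = (\<Union>h\<in>pid 1. {h + x})"
    by (simp add: reduction_def a_r_coset_def' int_ring_def pid_def)
  also have "\<dots> = {y. cg 1 y x}"
    by (auto simp: cg_def intro!: bexI[of _ "_ - x"])
  finally show ?thesis .
qed

lemma reduction_eq_iff: "reduction val x = reduction val y \<longleftrightarrow> cg 1 x y"
proof
  assume "reduction val x = reduction val y"
  moreover have "x \<in> reduction val x" by (simp add: reduction_eq)
  ultimately have "x \<in> reduction val y" by simp
  then show "cg 1 x y" by (simp add: reduction_eq)
next
  assume "cg 1 x y"
  then show "reduction val x = reduction val y"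
    unfolding reduction_eq using cg_trans cg_sym by blast
qed

lemma carrier_residue_field: "carrier (residue_field val) = reduction val ` pid 0"
  by (auto simp: residue_field_def FactRing_def A_RCOSETS_def' reduction_def int_ring_def pid_def)

lemma residue_mult:
  assumes "x \<in> pid 0" "y \<in> pid 0"
  shows "reduction val x \<otimes>\<^bsub>residue_field val\<^esub> reduction val y = reduction val (x * y)"
proof -
  have "reduction val x \<otimes>\<^bsub>residue_field val\<^esub> reduction val y
      = (\<Union>a\<in>reduction val x. \<Union>b\<in>reduction val y. reduction val (a * b))"
    by (simp add: residue_field_def FactRing_def rcoset_mult_def reduction_def int_ring_def)
  also have "\<dots> = reduction val (x * y)"
  proof -
    have "reduction val (a * b) = reduction val (x * y)"
      if "a \<in> reduction val x" "b \<in> reduction val y" for a b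
    proof -
      have "cg 1 a x" "cg 1 b y" using that by (simp_all add: reduction_eq)
      then show ?thesis
        unfolding reduction_eq_iff using assms by (intro cg_mult) (blast intro: cg_pid0)+
    qed
    note * = this
    have "x \<in> reduction val x" "y \<in> reduction val y"
      by (simp_all add: reduction_eq)
    then show ?thesis
      by (intro equalityI UN_least) (blast dest: *[THEN equalityD1], blast)
  qed
  finally show ?thesis .
qed

lemma residue_power:
  "x \<in> pid 0 \<Longrightarrow> reduction val x [^]\<^bsub>residue_field val\<^esub> (k::nat) = reduction val (x ^ k)"
proof (induction k)
  case 0
  have "\<one>\<^bsub>residue_field val\<^esub> = reduction val 1"
    by (simp add: residue_field_def FactRing_def reduction_def int_ring_def)
  then show ?case by (simp add: nat_pow_def)
next
  case (Suc k)
  then show ?case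
    by (simp add: nat_pow_def residue_mult pid_power mult.commute)
qed

lemma crs_exists: "\<exists>S. crs 1 S \<and> card S = q"
proof -
  define C where "C = carrier (residue_field val)"
  have "\<forall>A\<in>C. \<exists>x. x \<in> pid 0 \<and> reduction val x = A"
    by (auto simp: C_def carrier_residue_field)
  then obtain r where r: "\<And>A. A \<in> C \<Longrightarrow> r A \<in> pid 0 \<and> reduction val (r A) = A"
    by metis
  have "inj_on r C" by (metis inj_onI r)
  then have "card (r ` C) = q"
    by (simp add: card_image residue_card_def C_def)
  moreover have "crs 1 (r ` C)"
    unfolding crs_def
  proof (intro conjI ballI)
    show "finite (r ` C)" "r ` C \<subseteq> pid 0"
      using finite_residue_field r by (auto simp: C_def)
    fix x assume x: "x \<in> pid 0"
    then have "reduction val x \<in> C" by (auto simp: C_def carrier_residue_field)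
    then show "\<exists>!s. s \<in> r ` C \<and> cg 1 x s"
      unfolding reduction_eq_iff[symmetric] using r by (intro ex1I[of _ "r (reduction val x)"]) auto
  qed
  ultimately show ?thesis by blast
qed

text \<open>Translation by 1 permutes the residue classes; comparing the sum of all representatives
  before and after shows that q vanishes in the residue field.\<close>

lemma q_pid: "of_nat q \<in> pid 1"
proof -
  obtain S where S: "crs 1 S" "card S = q" using crs_exists by blast
  obtain \<tau> where \<tau>: "bij_betw \<tau> S S" "\<And>s. s \<in> S \<Longrightarrow> cg 1 (s + 1) (\<tau> s)"
    by (rule crs_bij_betw[OF S(1), of "\<lambda>s. s + 1"])
      (auto intro: pid_add crs_int[OF S(1)] crs_inj[OF S(1)] simp: cg_def)
  have "cg 1 (\<Sum>s\<in>S. s + 1) (\<Sum>s\<in>S. \<tau> s)" by (intro cg_sum \<tau>)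
  moreover have "(\<Sum>s\<in>S. \<tau> s) = (\<Sum>s\<in>S. s)"
    using sum.reindex_bij_betw[OF \<tau>(1), of "\<lambda>x. x"] by simp
  ultimately show ?thesis
    using S by (simp add: sum.distrib cg_def)
qed

lemma q_pos: "q > 1"
proof -
  obtain S where S: "crs 1 S" "card S = q" using crs_exists by blast
  obtain s t where "s \<in> S" "t \<in> S" "cg 1 0 s" "cg 1 1 t"
    using crs_ex[OF S(1)] pid_0 pid_one by metis
  moreover have "s \<noteq> t"
  proof
    assume "s = t"
    then have "cg 1 1 0" using calculation by (metis cg_sym cg_trans)
    then show False by (simp add: cg_0_iff pid_iff)
  qed
  ultimately show ?thesis
    using S card_le_Suc0_iff_eq[of S] crs_finite[OF S(1)] by fastforce
qed

text \<open>Multiplication by \<open>u\<close> permutes the nonzero residues, so their product, a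
  unit, is multiplied by u^(q-1) and yet unchanged modulo p.\<close>

lemma fermat:
  assumes u: "u \<in> units"
  shows "cg 1 (u ^ (q - 1)) 1"
proof -
  obtain S where S: "crs 1 S" "card S = q" using crs_exists by blast
  \<comment> \<open>\<open>z\<close> is the representative of the zero class; the remaining elements
    of \<open>S\<close> are exactly the units among the representatives.\<close>
  obtain z where z: "z \<in> S" "cg 1 0 z" using crs_ex[OF S(1) pid_0] by blast
  have unit: "s \<in> units \<longleftrightarrow> s \<noteq> z" if "s \<in> S" for s
    using crs_inj[OF S(1) that z(1)] z that crs_int[OF S(1)] units_iff_pid
    by (metis cg_0_iff cg_sym cg_trans)
  obtain \<tau> where \<tau>: "bij_betw \<tau> S S" "\<And>s. s \<in> S \<Longrightarrow> cg 1 (u * s) (\<tau> s)"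
    by (rule crs_bij_betw[OF S(1), of "\<lambda>s. u * s"])
      (auto intro: pid_mult0 crs_int[OF S(1)] crs_inj[OF S(1)] units_pid[OF u] dest: cg_cancelL[OF _ u])
  have \<tau>z: "\<tau> s = z \<longleftrightarrow> s = z" if "s \<in> S" for s
  proof -
    have "\<tau> s \<in> S" using \<tau> that by (auto dest: bij_betwE)
    moreover have "\<tau> s \<in> units \<longleftrightarrow> u * s \<in> units"
      using \<tau>(2)[OF that] cg_units cg_sym by (metis order_refl)
    moreover have "u * s \<in> units \<longleftrightarrow> s \<in> units"
      using u crs_int[OF S(1) that] by (simp add: units_mult_iff)
    ultimately show ?thesis using unit that by metis
  qed
  have \<tau>': "bij_betw \<tau> (S - {z}) (S - {z})"
    unfolding bij_betw_def
  proof
    show inj: "inj_on \<tau> (S - {z})" using \<tau>(1) by (auto simp: bij_betw_def inj_on_def)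
    show "\<tau> ` (S - {z}) = S - {z}"
    proof (rule endo_inj_surj[OF _ _ inj])
      show "finite (S - {z})" using S crs_finite by blast
      show "\<tau> ` (S - {z}) \<subseteq> S - {z}" using \<tau>z \<tau>(1) by (auto dest: bij_betwE)
    qed
  qed
  have cgp: "cg 1 (prod (\<lambda>s. u * s) T) (prod \<tau> T) \<and> prod \<tau> T \<in> pid 0 \<and> prod (\<lambda>s. u * s) T \<in> pid 0"
    if "T \<subseteq> S" for T
    using finite_subset[OF that crs_finite[OF S(1)]] that
  proof (induction T)
    case (insert x T)
    have "\<tau> x \<in> pid 0" using \<tau>(1) insert crs_int[OF S(1)] by (auto dest: bij_betwE)
    moreover have "u * x \<in> pid 0" using u insert crs_int[OF S(1)] by (auto intro: pid_mult0)
    ultimately show ?case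
      using insert \<tau>(2)[of x] by (auto intro: cg_mult pid_mult0)
  qed auto
  have "prod (\<lambda>s. s) T \<in> units" if "T \<subseteq> S - {z}" for T
    using finite_subset[OF that] crs_finite[OF S(1)] that
    by (induction T rule: infinite_finite_induct) (auto intro!: units_mult simp: unit)
  then have pu: "prod (\<lambda>s. s) (S - {z}) \<in> units" by blast
  have "prod (\<lambda>s. u * s) (S - {z}) = u ^ (q - 1) * prod (\<lambda>s. s) (S - {z})"
    using S z crs_finite[OF S(1)] by (simp add: prod.distrib)
  moreover have "prod \<tau> (S - {z}) = prod (\<lambda>s. s) (S - {z})"
    using prod.reindex_bij_betw[OF \<tau>', of "\<lambda>x. x"] by simp
  ultimately have "cg 1 (prod (\<lambda>s. s) (S - {z}) * u ^ (q - 1)) (prod (\<lambda>s. s) (S - {z}) * 1)"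
    using cgp[of "S - {z}"] by (auto simp: mult.commute)
  then show ?thesis using pu cg_cancelL by blast
qed

lemma fermat': "u \<in> pid 0 \<Longrightarrow> cg 1 (u ^ q) u"
proof (cases "u \<in> units")
  case True
  have "u ^ q = u ^ (q - 1) * u" using q_pos by (metis mult.commute less_imp_Suc_add One_nat_def power_Suc diff_Suc_1)
  then show ?thesis using fermat[OF True] cg_multR[of 1 "u ^ (q-1)" 1 u] True by simp
next
  case False
  assume "u \<in> pid 0"
  then have "u \<in> pid 1" using False units_iff_pid by blast
  moreover from this have "u ^ q \<in> pid 1"
    using pid_power_ideal[of u q] pid_mono[of "u ^ q" q 1] q_pos by simp
  ultimately show ?thesis by (simp add: cg_def pid_diff)
qed

text \<open>The cofactor of x - y in x^q - y^q is congruent to q y^(q-1), hence lies in p: raising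
  to the power q gains one level of congruence.\<close>

lemma cg_power_q:
  assumes "cg k x y" "k \<ge> 1" "x \<in> pid 0" "y \<in> pid 0"
  shows "cg (Suc k) (x ^ q) (y ^ q)"
proof -
  obtain r where r: "q = Suc r" using q_pos by (metis less_imp_Suc_add)
  have "cg 1 (\<Sum>p<Suc r. x ^ p * y ^ (r - p)) (\<Sum>p<Suc r. y ^ p * y ^ (r - p))"
    using assms cg_mono[OF assms(1), of 1] by (intro cg_sum cg_multR cg_power pid_power) auto
  also have "(\<Sum>p<Suc r. y ^ p * y ^ (r - p)) = of_nat q * y ^ r"
    by (simp add: r power_add[symmetric] del: sum.lessThan_Suc)
  finally have "(\<Sum>p<Suc r. x ^ p * y ^ (r - p)) \<in> pid 1"
    using cg_pid pid_multR[OF q_pid] assms pid_power by blast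
  then have "(x - y) * (\<Sum>p<Suc r. x ^ p * y ^ (r - p)) \<in> pid (k + 1)"
    using assms by (intro pid_mult) (auto simp: cg_def)
  moreover have "x ^ q - y ^ q = (x - y) * (\<Sum>p<Suc r. x ^ p * y ^ (r - p))"
    unfolding r by (subst power_diff_sumr2) (simp add: mult.commute)
  ultimately show ?thesis unfolding cg_def Suc_eq_plus1 by (simp only:)
qed

section \<open>Teichmueller representatives\<close>

lemma pid_all_zero: "(\<And>k. x \<in> pid k) \<Longrightarrow> x = 0"
proof (rule ccontr)
  assume "\<And>k. x \<in> pid k" "x \<noteq> 0"
  then have "int (nat (val x) + 1) \<le> val x" by (simp only: pid_iff) blast
  then show False by linarith
qed

text \<open>The (q-1)-th roots of unity together with 0: the multiplicative residue system modulo
  p.\<close>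

definition teich :: "'a set" where
  "teich = {t. t ^ q = t}"

lemma teich_int: "t \<in> teich \<Longrightarrow> t \<in> pid 0"
proof (cases "t = 0")
  case False
  assume "t \<in> teich"
  then have "int q * val t = val t" using val_power[OF False, of q] by (simp add: teich_def)
  then show ?thesis using q_pos by (auto simp: pid_iff)
qed simp

text \<open>Both elements are fixed by the q-th power map, so \<open>cg_power_q\<close> pushes their
  congruence to every level.\<close>

lemma teich_inj:
  assumes "s \<in> teich" "t \<in> teich" "cg 1 s t"
  shows "s = t"
proof -
  have "cg (Suc k) s t" for k
  proof (induction k)
    case (Suc k)
    then show ?case
      using cg_power_q[OF Suc] assms teich_int by (auto simp: teich_def)
  qed (use assms in \<open>simp add: One_nat_def\<close>)
  then have "s - t \<in> pid k" for k
    using cg_mono[of "Suc k" s t k] by (simp add: cg_def)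
  then show ?thesis using pid_all_zero[of "s - t"] by simp
qed

text \<open>The Teichmueller representative of \<open>u\<close> is the limit of \<open>u, u^q, u^(q^2), \<dots>\<close>.\<close>

lemma teich_exists:
  assumes u: "u \<in> pid 0"
  shows "\<exists>t\<in>teich. cg 1 u t"
proof -
  define s where "s i = u ^ (q ^ i)" for i :: nat
  have s0: "s i \<in> pid 0" for i by (simp add: s_def pid_power u)
  have sS: "s (Suc i) = s i ^ q" for i by (simp add: s_def power_mult[symmetric] mult.commute)
  have step: "cg (Suc i) (s (Suc i)) (s i)" for i
  proof (induction i)
    case 0
    then show ?case using fermat'[OF u] by (simp add: s_def One_nat_def)
  next
    case (Suc i)
    then show ?case using cg_power_q[OF Suc _ s0 s0] by (simp add: sS[symmetric])
  qed
  have far: "cg (Suc i) (s (i + j)) (s i)" for i j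
  proof (induction j)
    case (Suc j)
    have "cg (Suc i) (s (Suc (i + j))) (s (i + j))"
      by (rule cg_mono[OF step]) simp
    then show ?case using Suc cg_trans by auto
  qed simp
  have cau: "cg (Suc k) (s i) (s j)" if "i \<ge> k" "j \<ge> k" for i j k
    using far[of k "i - k"] far[of k "j - k"] that
      cg_trans[OF _ cg_sym, of "Suc k" "s i" "s k" "s j"] by simp
  have "\<exists>L. \<forall>k. \<exists>N::nat. \<forall>i\<ge>N. s i - L \<in> frac_ideal val k"
  proof (rule complete, intro allI)
    fix k :: int
    have "s i - s j \<in> frac_ideal val k" if "i \<ge> nat k" "j \<ge> nat k" for i j
      using cau[OF that] unfolding cg_def pid_iff frac_ideal_def mem_Collect_eq by linarith
    then show "\<exists>N. \<forall>i\<ge>N. \<forall>j\<ge>N. s i - s j \<in> frac_ideal val k" by blast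
  qed
  then obtain L where L: "\<And>k. \<exists>N. \<forall>i\<ge>N. s i - L \<in> frac_ideal val k" by blast
  have sL: "\<exists>N. \<forall>i\<ge>N. cg k (s i) L" for k
    using L[of "int k"] by (auto simp: cg_def pid_def)
  have L0: "L \<in> pid 0"
  proof -
    obtain N where "cg 0 (s N) L" using sL[of 0] by blast
    then show ?thesis using s0[of N] by (blast intro: cg_pid0 cg_sym)
  qed
  have "L ^ q - L \<in> pid k" for k
  proof -
    obtain N where N: "\<forall>i\<ge>N. cg k (s i) L" using sL by blast
    have "cg k (s N ^ q) (L ^ q)" using N s0 L0 by (intro cg_power) auto
    moreover have "cg k (s N ^ q) L" using N unfolding sS[symmetric] by simp
    ultimately show ?thesis unfolding cg_def[symmetric] by (metis cg_sym cg_trans)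
  qed
  then have "L ^ q = L" using pid_all_zero[of "L ^ q - L"] by simp
  moreover obtain N where "\<forall>i\<ge>N. cg 1 (s i) L" using sL by blast
  then have "cg 1 u L"
    using cau[of 0 N 0] cg_trans[of 1 "s 0" "s N" L] cg_sym[of 1 "s N" "s 0"]
    by (auto simp: One_nat_def s_def)
  ultimately show ?thesis by (auto simp: teich_def)
qed

lemma finite_teich: "finite teich" and card_teich: "card teich = q"
proof -
  obtain S where S: "crs 1 S" "card S = q" using crs_exists by blast
  have "\<forall>t\<in>teich. \<exists>s\<in>S. cg 1 t s" using crs_ex[OF S(1)] teich_int by blast
  then obtain f where f: "\<And>t. t \<in> teich \<Longrightarrow> f t \<in> S \<and> cg 1 t (f t)" by metis
  have "bij_betw f teich S"
    unfolding bij_betw_def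
  proof
    show "inj_on f teich"
      by (rule inj_onI) (metis f teich_inj cg_sym cg_trans)
    show "f ` teich = S"
    proof (intro equalityI subsetI)
      fix s assume s: "s \<in> S"
      obtain t where t: "t \<in> teich" "cg 1 s t" using teich_exists crs_int[OF S(1) s] by blast
      then have "f t = s" using f s crs_inj[OF S(1)] by (metis cg_sym cg_trans)
      then show "s \<in> f ` teich" using t by blast
    qed (use f in blast)
  qed
  then show "finite teich" "card teich = q"
    using S crs_finite by (auto dest: bij_betw_finite bij_betw_same_card)
qed

lemma crs_teich: "crs 1 teich"
  unfolding crs_def
proof (intro conjI ballI)
  fix x assume "x \<in> pid 0"
  then obtain t where t: "t \<in> teich" "cg 1 x t" using teich_exists by blast
  then show "\<exists>!s. s \<in> teich \<and> cg 1 x s"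
  proof (intro ex1I[of _ t])
    fix s assume "s \<in> teich \<and> cg 1 x s"
    then show "s = t"
      using t teich_inj[of s t] cg_trans[OF cg_sym, of 1 x s t] by blast
  qed (use t in blast)
qed (use finite_teich teich_int in auto)

lemma teich_0 [simp]: "0 \<in> teich"
  using q_pos by (auto simp: teich_def power_0_left)

lemma teich_1 [simp]: "1 \<in> teich"
  by (simp add: teich_def)

lemma teich_mult: "s \<in> teich \<Longrightarrow> t \<in> teich \<Longrightarrow> s * t \<in> teich"
  by (simp add: teich_def power_mult_distrib)

lemma teich_units: "t \<in> teich \<Longrightarrow> t \<noteq> 0 \<Longrightarrow> t \<in> units"
  using teich_inj[of t 0] units_iff_pid[OF teich_int, of t] teich_0 by (auto simp: cg_0_iff)

lemma teich_power: "t \<in> teich \<Longrightarrow> t ^ k \<in> teich"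
  by (induction k) (simp_all add: teich_mult)

lemma teich_order: "t \<in> teich \<Longrightarrow> t \<noteq> 0 \<Longrightarrow> t ^ (q - 1) = 1"
  by (rule teich_inj) (auto intro!: fermat teich_units teich_power)

text \<open>A polynomial of degree e < q - 1 cannot vanish at all q - 1 nonzero representatives.
  This replaces the choice of a generator of the cyclic group of residues.\<close>

lemma teich_nonroot:
  assumes "0 < e" "e < q - 1"
  shows "\<exists>t\<in>teich - {0}. t ^ e \<noteq> 1"
proof (rule ccontr)
  assume "\<not> ?thesis"
  then have "teich - {0} \<subseteq> {t. poly (Polynomial.monom 1 e - 1) t = 0}"
    by (auto simp: poly_monom)
  moreover have deg: "Polynomial.degree (Polynomial.monom (1::'a) e - 1) = e"
  proof -
    have "Polynomial.degree (Polynomial.monom (1::'a) e + (- 1)) = Polynomial.degree (Polynomial.monom (1::'a) e)"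
      using assms by (intro degree_add_eq_left) (simp add: degree_monom_eq)
    then show ?thesis by (simp add: degree_monom_eq)
  qed
  moreover from deg have "Polynomial.monom (1::'a) e - 1 \<noteq> 0"
    using assms by auto
  ultimately have "card (teich - {0}) \<le> e"
    using card_mono[of "{t. poly (Polynomial.monom 1 e - 1) t = 0}" "teich - {0}"]
      card_poly_roots_bound[of "Polynomial.monom (1::'a) e - 1"] poly_roots_finite[of "Polynomial.monom (1::'a) e - 1"]
    by (simp add: le_trans)
  moreover have "card (teich - {0}) = q - 1"
    using card_Diff_singleton[OF teich_0] card_teich by simp
  ultimately show False
    using assms by linarith
qed

end

section \<open>Matrices and principal series of the maximal compact subgroup\<close>

definition mk :: "'a::field \<Rightarrow> 'a \<Rightarrow> 'a \<Rightarrow> 'a \<Rightarrow> 'a mat2" where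
  "mk a b c d = vector [vector [a, b], vector [c, d]]"

lemma mk_nth [simp]:
  "mk a b c d $ 1 $ 1 = a" "mk a b c d $ 1 $ 2 = b" "mk a b c d $ 2 $ 1 = c" "mk a b c d $ 2 $ 2 = d"
  by (simp_all add: mk_def)

lemma mk_eta [simp]: "mk (g $ 1 $ 1) (g $ 1 $ 2) (g $ 2 $ 1) (g $ 2 $ 2) = g"
  by (simp add: vec_eq_iff forall_2)

lemma mk_cases: obtains a b c d where "g = mk a b c d"
  by (metis mk_eta)

lemma mk_eq_iff [simp]: "mk a b c d = mk a' b' c' d' \<longleftrightarrow> a = a' \<and> b = b' \<and> c = c' \<and> d = d'"
  by (auto simp: vec_eq_iff forall_2)

lemma mk_mult [simp]:
  "mk a b c d ** mk a' b' c' d' = mk (a * a' + b * c') (a * b' + b * d') (c * a' + d * c') (c * b' + d * d')"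
  by (simp add: vec_eq_iff forall_2 matrix_matrix_mult_def sum_2)

lemma mult_nth:
  fixes g h :: "'a::field mat2"
  shows "(g ** h) $ i $ j = g $ i $ 1 * h $ 1 $ j + g $ i $ 2 * h $ 2 $ j"
  by (simp add: matrix_matrix_mult_def sum_2)

lemma det_mk [simp]: "det (mk a b c d) = a * d - b * c"
  by (simp add: det_2)

lemma dg_mk: "dg t = mk t 0 0 (inverse t)"
  by (simp add: dg_def mk_def)

lemma mat_1_mk: "mat 1 = mk 1 0 0 1"
  by (simp add: vec_eq_iff forall_2 mat_def)

definition lo :: "'a::field \<Rightarrow> 'a mat2" where
  "lo z = mk 1 0 z 1"

context nonarch_local_field
begin

abbreviation K :: "'a mat2 set" where
  "K \<equiv> SL2_int val"

definition mcg :: "nat \<Rightarrow> 'a mat2 \<Rightarrow> 'a mat2 \<Rightarrow> bool" where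
  "mcg k g h \<longleftrightarrow> cg k (g $ 1 $ 1) (h $ 1 $ 1) \<and> cg k (g $ 1 $ 2) (h $ 1 $ 2) \<and>
     cg k (g $ 2 $ 1) (h $ 2 $ 1) \<and> cg k (g $ 2 $ 2) (h $ 2 $ 2)"

lemma mk_K: "mk a b c d \<in> K \<longleftrightarrow> a * d - b * c = 1 \<and> a \<in> pid 0 \<and> b \<in> pid 0 \<and> c \<in> pid 0 \<and> d \<in> pid 0"
  by (simp add: SL2_int_def SL2_def forall_2 pid_def)

lemma K_cases:
  assumes "g \<in> K"
  obtains a b c d where "g = mk a b c d" "a * d - b * c = 1"
    "a \<in> pid 0" "b \<in> pid 0" "c \<in> pid 0" "d \<in> pid 0"
  using assms by (metis mk_K mk_cases)

lemma K_mult: "g \<in> K \<Longrightarrow> h \<in> K \<Longrightarrow> g ** h \<in> K"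
  unfolding SL2_int_def SL2_def pid_def[of 0, simplified, symmetric]
  by (auto simp: det_mul mult_nth intro!: pid_add pid_mult0)

lemma K_one [simp]: "mat 1 \<in> K"
  by (simp add: mat_1_mk mk_K)

text \<open>The adjugate, which inverts a matrix of determinant 1 without leaving the integral
  entries.\<close>

definition adj2 :: "'a mat2 \<Rightarrow> 'a mat2" where
  "adj2 g = mk (g $ 2 $ 2) (- g $ 1 $ 2) (- g $ 2 $ 1) (g $ 1 $ 1)"

lemma K_adj2:
  assumes "g \<in> K"
  shows "adj2 g \<in> K" "g ** adj2 g = mat 1" "adj2 g ** g = mat 1"
  by (rule K_cases[OF assms], simp add: adj2_def mk_K mat_1_mk algebra_simps)+

lemma K_adj2_cancel:
  assumes "g \<in> K"
  shows "x ** g ** adj2 g = x" "x ** adj2 g ** g = x"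
  using K_adj2[OF assms] by (simp_all add: matrix_mul_assoc[symmetric])

lemma dg_K: "t \<in> units \<Longrightarrow> dg t \<in> K"
  by (simp add: dg_mk mk_K units_nonzero units_inverse units_pid)

lemma K_lower_right_unit:
  assumes "mk a b c d \<in> K" "c \<in> pid l" "1 \<le> l"
  shows "d \<in> units"
proof -
  have ad: "a * d = 1 + b * c" and int: "a \<in> pid 0" "b \<in> pid 0" "d \<in> pid 0"
    using assms by (auto simp: mk_K algebra_simps)
  have "b * c \<in> pid l" using int assms pid_multL by blast
  then have "a * d \<in> units" using ad one_add_pid_units[OF _ assms(3), of "b * c"] by simp
  then show "d \<in> units" using int units_mult_iff by auto
qed

lemmas K_lower_right_unit1 = K_lower_right_unit[OF _ _ order_refl]

lemma lo_K [simp]: "z \<in> pid 0 \<Longrightarrow> lo z \<in> K"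
  by (simp add: lo_def mk_K)

lemma lo_add: "lo x ** lo y = lo (x + y)"
  by (simp add: lo_def add.commute)

lemma congr_subgroup_iff: "g \<in> congr_subgroup val k \<longleftrightarrow> g \<in> K \<and> mcg k g (mat 1)"
  by (simp add: congr_subgroup_def mcg_def cg_def pid_def forall_2)

lemma mcg_refl [simp]: "mcg k x x"
  by (simp add: mcg_def)

lemma mcg_sym: "mcg k x y \<Longrightarrow> mcg k y x"
  by (simp add: mcg_def cg_sym)

lemma mcg_mono: "mcg j x y \<Longrightarrow> i \<le> j \<Longrightarrow> mcg i x y"
  by (auto simp: mcg_def intro: cg_mono)

lemma K_entry: "g \<in> K \<Longrightarrow> g $ i $ j \<in> pid 0"
  by (simp add: SL2_int_def pid_def)

lemma mcg_mult:
  assumes "mcg k x y" "mcg k x' y'" "y \<in> K" "x' \<in> K"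
  shows "mcg k (x ** x') (y ** y')"
  using assms unfolding mcg_def by (auto simp: mult_nth intro!: cg_add cg_mult K_entry)

lemma mcg_multR: "mcg k x y \<Longrightarrow> x \<in> K \<Longrightarrow> y \<in> K \<Longrightarrow> z \<in> K \<Longrightarrow> mcg k (x ** z) (y ** z)"
  by (rule mcg_mult) auto

lemma mcg_multL: "mcg k x y \<Longrightarrow> x \<in> K \<Longrightarrow> y \<in> K \<Longrightarrow> z \<in> K \<Longrightarrow> mcg k (z ** x) (z ** y)"
  by (rule mcg_mult) auto

text \<open>Links right invariance under the congruence subgroup, which defines fixed vectors, to
  the entrywise congruence that appears in \<open>ps\<close>.\<close>

lemma mcg_congr_subgroup:
  assumes "x \<in> K" "y \<in> K"
  shows "mcg k x y \<longleftrightarrow> adj2 x ** y \<in> congr_subgroup val k"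
proof
  assume "mcg k x y"
  then have "mcg k (adj2 x ** x) (adj2 x ** y)"
    using assms K_adj2 by (intro mcg_multL) auto
  then show "adj2 x ** y \<in> congr_subgroup val k"
    using assms K_adj2[of x] by (simp add: congr_subgroup_iff K_mult mcg_sym)
next
  assume "adj2 x ** y \<in> congr_subgroup val k"
  then have "mcg k (x ** (adj2 x ** y)) (x ** mat 1)"
    using assms by (intro mcg_multL) (auto simp: congr_subgroup_iff)
  then show "mcg k x y"
    using K_adj2[of x] assms by (simp add: matrix_mul_assoc mcg_sym)
qed

text \<open>A character of the unit group trivial on 1 + p^k, encoded as a function on the field
  with arbitrary values off the units.\<close>

definition unit_char :: "('a \<Rightarrow> complex) \<Rightarrow> nat \<Rightarrow> bool" where
  "unit_char \<eta> k \<longleftrightarrow> (\<forall>s\<in>units. \<forall>t\<in>units. \<eta> (s * t) = \<eta> s * \<eta> t) \<and>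
     (\<forall>t\<in>units. \<eta> t \<noteq> 0 \<and> (cg k t 1 \<longrightarrow> \<eta> t = 1))"

lemma unit_char_mult: "unit_char \<eta> k \<Longrightarrow> s \<in> units \<Longrightarrow> t \<in> units \<Longrightarrow> \<eta> (s * t) = \<eta> s * \<eta> t"
  and unit_char_nonzero: "unit_char \<eta> k \<Longrightarrow> t \<in> units \<Longrightarrow> \<eta> t \<noteq> 0"
  and unit_char_eq_1: "unit_char \<eta> k \<Longrightarrow> t \<in> units \<Longrightarrow> cg k t 1 \<Longrightarrow> \<eta> t = 1"
  and unit_char_one: "unit_char \<eta> k \<Longrightarrow> \<eta> 1 = 1"
  by (auto simp: unit_char_def)

lemma unit_char_mono: "unit_char \<eta> j \<Longrightarrow> j \<le> k \<Longrightarrow> unit_char \<eta> k"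
  unfolding unit_char_def using cg_mono by blast

lemma unit_char_inverse: "unit_char \<eta> k \<Longrightarrow> t \<in> units \<Longrightarrow> \<eta> (inverse t) = inverse (\<eta> t)"
  using unit_char_mult[of \<eta> k t "inverse t"] inverse_unique[of "\<eta> t" "\<eta> (inverse t)"]
  by (simp add: units_inverse units_nonzero unit_char_one)

lemma unit_char_cong: "unit_char \<eta> k \<Longrightarrow> s \<in> units \<Longrightarrow> t \<in> units \<Longrightarrow> cg k s t \<Longrightarrow> \<eta> s = \<eta> t"
  using unit_char_mult[of \<eta> k "s / t" t] unit_char_eq_1[of \<eta> k "s / t"] cg_divide[of k s t t t]
  by (simp add: units_divide units_nonzero)

text \<open>The principal series of level \<open>l\<close>: the third condition says that \<open>F\<close> factors through \<open>SL2(O / p^l)\<close>,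
  which amounts to invariance under the congruence subgroup on either side.\<close>

definition ps :: "('a \<Rightarrow> complex) \<Rightarrow> nat \<Rightarrow> ('a mat2 \<Rightarrow> complex) set" where
  "ps \<eta> l = {F. (\<forall>x. x \<notin> K \<longrightarrow> F x = 0) \<and>
      (\<forall>b \<in> borel \<inter> K. \<forall>x \<in> K. F (b ** x) = \<eta> (b $ 1 $ 1) * F x) \<and>
      (\<forall>x \<in> K. \<forall>y \<in> K. mcg l x y \<longrightarrow> F x = F y)}"

lemma ps_outside: "F \<in> ps \<eta> l \<Longrightarrow> x \<notin> K \<Longrightarrow> F x = 0"
  and ps_borel: "F \<in> ps \<eta> l \<Longrightarrow> b \<in> borel \<Longrightarrow> b \<in> K \<Longrightarrow> x \<in> K \<Longrightarrow> F (b ** x) = \<eta> (b $ 1 $ 1) * F x"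
  and ps_mcg: "F \<in> ps \<eta> l \<Longrightarrow> mcg l x y \<Longrightarrow> x \<in> K \<Longrightarrow> y \<in> K \<Longrightarrow> F x = F y"
  unfolding ps_def by blast+

lemma ps_I:
  assumes "\<And>x. x \<notin> K \<Longrightarrow> F x = 0"
    and "\<And>b x. b \<in> borel \<Longrightarrow> b \<in> K \<Longrightarrow> x \<in> K \<Longrightarrow> F (b ** x) = \<eta> (b $ 1 $ 1) * F x"
    and "\<And>x y. mcg l x y \<Longrightarrow> x \<in> K \<Longrightarrow> y \<in> K \<Longrightarrow> F x = F y"
  shows "F \<in> ps \<eta> l"
  unfolding ps_def using assms by blast

lemma borel_mk: "mk a b c d \<in> borel \<longleftrightarrow> a * d = 1 \<and> c = 0"
  by (auto simp: borel_def SL2_def)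

text \<open>Left multiplication by the Borel subgroup can change the top row freely, so up to the
  factor from \<open>\<eta>\<close> a function in \<open>ps\<close> depends only on the bottom row
  modulo p^l, and there only up to a unit.\<close>

lemma ps_row:
  assumes F: "F \<in> ps \<eta> l" and K: "mk a b c d \<in> K" "mk a' b' c' d' \<in> K" and t: "t \<in> units"
    and c: "cg l c (t * c')" and d: "cg l d (t * d')"
  shows "F (mk a b c d) = \<eta> (inverse t) * F (mk a' b' c' d')"
proof -
  have int: "a \<in> pid 0" "b \<in> pid 0" "c \<in> pid 0" "d \<in> pid 0" "a' \<in> pid 0" "b' \<in> pid 0" "c' \<in> pid 0" "d' \<in> pid 0"
    and det: "a * d - b * c = 1" "a' * d' - b' * c' = 1"
    using K by (simp_all add: mk_K)
  \<comment> \<open>\<open>\<alpha>\<close> and \<open>\<beta>\<close> form the top row of the first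
    matrix times the inverse of the second. The bottom row of that quotient is (0, t) modulo p^l, so
    \<open>B\<close> below replaces it by an honest Borel element.\<close>
  define \<beta> where "\<beta> = b * a' - a * b'"
  define \<alpha> where "\<alpha> = a * d' - b * c'"
  have \<beta>: "\<beta> \<in> pid 0" and \<alpha>: "\<alpha> \<in> pid 0"
    using int by (auto simp: \<beta>_def \<alpha>_def intro!: pid_diff pid_mult0)
  have tt: "t \<noteq> 0" "inverse t \<in> pid 0" using t by (auto simp: units_nonzero units_inverse units_pid)
  have a: "a = \<alpha> * a' + \<beta> * c'" and b: "b = \<alpha> * b' + \<beta> * d'"
  proof -
    have "\<alpha> * a' + \<beta> * c' = a * (a' * d' - b' * c')" "\<alpha> * b' + \<beta> * d' = b * (a' * d' - b' * c')"
      by (simp_all add: \<alpha>_def \<beta>_def algebra_simps)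
    then show "a = \<alpha> * a' + \<beta> * c'" "b = \<alpha> * b' + \<beta> * d'" using det by simp_all
  qed
  have "cg l (t * \<alpha>) (a * d - b * c)"
  proof -
    have "t * \<alpha> = a * (t * d') - b * (t * c')" by (simp add: \<alpha>_def algebra_simps)
    then show ?thesis using int c d by (auto intro!: cg_diff cg_multL cg_sym[OF c] cg_sym[OF d])
  qed
  then have "cg l (inverse t * (t * \<alpha>)) (inverse t * 1)"
    using tt det by (intro cg_multL) auto
  then have \<alpha>t: "cg l \<alpha> (inverse t)" using tt by (simp add: mult.assoc[symmetric])
  define B where "B = mk (inverse t) \<beta> 0 t"
  have B: "B \<in> borel" "B \<in> K" using t tt \<beta> by (auto simp: B_def borel_mk mk_K)
  have "mcg l (mk a b c d) (B ** mk a' b' c' d')"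
    using c d int \<alpha>t unfolding a b mcg_def B_def
    by (simp add: cg_add cg_multR)
  then have "F (mk a b c d) = F (B ** mk a' b' c' d')"
    using ps_mcg[OF F] K B K_mult by blast
  then show ?thesis
    using ps_borel[OF F B K(2)] by (simp add: B_def)
qed

section \<open>Right translation on the principal series\<close>

definition rt :: "'a mat2 \<Rightarrow> ('a mat2 \<Rightarrow> complex) \<Rightarrow> 'a mat2 \<Rightarrow> complex" where
  "rt g F = (\<lambda>x. if x \<in> K then F (x ** g) else 0)"

lemma rt_eq: "x \<in> K \<Longrightarrow> rt g F x = F (x ** g)"
  by (simp add: rt_def)

lemma rt_ps:
  assumes "g \<in> K" "F \<in> ps \<eta> l"
  shows "rt g F \<in> ps \<eta> l"
proof (rule ps_I)
  fix x y assume "mcg l x y" "x \<in> K" "y \<in> K"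
  then show "rt g F x = rt g F y"
    using ps_mcg[OF assms(2) mcg_multR] assms(1) by (simp add: rt_def K_mult)
next
  fix b x assume "b \<in> borel" "b \<in> K" "x \<in> K"
  then show "rt g F (b ** x) = \<eta> (b $ 1 $ 1) * rt g F x"
    using ps_borel[OF assms(2), of b "x ** g"] assms(1) by (simp add: rt_def K_mult matrix_mul_assoc)
qed (simp add: rt_def)

lemma rt_rt: "g \<in> K \<Longrightarrow> h \<in> K \<Longrightarrow> rt g (rt h F) = rt (g ** h) F"
  by (auto simp: rt_def fun_eq_iff K_mult matrix_mul_assoc)

lemma rt_one: "(\<And>x. x \<notin> K \<Longrightarrow> F x = 0) \<Longrightarrow> rt (mat 1) F = F"
  by (auto simp: rt_def fun_eq_iff)

lemma ps_add: "F \<in> ps \<eta> l \<Longrightarrow> G \<in> ps \<eta> l \<Longrightarrow> (\<lambda>x. F x + G x) \<in> ps \<eta> l"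
  by (rule ps_I) (simp_all add: ps_outside ps_borel distrib_left, blast intro: arg_cong2[of _ _ _ _ "(+)"] ps_mcg)

lemma ps_scale: "F \<in> ps \<eta> l \<Longrightarrow> (\<lambda>x. c * F x) \<in> ps \<eta> l"
  by (rule ps_I) (simp_all add: ps_outside ps_borel, blast intro: ps_mcg)

lemma ps_zero: "(\<lambda>_. 0) \<in> ps \<eta> l"
  by (rule ps_I) auto

end

section \<open>The tame symbol and the splitting of the cocycle\<close>

locale tame_field = nonarch_local_field +
  fixes n :: nat
  assumes n_pos: "n > 0" and n_dvd: "n dvd residue_card val - 1"
begin

lemma root_teich: "z \<in> roots_of_unity n \<Longrightarrow> z \<in> teich"
proof -
  assume "z \<in> roots_of_unity n"
  moreover obtain e where "q - 1 = n * e" using n_dvd by blast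
  ultimately have "z ^ (q - 1) = 1" by (simp add: roots_of_unity_def power_mult)
  then have "z ^ (q - 1) * z = z" by simp
  then show ?thesis
    using q_pos unfolding teich_def power_Suc2[symmetric] by simp
qed

lemma root_nonzero: "z \<in> roots_of_unity n \<Longrightarrow> z \<noteq> 0"
  using n_pos by (auto simp: roots_of_unity_def power_0_left)

lemma root_mult: "z \<in> roots_of_unity n \<Longrightarrow> w \<in> roots_of_unity n \<Longrightarrow> z * w \<in> roots_of_unity n"
  by (simp add: roots_of_unity_def power_mult_distrib)

lemma root_one [simp]: "1 \<in> roots_of_unity n"
  by (simp add: roots_of_unity_def)

lemma root_inverse: "z \<in> roots_of_unity n \<Longrightarrow> inverse z \<in> roots_of_unity n"
  by (simp add: roots_of_unity_def power_inverse)

lemma root_divide: "z \<in> roots_of_unity n \<Longrightarrow> w \<in> roots_of_unity n \<Longrightarrow> z / w \<in> roots_of_unity n"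
  by (simp add: divide_inverse root_mult root_inverse)

lemma root_powi: "z \<in> roots_of_unity n \<Longrightarrow> z powi k \<in> roots_of_unity n"
  by (simp add: roots_of_unity_def power_int_power' power_int_mult flip: power_int_of_nat) 
    (metis mult.commute power_int_1_left power_int_mult power_int_of_nat)

text \<open>The n-th power residue character of units, with values lifted from the residue field to
  the field; all Hilbert symbols below reduce to it.\<close>

definition tame :: "'a \<Rightarrow> 'a" where
  "tame x = (THE z. z \<in> roots_of_unity n \<and> cg 1 z (x ^ ((q - 1) div n)))"

text \<open>The Teichmueller representative of x^((q-1)/n) has n-th power congruent to 1 by
  \<open>fermat\<close>, hence equal to 1: it is an exact root of unity.\<close>

lemma tame_ex1:
  assumes x: "x \<in> units"
  shows "\<exists>!z. z \<in> roots_of_unity n \<and> cg 1 z (x ^ ((q - 1) div n))"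
proof -
  obtain t where t: "t \<in> teich" "cg 1 (x ^ ((q - 1) div n)) t"
    using teich_exists pid_power units_pid[OF x] by blast
  have "cg 1 (x ^ (q - 1)) (t ^ n)"
    using cg_power[OF t(2), of n] n_dvd t teich_int x pid_power
    by (simp add: power_mult[symmetric])
  then have "cg 1 (t ^ n) 1"
    using fermat[OF x] by (metis cg_sym cg_trans)
  then have "t ^ n = 1"
    using teich_inj t teich_power by simp
  show ?thesis
  proof (intro ex1I[of _ t] conjI)
    show "t \<in> roots_of_unity n" "cg 1 t (x ^ ((q - 1) div n))"
      using t \<open>t ^ n = 1\<close> by (simp_all add: roots_of_unity_def cg_sym)
    fix z assume "z \<in> roots_of_unity n \<and> cg 1 z (x ^ ((q - 1) div n))"
    then show "z = t"
      using t cg_trans root_teich teich_inj by blast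
  qed
qed

lemma tame_root: "x \<in> units \<Longrightarrow> tame x \<in> roots_of_unity n"
  and tame_cg: "x \<in> units \<Longrightarrow> cg 1 (tame x) (x ^ ((q - 1) div n))"
  using theI'[OF tame_ex1, of x] unfolding tame_def by auto

lemma tame_nonzero: "x \<in> units \<Longrightarrow> tame x \<noteq> 0"
  using tame_root root_nonzero by blast

lemma tame_unique:
  "x \<in> units \<Longrightarrow> z \<in> roots_of_unity n \<Longrightarrow> cg 1 z (x ^ ((q - 1) div n)) \<Longrightarrow> tame x = z"
  using tame_ex1 tame_root tame_cg by blast

lemma tame_cong: "cg 1 x y \<Longrightarrow> x \<in> units \<Longrightarrow> y \<in> units \<Longrightarrow> tame x = tame y"
  using tame_unique[OF _ tame_root[of y], of x] cg_trans[OF tame_cg[of y] cg_power[OF cg_sym], of x] by simp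

lemma tame_mult: "x \<in> units \<Longrightarrow> y \<in> units \<Longrightarrow> tame (x * y) = tame x * tame y"
proof (rule tame_unique)
  assume "x \<in> units" "y \<in> units"
  then show "cg 1 (tame x * tame y) ((x * y) ^ ((q - 1) div n))"
    unfolding power_mult_distrib
    by (intro cg_mult tame_cg pid_power units_pid teich_int[OF root_teich] tame_root)
qed (auto intro: units_mult root_mult tame_root)

lemma tame_one [simp]: "tame 1 = 1"
  by (rule tame_unique) auto

lemma tame_inverse: "x \<in> units \<Longrightarrow> tame (inverse x) = inverse (tame x)"
  using tame_mult[of x "inverse x"] inverse_unique[of "tame x" "tame (inverse x)"]
  by (simp add: units_inverse units_nonzero)

lemma tame_power: "x \<in> units \<Longrightarrow> tame (x ^ k) = tame x ^ k"
  by (induction k) (simp_all add: tame_mult units_power)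

lemma tame_powi: "x \<in> units \<Longrightarrow> tame (x powi k) = tame x powi k"
  by (simp add: power_int_def tame_power tame_inverse units_inverse)

section \<open>The Hilbert symbol in terms of the tame character, and the splitting over integral
  matrices\<close>

lemma hilbert_eq:
  assumes "a \<noteq> 0" "b \<noteq> 0"
  shows "hilbert val n a b = tame ((- 1) powi (val a * val b) * (a powi val b / b powi val a))"
proof -
  define c where "c = (- 1) powi (val a * val b) * (a powi val b / b powi val a)"
  have "c \<in> units"
    using assms by (simp add: c_def units_iff val_mult val_divide val_powi)
  then show ?thesis
    unfolding hilbert_def c_def[symmetric] tame_def Let_def
    by (simp only: residue_power units_pid reduction_eq_iff)
qed

lemma hilbert_unit_left: "a \<in> units \<Longrightarrow> b \<noteq> 0 \<Longrightarrow> hilbert val n a b = tame a powi val b"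
  by (simp add: hilbert_eq units_nonzero tame_powi) (simp add: units_iff tame_powi)

lemma hilbert_unit_right: "a \<noteq> 0 \<Longrightarrow> b \<in> units \<Longrightarrow> hilbert val n a b = tame b powi (- val a)"
  by (simp add: hilbert_eq units_nonzero tame_powi[symmetric]) (simp add: units_iff power_int_minus divide_inverse)

lemma hilbert_same_val:
  assumes "a \<noteq> 0" "b \<noteq> 0" "val a = val b"
  shows "hilbert val n a b = tame (- a / b) powi val b"
proof -
  have "(- 1 :: 'a) powi (val b * val b) = (- 1) powi val b"
    by (simp add: power_int_minus_left)
  then have "(- 1) powi (val a * val b) * (a powi val b / b powi val a) = (- a / b) powi val b"
    using power_int_mult_distrib[of "-1" "a / b" "val b"] assms by (simp add: power_int_divide_distrib)
  moreover have "- a / b \<in> units"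
    using assms by (simp add: units_iff val_divide)
  ultimately show ?thesis
    using assms by (simp add: hilbert_eq tame_powi)
qed

text \<open>In an integral matrix of determinant 1 whose entry c is a nonzero nonunit, d is a unit
  and (c,d)_n is this power of \<open>tame d\<close>.\<close>

definition split_factor :: "'a \<Rightarrow> 'a \<Rightarrow> 'a" where
  "split_factor c d = (if c \<noteq> 0 \<and> val c > 0 then tame d powi (- val c) else 1)"

text \<open>Three valuations \<open>x, y, z\<close> of the lower left entries of two integral matrices and of their
  product enter; the three formulas for the tame symbol cover \<open>x < y\<close>, \<open>x > y\<close>, \<open>x = y\<close>.\<close>

lemma kubota_split_scalar:
  fixes a b c d a' b' c' d' :: 'a
  assumes int: "a \<in> pid 0" "b \<in> pid 0" "c \<in> pid 0" "d \<in> pid 0"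
      "a' \<in> pid 0" "b' \<in> pid 0" "c' \<in> pid 0" "d' \<in> pid 0"
    and det: "a * d - b * c = 1" "a' * d' - b' * c' = 1"
  defines "c2 \<equiv> c * a' + d * c'" and "d2 \<equiv> c * b' + d * d'"
  defines "x1 \<equiv> (if c \<noteq> 0 then c else d)" and "x1' \<equiv> (if c' \<noteq> 0 then c' else d')"
    and "x2 \<equiv> (if c2 \<noteq> 0 then c2 else d2)"
  shows "hilbert val n (x2 / x1) (x2 / x1') * split_factor c d * split_factor c' d' = split_factor c2 d2"
proof -
  have d_unit: "d \<in> units" if "c \<in> pid 1"
  proof -
    have "a * d = 1 + b * c" using det by (simp add: algebra_simps)
    then have "a * d \<in> units" using that int one_add_pid_units[of "b * c" 1] pid_multL by simp
    then show ?thesis using int units_mult_iff by blast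
  qed
  have ad'_unit: "d' \<in> units \<and> a' \<in> units \<and> cg 1 (a' * d') 1" if "c' \<in> pid 1"
  proof -
    have "a' * d' = 1 + b' * c'" using det by (simp add: algebra_simps)
    moreover from this have "a' * d' \<in> units" using that int one_add_pid_units[of "b' * c'" 1] pid_multL by simp
    ultimately show ?thesis
      using that int units_mult_iff[of a' d'] pid_multL[of b' c' 1] by (simp add: cg_def)
  qed
  have cg_d2: "cg 1 d2 (d * d')" if "c \<in> pid 1"
    using that int pid_multR by (simp add: d2_def cg_def)
  have tame_d2: "tame d2 = tame d * tame d' \<and> d2 \<in> units" if "c \<in> pid 1" "c' \<in> pid 1"
    using tame_cong[OF cg_d2] cg_units[OF cg_d2] that d_unit ad'_unit by (auto simp: tame_mult units_mult)
  have pos: "x \<in> pid 1" if "x = 0 \<or> 0 < val x" for x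
    using that by (auto simp: pid_iff)
  \<comment> \<open>This is the lower left entry of g = (g h) h^(-1); it governs the cases in which
    c and c' have equal valuation.\<close>
  have key: "c' * d2 + c = d' * c2"
  proof -
    have "c' * d2 + c = c' * d2 + c * (a' * d' - b' * c')" using det by simp
    then show ?thesis by (simp add: c2_def d2_def algebra_simps)
  qed
  consider "c = 0" | "c \<noteq> 0" "c' = 0" | "c \<noteq> 0" "c' \<noteq> 0" "c2 = 0"
    | "c \<noteq> 0" "c' \<noteq> 0" "c2 \<noteq> 0" "val c < val c'"
    | "c \<noteq> 0" "c' \<noteq> 0" "c2 \<noteq> 0" "val c > val c'"
    | "c \<noteq> 0" "c' \<noteq> 0" "c2 \<noteq> 0" "val c = val c'"
    by linarith
  then show ?thesis
  proof cases
    case 1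
    then have d: "d \<in> units" "d \<noteq> 0" using d_unit units_nonzero by auto
    show ?thesis
    proof (cases "c' = 0")
      case True
      then have "d' \<in> units" using ad'_unit by auto
      then show ?thesis
        using 1 True d by (simp add: x1_def x1'_def x2_def c2_def d2_def split_factor_def hilbert_unit_left
            units_nonzero) (simp add: units_iff)
    next
      case False
      then have h: "hilbert val n (x2 / x1) (x2 / x1') = tame d powi (- val c')"
        using 1 d by (simp add: x1_def x1'_def x2_def c2_def hilbert_unit_right)
      show ?thesis
      proof (cases "val c' > 0")
        case True
        then have d': "d' \<in> units" using ad'_unit pos by blast
        show ?thesis
          using 1 d d' False True
          by (simp add: h split_factor_def c2_def d2_def val_mult tame_mult power_int_mult_distrib)
            (simp add: units_iff)
      next
        case v: False
        then have "val c' = 0" using False int by (simp add: pid_iff)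
        then show ?thesis
          using 1 d v by (simp add: h split_factor_def c2_def d2_def val_mult) (simp add: units_iff)
      qed
    qed
  next
    case 2
    then have u: "d' \<in> units" "a' \<in> units" and ad: "a' * d' = 1" using ad'_unit det by auto
    then have c2: "c2 = c * a'" "c2 \<noteq> 0" "val c2 = val c"
      using 2 units_nonzero by (auto simp: c2_def val_mult units_iff)
    have a': "a' = inverse d'" using ad by (metis inverse_unique mult.commute)
    have "hilbert val n (x2 / x1) (x2 / x1') = tame a' powi val (c2 / d')"
      using 2 c2 u by (simp add: x1_def x1'_def x2_def hilbert_unit_left units_nonzero)
    also have "\<dots> = tame d' powi (- val c)"
      using u c2 by (simp add: a' tame_inverse val_divide units_nonzero power_int_minus flip: power_int_inverse)
        (simp add: units_iff)
    finally have h: "hilbert val n (x2 / x1) (x2 / x1') = tame d' powi (- val c)" .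
    show ?thesis
    proof (cases "val c > 0")
      case True
      then show ?thesis
        using 2 c2 tame_d2 pos
        by (simp add: h split_factor_def power_int_mult_distrib mult.commute)
    next
      case False
      then have "val c = 0" using 2 int by (simp add: pid_iff)
      then show ?thesis using 2 c2 by (simp add: h split_factor_def)
    qed
  next
    case 3
    then have cd: "c = - (c' * d2)" using key by (simp add: eq_neg_iff_add_eq_0 add.commute)
    then have d2: "d2 \<noteq> 0" using 3 by auto
    have "(a * a' + b * c') * d2 = 1"
    proof -
      have "(a * a' + b * c') * d2 - (a * b' + b * d') * c2 = (a * d - b * c) * (a' * d' - b' * c')"
        by (simp add: c2_def d2_def algebra_simps)
      then show ?thesis using 3 det by simp
    qed
    then have d2u: "d2 \<in> units"
      using units_mult_iff[of "a * a' + b * c'" d2] int by (simp add: d2_def pid_add pid_mult0)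
    then have v: "val c = val c'"
      using 3 d2 by (simp add: cd val_mult) (simp add: units_iff)
    have "hilbert val n (x2 / x1) (x2 / x1') = tame (- (d2 / c) / (d2 / c')) powi val (d2 / c')"
      using 3 d2 v by (simp add: x1_def x1'_def x2_def hilbert_same_val val_divide)
    also have "- (d2 / c) / (d2 / c') = inverse d2"
      using 3 d2 cd by (simp add: field_simps)
    also have "tame (inverse d2) powi val (d2 / c') = tame d2 powi val c"
      using d2u 3 d2 v by (simp add: tame_inverse val_divide power_int_inverse)
        (simp add: units_iff power_int_minus)
    finally have h: "hilbert val n (x2 / x1) (x2 / x1') = tame d2 powi val c" .
    show ?thesis
    proof (cases "val c > 0")
      case True
      then have "c \<in> pid 1" "c' \<in> pid 1" using pos v by auto
      then show ?thesis
        using 3 True v tame_d2 tame_nonzero[of d] tame_nonzero[of d'] d_unit ad'_unit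
        by (simp add: h split_factor_def power_int_mult_distrib power_int_minus field_simps)
    next
      case False
      then have "val c = 0" using 3 int by (simp add: pid_iff)
      then show ?thesis using 3 v by (simp add: h split_factor_def)
    qed
  next
    case 4
    then have y: "val c' > 0" using int by (auto simp: pid_iff)
    then have u': "d' \<in> units" "a' \<in> units" "cg 1 (a' * d') 1" using ad'_unit pos by auto
    \<comment> \<open>For val c < val c' the quotient A is congruent to a', hence inverse to d'
      modulo p, and the symbol becomes a power of \<open>tame d'\<close>.\<close>
    define A where "A = c2 / c"
    have "c' / c \<in> pid 1" using 4 by (simp add: pid_iff val_divide)
    then have cgA: "cg 1 A a'"
    proof -
      have "A - a' = d * (c' / c)" using 4 by (simp add: A_def c2_def field_simps)
      then show ?thesis
        unfolding cg_def using pid_multL[of d "c' / c" 1] int \<open>c' / c \<in> pid 1\<close> by simp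
    qed
    then have Au: "A \<in> units" using u' cg_units by blast
    then have z: "val c2 = val c" using 4 by (simp add: A_def units_iff val_divide)
    have "cg 1 (A * d') 1" using cg_multR[OF cgA] u' cg_trans by (meson units_pid)
    then have "tame A * tame d' = 1"
      using tame_cong[of "A * d'" 1] Au u' by (simp add: tame_mult units_mult)
    then have tA: "tame A = inverse (tame d')" by (metis inverse_unique mult.commute)
    have "hilbert val n (x2 / x1) (x2 / x1') = tame A powi (val c - val c')"
      using 4 Au by (simp add: x1_def x1'_def x2_def A_def[symmetric] hilbert_unit_left val_divide z)
    then have h: "hilbert val n (x2 / x1) (x2 / x1') = tame d' powi (val c' - val c)"
      by (simp add: tA power_int_inverse flip: power_int_minus)
    note nz = tame_nonzero[OF u'(1)]
    show ?thesis
    proof (cases "val c > 0")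
      case True
      then have "c \<in> pid 1" "c' \<in> pid 1" using pos y by auto
      then show ?thesis
        using 4 True y z tame_d2 tame_nonzero[of d] nz d_unit
        by (simp add: h split_factor_def power_int_mult_distrib power_int_minus power_int_diff field_simps)
    next
      case False
      then have "val c = 0" using 4 int by (simp add: pid_iff)
      then show ?thesis using 4 y z nz by (simp add: h split_factor_def power_int_minus)
    qed
  next
    case 5
    then have x: "val c > 0" using int by (auto simp: pid_iff)
    then have u: "d \<in> units" using d_unit pos by auto
    \<comment> \<open>For val c > val c' the quotient B is congruent to d instead.\<close>
    define B where "B = c2 / c'"
    have "c / c' \<in> pid 1" using 5 by (simp add: pid_iff val_divide)
    then have cgB: "cg 1 B d"
      using 5 int pid_multL[of a' "c / c'" 1]
      by (simp add: B_def c2_def cg_def add_divide_distrib mult.commute)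
    then have Bu: "B \<in> units" using u cg_units by blast
    then have z: "val c2 = val c'" using 5 by (simp add: B_def units_iff val_divide)
    have tB: "tame B = tame d" using tame_cong[OF cgB] Bu u by simp
    have h: "hilbert val n (x2 / x1) (x2 / x1') = tame d powi (val c - val c')"
      using 5 Bu by (simp add: x1_def x1'_def x2_def B_def[symmetric] hilbert_unit_right val_divide z tB)
    note nz = tame_nonzero[OF u(1)]
    show ?thesis
    proof (cases "val c' > 0")
      case True
      then have "c \<in> pid 1" "c' \<in> pid 1" using pos x by auto
      then show ?thesis
        using 5 True x z tame_d2 tame_nonzero[of d'] nz ad'_unit
        by (simp add: h split_factor_def power_int_mult_distrib power_int_minus power_int_diff field_simps)
    next
      case False
      then have "val c' = 0" using 5 int by (simp add: pid_iff)
      then show ?thesis using 5 x z nz by (simp add: h split_factor_def power_int_minus)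
    qed
  next
    case 6
    have "hilbert val n (x2 / x1) (x2 / x1') = tame (- (c2 / c) / (c2 / c')) powi val (c2 / c')"
      using 6 by (simp add: x1_def x1'_def x2_def hilbert_same_val val_divide)
    also have "- (c2 / c) / (c2 / c') = - c' / c"
      using 6 by (simp add: field_simps)
    finally have h: "hilbert val n (x2 / x1) (x2 / x1') = tame (- c' / c) powi (val c2 - val c)"
      using 6 by (simp add: val_divide)
    have c2_val: "val c2 \<ge> val c"
    proof -
      have "c2 / c = a' + d * (c' / c)" using 6 by (simp add: c2_def field_simps)
      moreover have "c' / c \<in> pid 0" using 6 by (simp add: pid_iff val_divide)
      ultimately have "c2 / c \<in> pid 0" using int pid_add pid_mult0 by metis
      then show ?thesis using 6 by (simp add: pid_iff val_divide)
    qed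
    show ?thesis
    proof (cases "val c2 = val c")
      case True
      show ?thesis
      proof (cases "val c > 0")
        case x: True
        then have "c \<in> pid 1" "c' \<in> pid 1" using pos 6 by auto
        then show ?thesis
          using 6 x True tame_d2 by (simp add: h split_factor_def power_int_mult_distrib)
      qed (use 6 True in \<open>simp add: h split_factor_def\<close>)
    next
      case False
      then have z: "val c2 > val c" using c2_val by simp
      \<comment> \<open>Cancellation between the two terms of c2 has raised its valuation. Dividing
        \<open>key\<close> by c gives d2 r = 1 - d' c2 / c, so r is inverse to d2 modulo p.\<close>
      define r where "r = - c' / c"
      have r: "r \<in> units" using 6 by (simp add: r_def units_iff val_divide)
      have "c2 / c \<in> pid 1" using 6 z by (simp add: pid_iff val_divide)
      then have "cg 1 (d2 * r) 1"
        using pid_multL[of "- d'" "c2 / c" 1] int key 6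
        by (simp add: cg_def r_def diff_divide_eq_iff add_divide_eq_iff field_simps)
          (metis (no_types, lifting) add.commute add_diff_cancel_right' diff_minus_eq_add divide_diff_eq_iff
            minus_add_distrib minus_divide_left pid_uminus)
      then have "d2 * r \<in> units" "tame (d2 * r) = 1"
        using cg_units[of 1 "d2 * r" 1] tame_cong[of "d2 * r" 1] by auto
      moreover from this have d2u: "d2 \<in> units"
        using units_mult_iff[of d2 r] r int by (simp add: d2_def pid_add pid_mult0)
      ultimately have "tame r = inverse (tame d2)"
        using r by (metis inverse_unique tame_mult)
      then have h': "hilbert val n (x2 / x1) (x2 / x1') = tame d2 powi (val c - val c2)"
        unfolding h r_def[symmetric] by (simp add: power_int_inverse flip: power_int_minus)
      note nz = tame_nonzero[OF d2u]
      show ?thesis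
      proof (cases "val c > 0")
        case True
        then have "c \<in> pid 1" "c' \<in> pid 1" using pos 6 by auto
        then show ?thesis
          using 6 True z tame_d2 nz d_unit ad'_unit tame_nonzero[of d] tame_nonzero[of d']
          by (simp add: h' split_factor_def power_int_mult_distrib power_int_minus power_int_diff field_simps)
      next
        case False
        then have "val c = 0" using 6 int by (simp add: pid_iff)
        then show ?thesis using 6 z nz by (simp add: h' split_factor_def power_int_minus)
      qed
    qed
  qed
qed

end

section \<open>Additive characters of finite quotients\<close>

lemma roots_of_unity_orthogonal:
  fixes N k :: nat
  assumes "k < N"
  defines "\<zeta> \<equiv> cis (2 * pi / real N)"
  shows "(\<Sum>j<N. \<zeta> ^ (j * k)) = (if k = 0 then of_nat N else 0)" and "\<zeta> ^ (j * N) = 1"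
proof -
  have N: "N > 0" using assms by simp
  have pow: "\<zeta> ^ i = cis (2 * pi * real i / real N)" for i
    unfolding \<zeta>_def Complex.DeMoivre by (simp add: mult_ac)
  have one: "\<zeta> ^ N = 1" using N by (simp add: pow)
  then show "\<zeta> ^ (j * N) = 1" by (metis mult.commute power_mult power_one)
  show "(\<Sum>j<N. \<zeta> ^ (j * k)) = (if k = 0 then of_nat N else 0)"
  proof (cases "k = 0")
    case False
    have "inj_on (\<lambda>k. cis (2 * pi * real k / real N)) {..<N}"
      using Complex.bij_betw_roots_unity[OF N] by (rule bij_betw_imp_inj_on)
    then have "\<zeta> ^ k \<noteq> 1"
      using False assms N unfolding pow inj_on_def by (metis lessThan_iff cis_zero div_0 mult_zero_right of_nat_0)
    moreover have "(\<zeta> ^ k) ^ N = 1" by (metis one mult.commute power_mult power_one)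
    ultimately have "(\<Sum>j<N. (\<zeta> ^ k) ^ j) = 0"
      using geometric_sum[of "\<zeta> ^ k" N] by simp
    then show ?thesis using False by (simp add: power_mult[symmetric] mult.commute)
  qed simp
qed

context nonarch_local_field
begin

definition add_char :: "nat \<Rightarrow> ('a \<Rightarrow> complex) \<Rightarrow> bool" where
  "add_char L \<Lambda> \<longleftrightarrow> (\<forall>x\<in>pid 0. \<forall>y\<in>pid 0. \<Lambda> (x + y) = \<Lambda> x * \<Lambda> y) \<and> (\<forall>x\<in>pid L. \<Lambda> x = 1)"

lemma add_char_add: "add_char L \<Lambda> \<Longrightarrow> x \<in> pid 0 \<Longrightarrow> y \<in> pid 0 \<Longrightarrow> \<Lambda> (x + y) = \<Lambda> x * \<Lambda> y"
  and add_char_pid: "add_char L \<Lambda> \<Longrightarrow> x \<in> pid L \<Longrightarrow> \<Lambda> x = 1"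
  and add_char_0: "add_char L \<Lambda> \<Longrightarrow> \<Lambda> 0 = 1"
  by (simp_all add: add_char_def)

lemma add_char_cong: "add_char L \<Lambda> \<Longrightarrow> x \<in> pid 0 \<Longrightarrow> y \<in> pid 0 \<Longrightarrow> cg L x y \<Longrightarrow> \<Lambda> x = \<Lambda> y"
  using add_char_add[of L \<Lambda> "x - y" y] add_char_pid[of L \<Lambda> "x - y"] by (simp add: cg_def pid_diff)

lemma add_char_minus: "add_char L \<Lambda> \<Longrightarrow> x \<in> pid 0 \<Longrightarrow> \<Lambda> (- x) * \<Lambda> x = 1"
  using add_char_add[of L \<Lambda> "- x" x] by (simp add: add_char_0)

lemma add_char_nonzero: "add_char L \<Lambda> \<Longrightarrow> x \<in> pid 0 \<Longrightarrow> \<Lambda> x \<noteq> 0"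
  using add_char_minus[of L \<Lambda> x] by auto

lemma add_char_scale: "add_char L \<Lambda> \<Longrightarrow> u \<in> pid 0 \<Longrightarrow> add_char L (\<lambda>x. \<Lambda> (u * x))"
  unfolding add_char_def by (simp add: distrib_left pid_mult0 pid_multL)

text \<open>Every translation has finite order modulo \<open>p^L\<close>, so it can be diagonalised by averaging
  over roots of unity; doing this for all residues in turn leaves a simultaneous eigenvector, which is
  a multiple of a character.\<close>

lemma translation_eigenvector:
  assumes add: "\<And>\<phi> \<psi>. \<phi> \<in> S \<Longrightarrow> \<psi> \<in> S \<Longrightarrow> (\<lambda>x. \<phi> x + \<psi> x) \<in> S"
    and scale: "\<And>c \<phi>. \<phi> \<in> S \<Longrightarrow> (\<lambda>x. c * \<phi> x) \<in> S"
    and shift: "\<And>z \<phi>. z \<in> pid 0 \<Longrightarrow> \<phi> \<in> S \<Longrightarrow> (\<lambda>x. \<phi> (x + z)) \<in> S"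
    and per: "\<And>\<phi> x y. \<phi> \<in> S \<Longrightarrow> x \<in> pid 0 \<Longrightarrow> y \<in> pid 0 \<Longrightarrow> cg L x y \<Longrightarrow> \<phi> x = \<phi> y"
    and \<phi>: "\<phi> \<in> S" and x0: "x0 \<in> pid 0" "\<phi> x0 \<noteq> 0"
  obtains \<phi>' \<Lambda> where "\<phi>' \<in> S" "\<phi>' 0 \<noteq> 0" "add_char L \<Lambda>" "\<And>x. x \<in> pid 0 \<Longrightarrow> \<phi>' x = \<phi>' 0 * \<Lambda> x"
proof -
  \<comment> \<open>An exponent of the additive group O / p^L: q lies in p, so N z lies in p^L for
    integral z.\<close>
  define N where "N = q ^ L"
  define \<zeta> where "\<zeta> = cis (2 * pi / real N)"
  have N: "N > 0" using q_pos by (simp add: N_def)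
  have sumS: "(\<lambda>x. \<Sum>k<j. f k x) \<in> S" if "\<And>k. f k \<in> S" for f and j :: nat
  proof (induction j)
    case 0
    show ?case using scale[OF \<phi>, of 0] by simp
  next
    case (Suc j)
    then show ?case using add[OF Suc that[of j]] by simp
  qed
  have Nz: "of_nat N * z \<in> pid L" if "z \<in> pid 0" for z
    using that pid_power_ideal[OF q_pid] by (simp add: N_def pid_multR)
  have step: "\<exists>\<phi>'\<in>S. \<phi>' x0 \<noteq> 0 \<and> (\<exists>\<kappa>. \<forall>x\<in>pid 0. \<phi>' (x + z) = \<kappa> * \<phi>' x) \<and>
      (\<forall>w\<in>pid 0. \<forall>\<mu>. (\<forall>x\<in>pid 0. \<phi> (x + w) = \<mu> * \<phi> x) \<longrightarrow> (\<forall>x\<in>pid 0. \<phi>' (x + w) = \<mu> * \<phi>' x))"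
    if \<phi>: "\<phi> \<in> S" "\<phi> x0 \<noteq> 0" and z: "z \<in> pid 0" for \<phi> z
  proof -
    \<comment> \<open>The component of \<open>\<phi>\<close> with eigenvalue \<zeta>^(-j) for
      translation by z. The components sum to N times \<open>\<phi>\<close>, so one of them survives
      at x0.\<close>
    define \<phi>j where "\<phi>j j = (\<lambda>x. \<Sum>k<N. \<zeta> ^ (j * k) * \<phi> (x + of_nat k * z))" for j
    have kz: "of_nat k * z \<in> pid 0" for k using z pid_of_nat pid_mult0 by blast
    have jS: "\<phi>j j \<in> S" for j
      unfolding \<phi>j_def by (intro sumS scale shift kz \<phi>)
    have "(\<Sum>j<N. \<phi>j j x0) = (\<Sum>k<N. (\<Sum>j<N. \<zeta> ^ (j * k)) * \<phi> (x0 + of_nat k * z))"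
      unfolding \<phi>j_def by (subst sum.swap) (simp add: sum_distrib_right)
    also have "\<dots> = (\<Sum>k<N. (if k = 0 then of_nat N else 0) * \<phi> (x0 + of_nat k * z))"
      by (intro sum.cong refl) (simp add: roots_of_unity_orthogonal \<zeta>_def)
    also have "\<dots> = (\<Sum>k<N. if k = 0 then of_nat N * \<phi> x0 else 0)"
      by (intro sum.cong refl) simp
    also have "\<dots> = of_nat N * \<phi> x0"
      using N by simp
    finally have "(\<Sum>j<N. \<phi>j j x0) \<noteq> 0" using \<phi> N by simp
    then obtain j where j: "\<phi>j j x0 \<noteq> 0" by (meson sum.neutral)
    have eig: "\<zeta> ^ j * \<phi>j j (x + z) = \<phi>j j x" if x: "x \<in> pid 0" for x
    proof -
      define f where "f k = \<zeta> ^ (j * k) * \<phi> (x + of_nat k * z)" for k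
      have "\<zeta> ^ j * \<phi>j j (x + z) = (\<Sum>k<N. f (Suc k))"
        unfolding \<phi>j_def f_def sum_distrib_left by (intro sum.cong refl) (simp add: power_add algebra_simps)
      also have "\<dots> = (\<Sum>k<N. f k) + f N - f 0"
        using sum.lessThan_Suc_shift[of f N] by (simp add: algebra_simps)
      also have "f N = f 0"
      proof -
        have "\<phi> (x + of_nat N * z) = \<phi> x"
          using per[OF \<phi>(1), of "x + of_nat N * z" x] x Nz[OF z] kz by (simp add: cg_def pid_add)
        then show ?thesis
          using roots_of_unity_orthogonal(2)[of 0 N j] N by (simp add: f_def \<zeta>_def)
      qed
      finally show ?thesis by (simp add: f_def \<phi>j_def)
    qed
    have "\<zeta> ^ j \<noteq> 0" by (simp add: \<zeta>_def)
    then have "\<forall>x\<in>pid 0. \<phi>j j (x + z) = inverse (\<zeta> ^ j) * \<phi>j j x"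
      using eig by (metis mult.assoc left_inverse mult_1)
    moreover have "\<phi>j j (x + w) = \<mu> * \<phi>j j x"
      if "w \<in> pid 0" "\<forall>x\<in>pid 0. \<phi> (x + w) = \<mu> * \<phi> x" "x \<in> pid 0" for w \<mu> x
    proof -
      have "\<phi> (x + w + of_nat k * z) = \<mu> * \<phi> (x + of_nat k * z)" for k
        using that(2,3) kz[of k] pid_add[of x 0 "of_nat k * z"] by (metis add.assoc add.commute)
      then show ?thesis unfolding \<phi>j_def sum_distrib_left by (simp add: mult_ac)
    qed
    ultimately show ?thesis using jS j by blast
  qed
  have fin: "\<exists>\<phi>'\<in>S. \<phi>' x0 \<noteq> 0 \<and> (\<forall>z\<in>Z. \<exists>\<kappa>. \<forall>x\<in>pid 0. \<phi>' (x + z) = \<kappa> * \<phi>' x)"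
    if "finite Z" "Z \<subseteq> pid 0" for Z
    using that
  proof (induction Z)
    case empty
    then show ?case using \<phi> x0 by blast
  next
    case (insert z Z)
    then obtain \<phi>1 where 1: "\<phi>1 \<in> S" "\<phi>1 x0 \<noteq> 0"
        "\<And>z. z \<in> Z \<Longrightarrow> \<exists>\<kappa>. \<forall>x\<in>pid 0. \<phi>1 (x + z) = \<kappa> * \<phi>1 x" by auto
    from step[OF 1(1,2), of z] insert.prems obtain \<phi>2 where "\<phi>2 \<in> S" "\<phi>2 x0 \<noteq> 0"
        "\<exists>\<kappa>. \<forall>x\<in>pid 0. \<phi>2 (x + z) = \<kappa> * \<phi>2 x"
        "\<forall>w\<in>pid 0. \<forall>\<mu>. (\<forall>x\<in>pid 0. \<phi>1 (x + w) = \<mu> * \<phi>1 x) \<longrightarrow> (\<forall>x\<in>pid 0. \<phi>2 (x + w) = \<mu> * \<phi>2 x)"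
      by auto
    then show ?case using 1(3) insert.prems by (intro bexI[of _ \<phi>2]) (auto, metis subsetD)
  qed
  obtain Z where Z: "crs L Z" using crs_power_exists[OF crs_teich] by blast
  from fin[of Z] obtain \<phi>' where \<phi>': "\<phi>' \<in> S" "\<phi>' x0 \<noteq> 0"
      "\<And>z. z \<in> Z \<Longrightarrow> \<exists>\<kappa>. \<forall>x\<in>pid 0. \<phi>' (x + z) = \<kappa> * \<phi>' x"
    using crs_finite[OF Z] crs_int[OF Z] by blast
  have eig: "\<exists>\<kappa>. \<forall>x\<in>pid 0. \<phi>' (x + z) = \<kappa> * \<phi>' x" if z: "z \<in> pid 0" for z
  proof -
    obtain z' where z': "z' \<in> Z" "cg L z z'" using crs_ex[OF Z z] by blast
    have "\<phi>' (x + z) = \<phi>' (x + z')" if "x \<in> pid 0" for x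
      using per[OF \<phi>'(1), of "x + z" "x + z'"] that z z' crs_int[OF Z] by (simp add: cg_def pid_add)
    then show ?thesis using \<phi>'(3)[OF z'(1)] by auto
  qed
  have nz: "\<phi>' 0 \<noteq> 0"
    using eig[OF x0(1)] \<phi>'(2) by (metis add_0 mult_zero_right pid_0)
  define \<Lambda> where "\<Lambda> x = \<phi>' x / \<phi>' 0" for x
  have mul: "\<phi>' (x + z) = \<Lambda> z * \<phi>' x" if xz: "x \<in> pid 0" "z \<in> pid 0" for x z
  proof -
    obtain \<kappa> where \<kappa>: "\<forall>x\<in>pid 0. \<phi>' (x + z) = \<kappa> * \<phi>' x" using eig xz by blast
    then have "\<phi>' z = \<kappa> * \<phi>' 0" by (metis add_0 pid_0)
    then have "\<Lambda> z = \<kappa>" using nz by (simp add: \<Lambda>_def)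
    then show ?thesis using \<kappa> xz by simp
  qed
  have "add_char L \<Lambda>"
    unfolding add_char_def
  proof (intro conjI ballI)
    fix x y assume "x \<in> pid 0" "y \<in> pid 0"
    then show "\<Lambda> (x + y) = \<Lambda> x * \<Lambda> y"
      using mul[of x y] unfolding \<Lambda>_def by (simp add: \<Lambda>_def)
  next
    fix x assume "x \<in> pid L"
    then have "\<phi>' x = \<phi>' 0" using per[OF \<phi>'(1), of x 0] pid_int[of x L] by (simp add: cg_def)
    then show "\<Lambda> x = 1" using nz by (simp add: \<Lambda>_def)
  qed
  then show ?thesis
  proof (rule that[OF \<phi>'(1) nz])
    show "\<phi>' x = \<phi>' 0 * \<Lambda> x" for x using nz by (simp add: \<Lambda>_def)
  qed
qed

text \<open>Exact conductor p^L: nontrivial on p^(L-1). Such a character generates the dual of O /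
  p^L by scaling of the argument, see \<open>prim_char_dual\<close>.\<close>

definition prim_char :: "nat \<Rightarrow> ('a \<Rightarrow> complex) \<Rightarrow> bool" where
  "prim_char L \<Lambda> \<longleftrightarrow> add_char L \<Lambda> \<and> 1 \<le> L \<and> (\<exists>w\<in>pid 0. \<Lambda> (\<omega> ^ (L - 1) * w) \<noteq> 1)"

lemma prim_char_add_char: "prim_char L \<Lambda> \<Longrightarrow> add_char L \<Lambda>"
  by (simp add: prim_char_def)

lemma char_sum_zero:
  assumes S: "crs L S" and \<Lambda>: "add_char L \<Lambda>" and x: "x \<in> pid 0" "\<Lambda> x \<noteq> 1"
  shows "(\<Sum>s\<in>S. \<Lambda> s) = 0"
proof -
  have "(\<Sum>s\<in>S. \<Lambda> s) = (\<Sum>s\<in>S. \<Lambda> (s + x))"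
    by (rule crs_sum_shift[OF S x(1), symmetric]) (rule add_char_cong[OF \<Lambda>])
  also have "\<dots> = \<Lambda> x * (\<Sum>s\<in>S. \<Lambda> s)"
    unfolding sum_distrib_left using x crs_int[OF S] add_char_add[OF \<Lambda>] by (intro sum.cong) auto
  finally show ?thesis using x by simp
qed

text \<open>\<open>translation_eigenvector\<close> is applied to the functions on O / p^L whose sums
  over all cosets of p^(L-1) vanish. A character trivial on p^(L-1) has coset sum q at 0, so it
  cannot occur there.\<close>

lemma prim_char_exists:
  assumes "1 \<le> L"
  shows "\<exists>\<Lambda>. prim_char L \<Lambda>"
proof -
  define S :: "('a \<Rightarrow> complex) set" where "S = {\<phi>. (\<forall>x\<in>pid 0. \<forall>y\<in>pid 0. cg L x y \<longrightarrow> \<phi> x = \<phi> y) \<and>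
     (\<forall>x\<in>pid 0. (\<Sum>y\<in>teich. \<phi> (x + \<omega> ^ (L - 1) * y)) = 0)}"
  \<comment> \<open>Two point masses of opposite sign in one coset of p^(L-1): a nonzero element of
    \<open>S\<close>.\<close>
  define \<phi>0 :: "'a \<Rightarrow> complex" where "\<phi>0 x = (if cg L 0 x then 1 else 0) - (if cg L (\<omega> ^ (L - 1)) x then 1 else 0)" for x
  obtain k where L: "L = k + 1" using assms by (metis add.commute le_Suc_ex)
  have S1: "\<phi>0 \<in> S"
    unfolding S_def mem_Collect_eq
  proof (intro conjI ballI impI)
    fix x y :: 'a assume "cg L x y"
    then have "cg L 0 x \<longleftrightarrow> cg L 0 y" "cg L (\<omega> ^ (L - 1)) x \<longleftrightarrow> cg L (\<omega> ^ (L - 1)) y"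
      using cg_trans cg_sym by blast+
    then show "\<phi>0 x = \<phi>0 y" by (simp add: \<phi>0_def)
  next
    fix x assume x: "x \<in> pid 0"
    have eq: "cg L t (x + \<omega> ^ (L - 1) * y) \<longleftrightarrow> cg (L - 1) t x \<and> cg 1 ((t - x) / \<omega> ^ (L - 1)) y"
      if "y \<in> pid 0" for t y
    proof -
      have "\<omega> ^ k * ((t - x) / \<omega> ^ k) = t - x" using uniformizer by simp
      then have "cg L t (x + \<omega> ^ (L - 1) * y) \<longleftrightarrow> cg (k + 1) (\<omega> ^ k * ((t - x) / \<omega> ^ k)) (\<omega> ^ k * y)"
        by (simp only: L cg_def) (simp add: diff_diff_eq)
      also have "\<dots> \<longleftrightarrow> cg 1 ((t - x) / \<omega> ^ k) y"
        by (rule cg_unif)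
      finally have *: "cg L t (x + \<omega> ^ (L - 1) * y) \<longleftrightarrow> cg 1 ((t - x) / \<omega> ^ k) y" .
      have "cg k t x" if "cg L t (x + \<omega> ^ (L - 1) * y)"
      proof -
        have "cg k t (x + \<omega> ^ k * y)" using that cg_mono[of L _ _ k] by (simp add: L)
        moreover have "cg k (x + \<omega> ^ k * y) x"
          using \<open>y \<in> pid 0\<close> unif_pid pid_multR by (simp add: cg_def)
        ultimately show ?thesis by (rule cg_trans)
      qed
      then show ?thesis using * L by auto
    qed
    have "(\<Sum>y\<in>teich. if cg L t (x + \<omega> ^ (L - 1) * y) then 1 else 0 :: complex) = (if cg (L - 1) t x then 1 else 0)"
      if "t \<in> pid 0" for t
    proof (cases "cg (L - 1) t x")
      case True
      then have "(t - x) / \<omega> ^ (L - 1) \<in> pid 0"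
        using unif_mult_pid_iff[of "L - 1" "(t - x) / \<omega> ^ (L - 1)" 0] uniformizer by (simp add: cg_def)
      then show ?thesis
        using crs_sum_single[OF crs_teich, of "(t - x) / \<omega> ^ (L - 1)" "1::complex"] True eq teich_int
        by (simp cong: sum.cong)
    next
      case False
      then show ?thesis using eq teich_int by (simp cong: sum.cong)
    qed
    moreover have "cg (L - 1) (\<omega> ^ (L - 1)) x \<longleftrightarrow> cg (L - 1) 0 x"
      using unif_pid[of "L - 1"] cg_0_iff cg_sym cg_trans by meson
    ultimately show "(\<Sum>y\<in>teich. \<phi>0 (x + \<omega> ^ (L - 1) * y)) = 0"
      using unif_pid'[of "L - 1"] by (simp add: \<phi>0_def sum_subtractf)
  qed
  have S2: "\<phi>0 0 \<noteq> 0"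
  proof -
    have "\<not> cg L (\<omega> ^ (L - 1)) 0"
      using uniformizer by (simp add: cg_0_iff pid_iff val_power L)
    then show ?thesis by (simp add: \<phi>0_def)
  qed
  have S3: "(\<lambda>x. \<phi> x + \<psi> x) \<in> S" if "\<phi> \<in> S" "\<psi> \<in> S" for \<phi> \<psi>
    using that unfolding S_def mem_Collect_eq sum.distrib by (metis add_0)
  have S4: "(\<lambda>x. c * \<phi> x) \<in> S" if "\<phi> \<in> S" for c \<phi>
    using that unfolding S_def mem_Collect_eq sum_distrib_left[symmetric] by (metis mult_zero_right)
  have S5: "(\<lambda>x. \<phi> (x + z)) \<in> S" if "\<phi> \<in> S" "z \<in> pid 0" for z \<phi>
    unfolding S_def mem_Collect_eq
  proof (intro conjI ballI impI)
    fix x y assume "x \<in> pid 0" "y \<in> pid 0" "cg L x y"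
    moreover have "cg L (x + z) (y + z)" using \<open>cg L x y\<close> by (simp add: cg_add)
    ultimately show "\<phi> (x + z) = \<phi> (y + z)" using that pid_add unfolding S_def by blast
  next
    fix x assume "x \<in> pid 0"
    then have "(\<Sum>y\<in>teich. \<phi> (x + z + \<omega> ^ (L - 1) * y)) = 0"
      using that pid_add unfolding S_def by blast
    then show "(\<Sum>y\<in>teich. \<phi> (x + \<omega> ^ (L - 1) * y + z)) = 0" by (simp add: add_ac)
  qed
  have S6: "\<phi> x = \<phi> y" if "\<phi> \<in> S" "x \<in> pid 0" "y \<in> pid 0" "cg L x y" for \<phi> x y
    using that unfolding S_def by blast
  obtain \<phi> \<Lambda> where \<phi>: "\<phi> \<in> S" "\<phi> 0 \<noteq> 0" "add_char L \<Lambda>" "\<And>x. x \<in> pid 0 \<Longrightarrow> \<phi> x = \<phi> 0 * \<Lambda> x"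
    using translation_eigenvector[OF S3 S4 S5 S6 S1 pid_0 S2] by blast
  have "\<exists>w\<in>pid 0. \<Lambda> (\<omega> ^ (L - 1) * w) \<noteq> 1"
  proof (rule ccontr)
    assume "\<not> ?thesis"
    then have "\<phi> (0 + \<omega> ^ (L - 1) * y) = \<phi> 0" if "y \<in> teich" for y
      using \<phi>(4)[of "\<omega> ^ (L - 1) * y"] teich_int[OF that] unif_pid' pid_mult0 by auto
    then have "(\<Sum>y\<in>teich. \<phi> (0 + \<omega> ^ (L - 1) * y)) = of_nat q * \<phi> 0"
      using card_teich by simp
    moreover have "(\<Sum>y\<in>teich. \<phi> (0 + \<omega> ^ (L - 1) * y)) = 0"
      using \<phi>(1) pid_0 unfolding S_def by blast
    ultimately show False using \<phi>(2) q_pos by simp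
  qed
  then show ?thesis using \<phi>(3) assms by (auto simp: prim_char_def)
qed

text \<open>If x is not in p^L, its valuation is below L, so some integral multiple of x equals
  \<omega>^(L-1) w with \<open>\<Lambda>\<close> nontrivial there; the sum then runs over a
  nontrivial character.\<close>

lemma prim_char_sum:
  assumes \<Lambda>: "prim_char L \<Lambda>" and S: "crs L S" and x: "x \<in> pid 0"
  shows "(\<Sum>u\<in>S. \<Lambda> (u * x)) = (if x \<in> pid L then of_nat (card S) else 0)"
proof (cases "x \<in> pid L")
  case True
  then have "\<Lambda> (u * x) = 1" if "u \<in> S" for u
    using crs_int[OF S that] add_char_pid[OF prim_char_add_char[OF \<Lambda>]] pid_multL by blast
  then show ?thesis using True by simp
next
  case False
  obtain w where w: "w \<in> pid 0" "\<Lambda> (\<omega> ^ (L - 1) * w) \<noteq> 1" using \<Lambda> by (auto simp: prim_char_def)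
  have x0: "x \<noteq> 0" "0 \<le> val x" "val x < int L" using False x by (auto simp: pid_iff)
  define u where "u = \<omega> ^ (L - 1) * w / x"
  have "u \<in> pid 0"
    using w x0 uniformizer by (cases "w = 0") (auto simp: pid_iff u_def val_mult val_divide val_power)
  moreover have "u * x = \<omega> ^ (L - 1) * w" using x0 by (simp add: u_def)
  moreover have "add_char L (\<lambda>u. \<Lambda> (u * x))"
    using add_char_scale[OF prim_char_add_char[OF \<Lambda>] x] by (simp add: mult.commute)
  ultimately show ?thesis
    using char_sum_zero[OF S, of "\<lambda>u. \<Lambda> (u * x)" u] w False by simp
qed

text \<open>Self-duality of O / p^L. If \<open>\<Lambda>'\<close> were none of the scaled
  characters, its inner product with each of them would vanish; but their sum over all scalings is
  the number of residues by \<open>prim_char_sum\<close>.\<close>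

lemma prim_char_dual:
  assumes \<Lambda>: "prim_char L \<Lambda>" and \<Lambda>': "add_char L \<Lambda>'"
  obtains u where "u \<in> pid 0" "\<And>x. x \<in> pid 0 \<Longrightarrow> \<Lambda>' x = \<Lambda> (u * x)"
proof -
  obtain S where S: "crs L S" using crs_power_exists[OF crs_teich] by blast
  note \<Lambda>a = prim_char_add_char[OF \<Lambda>]
  have "\<exists>u\<in>S. \<forall>x\<in>pid 0. \<Lambda>' x = \<Lambda> (u * x)"
  proof (rule ccontr)
    assume contra: "\<not> ?thesis"
    have "(\<Sum>z\<in>S. \<Lambda>' (- z) * \<Lambda> (u * z)) = 0" if u: "u \<in> S" for u
    proof -
      obtain x where x: "x \<in> pid 0" "\<Lambda>' x \<noteq> \<Lambda> (u * x)" using contra u by blast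
      have ac: "add_char L (\<lambda>z. \<Lambda>' (- z) * \<Lambda> (u * z))"
        using add_char_scale[OF \<Lambda>a crs_int[OF S u]] add_char_scale[OF \<Lambda>', of "- 1"]
        unfolding add_char_def by simp
      have "\<Lambda>' (- x) * \<Lambda> (u * x) \<noteq> 1"
        using x add_char_minus[OF \<Lambda>' x(1)] add_char_nonzero[OF \<Lambda>', of "-x"]
        by (metis pid_uminus mult_cancel_left)
      then show ?thesis using char_sum_zero[OF S ac x(1)] by simp
    qed
    then have "0 = (\<Sum>u\<in>S. \<Sum>z\<in>S. \<Lambda>' (- z) * \<Lambda> (u * z))" by simp
    also have "\<dots> = (\<Sum>z\<in>S. \<Lambda>' (- z) * (\<Sum>u\<in>S. \<Lambda> (u * z)))"
      by (subst sum.swap) (simp add: sum_distrib_left)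
    also have "\<dots> = (\<Sum>z\<in>S. if cg L 0 z then of_nat (card S) else 0)"
      using crs_int[OF S] prim_char_sum[OF \<Lambda> S] add_char_pid[OF \<Lambda>']
      by (intro sum.cong refl) (auto simp: cg_def)
    also have "\<dots> = of_nat (card S)"
      by (rule crs_sum_single[OF S]) simp
    finally show False using crs_card_pos[OF S] by simp
  qed
  then show ?thesis using that crs_int[OF S] by blast
qed

text \<open>Restricting to p^(L-1) yields a nontrivial character of the residue field.\<close>

lemma prim_char_restrict:
  assumes "prim_char L \<Lambda>"
  shows "prim_char 1 (\<lambda>y. \<Lambda> (\<omega> ^ (L - 1) * y))"
proof -
  have "\<omega> ^ (L - 1) * x \<in> pid L" if "x \<in> pid 1" for x
    using that unif_mult_pid_iff[of "L - 1" x 1] assms by (simp add: prim_char_def)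
  then show ?thesis
    using assms unfolding prim_char_def add_char_def
    by (simp add: distrib_left pid_mult0 unif_pid')
qed

end

section \<open>Square classes\<close>

locale odd_local_field = nonarch_local_field +
  assumes odd_q: "odd (residue_card val)"
begin

lemma two_unit: "2 \<in> units"
proof -
  obtain k where k: "q = 2 * k + 1" using odd_q by (rule oddE)
  have "2 \<notin> pid 1"
  proof
    assume "2 \<in> pid 1"
    then have "of_nat q - 2 * of_nat k \<in> pid 1"
      using pid_diff[OF q_pid pid_multR[OF _ pid_of_nat]] by blast
    then show False by (simp add: k pid_iff)
  qed
  then show ?thesis using units_iff_pid[of 2] by simp
qed

lemma two_nonzero [simp]: "(2::'a) \<noteq> 0"
  using two_unit units_nonzero by blast

lemma cg_squareE:
  assumes "r \<in> units" "s \<in> units" "cg 1 (r\<^sup>2) (s\<^sup>2)"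
  shows "cg 1 r s \<or> cg 1 r (- s)"
proof (rule ccontr)
  assume "\<not> ?thesis"
  then have "r - s \<in> units" "r + s \<in> units"
    using assms units_iff_pid[of "r - s"] units_iff_pid[of "r + s"]
    by (auto simp: cg_def pid_add pid_diff)
  then have "(r - s) * (r + s) \<in> units" by (rule units_mult)
  moreover have "(r - s) * (r + s) \<in> pid 1"
    using assms(3) by (simp add: cg_def algebra_simps power2_eq_square)
  ultimately show False using units_iff_pid[of "(r - s) * (r + s)"] by simp
qed

text \<open>Newton iteration \<open>r \<mapsto> r (1 + x/2)\<close> where \<open>w = r^2 (1 + x)\<close>.\<close>

lemma unit_sqrt:
  assumes w: "w \<in> units" and r: "r \<in> units" "cg 1 w (r\<^sup>2)"
  shows "\<exists>r'\<in>units. cg (Suc k) w (r'\<^sup>2)"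
proof (induction k)
  case 0
  then show ?case using r by (auto simp: One_nat_def)
next
  case (Suc k)
  then obtain s where s: "s \<in> units" "cg (Suc k) w (s\<^sup>2)" by blast
  define x where "x = (w / s\<^sup>2 - 1) / 2"
  have s2: "s\<^sup>2 \<noteq> 0" "inverse (s\<^sup>2) \<in> pid 0"
    using s units_nonzero units_power units_inverse units_pid by auto
  have "w / s\<^sup>2 - 1 = (w - s\<^sup>2) * inverse (s\<^sup>2)"
    using s2 by (simp add: divide_inverse algebra_simps)
  then have "w / s\<^sup>2 - 1 \<in> pid (Suc k)"
    using s s2 pid_multR[of "w - s\<^sup>2" "Suc k"] by (simp add: cg_def)
  then have x: "x \<in> pid (Suc k)"
    unfolding x_def divide_inverse[of _ 2] using two_unit units_inverse units_pid pid_multR by blast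
  have "2 * x = w / s\<^sup>2 - 1" by (simp add: x_def)
  then have "w = s\<^sup>2 * (1 + 2 * x)" using s2 by simp
  then have "w - (s * (1 + x))\<^sup>2 = - (s\<^sup>2 * (x * x))"
    by (simp add: power2_eq_square algebra_simps)
  moreover have "x * x \<in> pid (Suc (Suc k))"
    using pid_mult[OF x x] by (rule pid_mono) simp
  ultimately have "cg (Suc (Suc k)) w ((s * (1 + x))\<^sup>2)"
    using s by (simp add: cg_def pid_multL units_power)
  moreover have "s * (1 + x) \<in> units"
    using s one_add_pid_units[OF x] by (simp add: units_mult One_nat_def)
  ultimately show ?case by blast
qed

text \<open>For a unit \<open>\<delta>\<close>, its class modulo squares of units, tested modulo p
  only; \<open>unit_sqrt\<close> lifts the test to every level.\<close>

definition sq_class :: "'a \<Rightarrow> 'a set" where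
  "sq_class \<delta> = {s \<in> pid 0. \<exists>r\<in>units. cg 1 s (\<delta> * r\<^sup>2)}"

lemma sq_class_self: "\<delta> \<in> units \<Longrightarrow> \<delta> \<in> sq_class \<delta>"
  by (auto simp: sq_class_def intro!: bexI[of _ 1])

lemma sq_class_units: "\<delta> \<in> units \<Longrightarrow> s \<in> sq_class \<delta> \<Longrightarrow> s \<in> units"
  unfolding sq_class_def by (auto intro: cg_units[of 1] units_mult units_power)

lemma sq_class_cong: "cg 1 s t \<Longrightarrow> s \<in> pid 0 \<Longrightarrow> t \<in> pid 0 \<Longrightarrow> s \<in> sq_class \<delta> \<longleftrightarrow> t \<in> sq_class \<delta>"
  unfolding sq_class_def using cg_trans cg_sym by blast

lemma sq_class_scale:
  assumes "t \<in> units" "s \<in> pid 0" "\<delta> \<in> units"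
  shows "t\<^sup>2 * s \<in> sq_class \<delta> \<longleftrightarrow> s \<in> sq_class \<delta>"
proof -
  have *: "u\<^sup>2 * s \<in> sq_class \<delta>" if us: "u \<in> units" "s \<in> sq_class \<delta>" for u s
  proof -
    obtain r where r: "r \<in> units" "cg 1 s (\<delta> * r\<^sup>2)" using us by (auto simp: sq_class_def)
    then have "cg 1 (u\<^sup>2 * s) (u\<^sup>2 * (\<delta> * r\<^sup>2))" using that by (intro cg_multL) (auto simp: units_power)
    then have "cg 1 (u\<^sup>2 * s) (\<delta> * (u * r)\<^sup>2)" by (simp add: power_mult_distrib mult_ac)
    then show ?thesis
      using that r units_mult[of u r] by (auto simp: sq_class_def units_power intro!: pid_mult0)
  qed
  have "inverse t \<in> units" using assms by (simp add: units_inverse)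
  moreover have "(inverse t)\<^sup>2 * (t\<^sup>2 * s) = s"
    using assms units_nonzero[of t] by (simp add: power_inverse)
  ultimately show ?thesis using * assms by metis
qed

lemma square_root_count: "card {t \<in> teich - {0}. t ^ ((q - 1) div 2) = 1} \<le> (q - 1) div 2"
proof -
  define e where "e = (q - 1) div 2"
  have e: "e > 0" using odd_q q_pos by (auto simp: e_def elim!: oddE)
  let ?p = "Polynomial.monom (1::'a) e - 1"
  have deg: "Polynomial.degree ?p = e"
  proof -
    have "Polynomial.degree (Polynomial.monom (1::'a) e + (- 1)) = Polynomial.degree (Polynomial.monom (1::'a) e)"
      using e by (intro degree_add_eq_left) (simp add: degree_monom_eq)
    then show ?thesis by (simp add: degree_monom_eq)
  qed
  moreover from deg have nz: "?p \<noteq> 0" using e by auto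
  moreover have "{t \<in> teich - {0}. t ^ e = 1} \<subseteq> {t. poly ?p t = 0}" by (auto simp: poly_monom)
  ultimately have "card {t \<in> teich - {0}. t ^ e = 1} \<le> card {t. poly ?p t = 0}"
    by (intro card_mono poly_roots_finite)
  also have "\<dots> \<le> e" using card_poly_roots_bound[OF nz] deg by simp
  finally show ?thesis by (simp add: e_def)
qed

text \<open>Euler's criterion with e = (q-1)/2. Squaring on the nonzero Teichmueller representatives
  is at most two-to-one and lands in the at most e solutions of t^e = 1, so squares and solutions
  coincide; any t with t^e = -1 serves as \<open>\<delta>\<close>.\<close>

lemma sq_class_dichotomy:
  obtains \<delta> where "\<delta> \<in> units" "\<And>s. s \<in> units \<Longrightarrow> s \<in> sq_class 1 \<longleftrightarrow> s \<notin> sq_class \<delta>"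
proof -
  define e where "e = (q - 1) div 2"
  have e: "e > 0" "2 * e = q - 1" using odd_q q_pos by (auto simp: e_def elim!: oddE)
  define T where "T = teich - {0}"
  define A where "A = {t \<in> T. t ^ e = 1}"
  have finT: "finite T" and cardT: "card T = 2 * e"
    using finite_teich card_teich card_Diff_singleton[OF teich_0] e by (auto simp: T_def)
  have Tu: "t \<in> units" if "t \<in> T" for t using that teich_units by (simp add: T_def)
  have Qsub: "(\<lambda>t. t\<^sup>2) ` T \<subseteq> A"
    using teich_order e by (auto simp: A_def T_def teich_power power_mult[symmetric])
  have "card T = (\<Sum>x\<in>(\<lambda>t. t\<^sup>2) ` T. card {t \<in> T. t\<^sup>2 = x})"
    using sum.image_gen[OF finT, of "\<lambda>_. 1::nat" "\<lambda>t. t\<^sup>2"] by simp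
  also have "\<dots> \<le> (\<Sum>x\<in>(\<lambda>t. t\<^sup>2) ` T. 2)"
  proof (rule sum_mono)
    fix x assume "x \<in> (\<lambda>t. t\<^sup>2) ` T"
    then obtain r where r: "x = r\<^sup>2" by blast
    have "{t \<in> T. t\<^sup>2 = x} \<subseteq> {r, - r}" by (auto simp: r power2_eq_iff)
    then have "card {t \<in> T. t\<^sup>2 = x} \<le> card {r, - r}" by (rule card_mono[rotated]) simp
    also have "\<dots> \<le> 2" by (simp add: card_insert_if)
    finally show "card {t \<in> T. t\<^sup>2 = x} \<le> 2" .
  qed
  finally have "e \<le> card ((\<lambda>t. t\<^sup>2) ` T)" using cardT by simp
  moreover have "card A \<le> e" using square_root_count by (simp add: A_def T_def e_def)
  ultimately have QA: "(\<lambda>t. t\<^sup>2) ` T = A"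
    using finT Qsub by (intro card_seteq) (auto simp: A_def)
  have alt: "t ^ e = 1 \<or> t ^ e = - 1" if "t \<in> T" for t
  proof -
    have "(t ^ e)\<^sup>2 = 1"
      using that teich_order[of t] e unfolding power_mult[symmetric] T_def by (simp add: mult.commute)
    then show ?thesis by (simp add: power2_eq_1_iff)
  qed
  have one: "(1::'a) \<noteq> - 1" using two_nonzero by (metis add.right_inverse one_add_one)
  obtain \<delta> where \<delta>: "\<delta> \<in> T" "\<delta> ^ e = - 1"
    using teich_nonroot[of e] e alt by (auto simp: T_def)
  have div: "s / t \<in> T" if "s \<in> T" "t \<in> T" for s t
    using that by (auto simp: T_def teich_def power_divide)
  have sq1: "t \<in> sq_class 1 \<longleftrightarrow> t ^ e = 1" and sqd: "t \<in> sq_class \<delta> \<longleftrightarrow> t ^ e = - 1" if t: "t \<in> T" for t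
  proof -
    have gen: "t \<in> sq_class d \<longleftrightarrow> (t / d) ^ e = 1" if d: "d \<in> T" for d
    proof
      assume "t \<in> sq_class d"
      then obtain r where r: "r \<in> units" "cg 1 t (d * r\<^sup>2)" by (auto simp: sq_class_def)
      obtain r' where r': "r' \<in> teich" "cg 1 r r'" using teich_exists r by (meson units_pid)
      then have "r' \<in> T"
        using r cg_units[OF cg_sym, of 1 r r'] units_nonzero by (auto simp: T_def)
      have "cg 1 (d * r\<^sup>2) (d * r'\<^sup>2)"
        using r r' Tu[OF d] teich_int by (intro cg_multL cg_power) auto
      then have "t = d * r'\<^sup>2"
        using r(2) cg_trans t d r' by (intro teich_inj) (auto simp: T_def intro!: teich_mult teich_power)
      then have "t / d = r'\<^sup>2" using d by (simp add: T_def)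
      then show "(t / d) ^ e = 1" using QA \<open>r' \<in> T\<close> by (auto simp: A_def)
    next
      assume "(t / d) ^ e = 1"
      then obtain r where "r \<in> T" "t / d = r\<^sup>2" using QA div[OF t d] by (auto simp: A_def image_iff)
      then have "r \<in> units" "t = d * r\<^sup>2" using Tu d by (auto simp: T_def field_simps)
      then show "t \<in> sq_class d" using Tu[OF t] unfolding sq_class_def by (metis (lifting) cg_refl mem_Collect_eq units_pid)
    qed
    show "t \<in> sq_class 1 \<longleftrightarrow> t ^ e = 1" using gen[of 1] by (simp add: T_def)
    show "t \<in> sq_class \<delta> \<longleftrightarrow> t ^ e = - 1"
      using gen[OF \<delta>(1)] alt[OF t] \<delta>(2) one by (auto simp: power_divide)
  qed
  show ?thesis
  proof (rule that)
    show "\<delta> \<in> units" using \<delta> Tu by blast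
    fix s assume s: "s \<in> units"
    obtain t where t: "t \<in> teich" "cg 1 s t" using teich_exists s by (meson units_pid)
    then have "t \<in> T"
      using s cg_units[OF cg_sym, of 1 s t] units_nonzero by (auto simp: T_def)
    then show "s \<in> sq_class 1 \<longleftrightarrow> s \<notin> sq_class \<delta>"
      using sq1 sqd alt one sq_class_cong[OF t(2)] s t teich_int by (metis units_pid)
  qed
qed

end

section \<open>Decomposition of a level\<close>

text \<open>One step of the filtration, from level L to level L + 1; scalings of
  \<open>\<Lambda>\<close> supply all characters of O / p^L.\<close>

locale level_char = odd_local_field +
  fixes L :: nat and \<Lambda> :: "'a \<Rightarrow> complex"
  assumes prim: "prim_char L \<Lambda>"
begin

lemma L_ge_1: "1 \<le> L"
  using prim by (simp add: prim_char_def)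

lemma \<Lambda>_add_char: "add_char L \<Lambda>"
  using prim by (rule prim_char_add_char)

text \<open>Deriving \<open>\<psi>\<close> from \<open>\<Lambda>\<close> ties two parametrisations
  together: the vector \<open>basic \<eta> u\<close> lies over the component s = u modulo p, see
  \<open>hat_basic_one\<close>.\<close>

definition \<psi> :: "'a \<Rightarrow> complex" where
  "\<psi> y = \<Lambda> (\<omega> ^ (L - 1) * y)"

lemma \<psi>_prim: "prim_char 1 \<psi>"
  using prim_char_restrict[OF prim] by (simp add: \<psi>_def[abs_def])

lemma \<psi>_add_char: "add_char 1 \<psi>"
  using \<psi>_prim by (rule prim_char_add_char)

lemma \<psi>_add: "x \<in> pid 0 \<Longrightarrow> y \<in> pid 0 \<Longrightarrow> \<psi> (x + y) = \<psi> x * \<psi> y"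
  by (rule add_char_add[OF \<psi>_add_char])

lemma \<psi>_0: "\<psi> 0 = 1"
  by (rule add_char_0[OF \<psi>_add_char])

lemma \<psi>_cong: "cg 1 x y \<Longrightarrow> x \<in> pid 0 \<Longrightarrow> y \<in> pid 0 \<Longrightarrow> \<psi> x = \<psi> y"
  using add_char_cong[OF \<psi>_add_char] by blast

lemma \<psi>_sum:
  assumes "x \<in> pid 0"
  shows "(\<Sum>y\<in>teich. \<psi> (x * y)) = (if x \<in> pid 1 then of_nat q else 0)"
  using prim_char_sum[OF \<psi>_prim crs_teich assms] by (simp add: card_teich mult.commute)

text \<open>The level condition alone, so that the calculus of \<open>hat\<close> and
  \<open>op\<close> serves all characters at once.\<close>

definition pf :: "('a mat2 \<Rightarrow> complex) set" where
  "pf = {F. \<forall>x\<in>K. \<forall>y\<in>K. mcg (L + 1) x y \<longrightarrow> F x = F y}"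

lemma pf_mcg: "F \<in> pf \<Longrightarrow> mcg (L + 1) x y \<Longrightarrow> x \<in> K \<Longrightarrow> y \<in> K \<Longrightarrow> F x = F y"
  unfolding pf_def by blast

lemma ps_pf: "F \<in> ps \<eta> (L + 1) \<Longrightarrow> F \<in> pf"
  unfolding pf_def by (blast intro: ps_mcg)

section \<open>Fourier analysis along the lower unipotents with entry in p^L, taken modulo
  p^(L+1)\<close>

definition low :: "'a \<Rightarrow> 'a mat2" where
  "low y = lo (\<omega> ^ L * y)"

lemma low_K: "y \<in> pid 0 \<Longrightarrow> low y \<in> K"
  by (simp add: low_def pid_mult0 unif_pid')

lemma low_add: "low x ** low y = low (x + y)"
  by (simp add: low_def lo_add distrib_left)

lemma low_cong:
  assumes "F \<in> pf" "k \<in> K" "cg 1 y y'" "y \<in> pid 0" "y' \<in> pid 0"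
  shows "F (low y ** k) = F (low y' ** k)"
proof (rule pf_mcg[OF assms(1)])
  have "mcg (L + 1) (low y) (low y')"
    using cg_unif'[OF assms(3), of L] by (simp add: mcg_def low_def lo_def)
  then show "mcg (L + 1) (low y ** k) (low y' ** k)"
    using assms low_K by (intro mcg_multR) auto
qed (use assms low_K K_mult in auto)

text \<open>\<open>hat F k s\<close> is the value at \<open>k\<close> of the component of \<open>F\<close> on which left translation by \<open>low y\<close>
  acts as \<open>\<psi> (s * y)\<close>.\<close>

definition hat :: "('a mat2 \<Rightarrow> complex) \<Rightarrow> 'a mat2 \<Rightarrow> 'a \<Rightarrow> complex" where
  "hat F k s = (\<Sum>y\<in>teich. \<psi> (- (s * y)) * F (low y ** k)) / of_nat q"

lemma q_nonzero: "(of_nat q :: complex) \<noteq> 0"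
  using q_pos by simp

lemma hat_cong:
  assumes "cg 1 s s'" "s \<in> pid 0" "s' \<in> pid 0"
  shows "hat F k s = hat F k s'"
proof -
  have "\<psi> (- (s * y)) = \<psi> (- (s' * y))" if "y \<in> teich" for y
    using assms teich_int[OF that] by (intro \<psi>_cong cg_uminus cg_multR) (auto intro: pid_mult0)
  then show ?thesis unfolding hat_def by (simp cong: sum.cong)
qed

text \<open>Fourier inversion on the residue field: summing over s isolates the term y = 0, where
  \<open>low y\<close> is the identity.\<close>

lemma hat_inversion:
  assumes "F \<in> pf" "k \<in> K"
  shows "(\<Sum>s\<in>teich. hat F k s) = F k"
proof -
  have "(\<Sum>s\<in>teich. hat F k s) = (\<Sum>y\<in>teich. (\<Sum>s\<in>teich. \<psi> (- y * s)) * F (low y ** k)) / of_nat q"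
    unfolding hat_def sum_divide_distrib[symmetric]
    by (subst sum.swap) (simp add: sum_distrib_left mult.commute)
  also have "\<dots> = (\<Sum>y\<in>teich. if cg 1 0 y then of_nat q * F k else 0) / of_nat q"
  proof -
    have "(\<Sum>s\<in>teich. \<psi> (- y * s)) * F (low y ** k) = (if cg 1 0 y then of_nat q * F k else 0)"
      if y: "y \<in> teich" for y
    proof (cases "cg 1 0 y")
      case True
      then have "y = 0" using teich_inj[OF teich_0 y] by simp
      then show ?thesis using \<psi>_sum[of "-y"] by (simp add: low_def lo_def mat_1_mk[symmetric])
    next
      case False
      then show ?thesis
        using \<psi>_sum[of "- y"] teich_int[OF y] by (simp add: cg_def)
    qed
    then show ?thesis by (simp cong: sum.cong)
  qed
  also have "\<dots> = F k"
    using crs_sum_single[OF crs_teich pid_0, of "of_nat q * F k"] q_nonzero by simp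
  finally show ?thesis .
qed

lemma hat_low:
  assumes F: "F \<in> pf" and k: "k \<in> K" and y: "y \<in> pid 0" and s: "s \<in> pid 0"
  shows "hat F (low y ** k) s = \<psi> (s * y) * hat F k s"
proof -
  define g where "g t = \<psi> (- (s * (t - y))) * F (low t ** k)" for t
  have "(\<Sum>t\<in>teich. g (t + y)) = (\<Sum>t\<in>teich. g t)"
  proof (rule crs_sum_shift[OF crs_teich y])
    fix t t' assume t: "t \<in> pid 0" "t' \<in> pid 0" "cg 1 t t'"
    then have "\<psi> (- (s * (t - y))) = \<psi> (- (s * (t' - y)))"
      using s y by (intro \<psi>_cong cg_uminus cg_multL cg_diff) (auto intro: pid_mult0 pid_diff)
    then show "g t = g t'" using low_cong[OF F k t(3,1,2)] by (simp add: g_def)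
  qed
  moreover have "g (t + y) = \<psi> (- (s * t)) * F (low t ** (low y ** k))" for t
    by (simp add: g_def matrix_mul_assoc low_add)
  moreover have "g t = \<psi> (s * y) * (\<psi> (- (s * t)) * F (low t ** k))" if "t \<in> teich" for t
  proof -
    have "\<psi> (s * y + - (s * t)) = \<psi> (s * y) * \<psi> (- (s * t))"
      using s y teich_int[OF that] by (intro \<psi>_add) (auto intro: pid_mult0)
    moreover have "s * y + - (s * t) = - (s * (t - y))" by (simp add: algebra_simps)
    ultimately show ?thesis by (simp add: g_def)
  qed
  ultimately show ?thesis
    by (simp add: hat_def sum_distrib_left cong: sum.cong)
qed

text \<open>The Fourier multiplier with symbol \<open>a\<close>. It acts on the left variable, hence
  commutes with right translation.\<close>

definition op :: "('a \<Rightarrow> complex) \<Rightarrow> ('a mat2 \<Rightarrow> complex) \<Rightarrow> 'a mat2 \<Rightarrow> complex" where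
  "op a F k = (if k \<in> K then \<Sum>s\<in>teich. a s * hat F k s else 0)"

lemma hat_op:
  assumes F: "F \<in> pf" and k: "k \<in> K" and s: "s \<in> teich"
  shows "hat (op a F) k s = a s * hat F k s"
proof -
  have s0: "s \<in> pid 0" using s teich_int by blast
  have "op a F (low y ** k) = (\<Sum>t\<in>teich. a t * \<psi> (t * y) * hat F k t)" if "y \<in> teich" for y
    using hat_low[OF F k] teich_int that low_K k K_mult unfolding op_def
    by (simp add: mult.assoc cong: sum.cong)
  then have "(\<Sum>y\<in>teich. \<psi> (- (s * y)) * op a F (low y ** k)) =
      (\<Sum>y\<in>teich. \<Sum>t\<in>teich. \<psi> (- (s * y)) * (a t * \<psi> (t * y) * hat F k t))"
    by (simp add: sum_distrib_left cong: sum.cong)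
  also have "\<dots> = (\<Sum>t\<in>teich. a t * hat F k t * (\<Sum>y\<in>teich. \<psi> ((t - s) * y)))"
  proof (subst sum.swap, intro sum.cong refl)
    fix t assume t: "t \<in> teich"
    have "\<psi> (- (s * y)) * (a t * \<psi> (t * y) * hat F k t) = a t * hat F k t * \<psi> ((t - s) * y)"
      if "y \<in> teich" for y
    proof -
      have "\<psi> (t * y + - (s * y)) = \<psi> (t * y) * \<psi> (- (s * y))"
        using s0 t that teich_int by (intro \<psi>_add) (auto intro: pid_mult0)
      then show ?thesis by (simp add: algebra_simps)
    qed
    then show "(\<Sum>y\<in>teich. \<psi> (- (s * y)) * (a t * \<psi> (t * y) * hat F k t)) =
        a t * hat F k t * (\<Sum>y\<in>teich. \<psi> ((t - s) * y))"
      unfolding sum_distrib_left by (intro sum.cong refl)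
  qed
  also have "\<dots> = (\<Sum>t\<in>teich. if t = s then a s * hat F k s * of_nat q else 0)"
  proof (intro sum.cong refl)
    fix t assume t: "t \<in> teich"
    have "t - s \<in> pid 1 \<longleftrightarrow> t = s" using teich_inj[OF t s] by (auto simp: cg_def)
    then show "a t * hat F k t * (\<Sum>y\<in>teich. \<psi> ((t - s) * y)) = (if t = s then a s * hat F k s * of_nat q else 0)"
      using \<psi>_sum[of "t - s"] teich_int[OF t] s0 by (simp add: pid_diff)
  qed
  also have "\<dots> = a s * hat F k s * of_nat q"
    using s finite_teich by simp
  finally show ?thesis using q_nonzero by (simp add: hat_def[of "op a F"])
qed

lemma hat_mcg:
  assumes "F \<in> pf" "x \<in> K" "y \<in> K" "mcg (L + 1) x y"
  shows "hat F x s = hat F y s"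
proof -
  have "F (low t ** x) = F (low t ** y)" if "t \<in> teich" for t
    using assms teich_int[OF that] low_K K_mult by (intro pf_mcg[OF assms(1)] mcg_multL) auto
  then show ?thesis unfolding hat_def by (simp cong: sum.cong)
qed

lemma op_pf: "F \<in> pf \<Longrightarrow> op a F \<in> pf"
  unfolding pf_def[THEN arg_cong[where f = "\<lambda>S. op a F \<in> S"]] mem_Collect_eq
proof (intro ballI impI)
  fix x y assume "F \<in> pf" "x \<in> K" "y \<in> K" "mcg (L + 1) x y"
  then have "hat F x s = hat F y s" for s using hat_mcg by blast
  then show "op a F x = op a F y" using \<open>x \<in> K\<close> \<open>y \<in> K\<close> by (simp add: op_def)
qed

lemma hat_rt: "k \<in> K \<Longrightarrow> hat (rt g F) k s = hat F (k ** g) s"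
  unfolding hat_def rt_def using teich_int low_K K_mult by (simp add: matrix_mul_assoc cong: sum.cong)

lemma op_rt: "g \<in> K \<Longrightarrow> op a (rt g F) = rt g (op a F)"
  by (auto simp: op_def fun_eq_iff hat_rt K_mult rt_def[of g "op a F"])

lemma op_op: "F \<in> pf \<Longrightarrow> op b (op a F) = op (\<lambda>s. b s * a s) F"
  by (auto simp: op_def[of b] op_def[of "\<lambda>s. b s * a s"] fun_eq_iff hat_op mult.assoc cong: sum.cong)

lemma hat_add: "hat (\<lambda>x. F x + G x) k s = hat F k s + hat G k s"
  by (simp add: hat_def distrib_left sum.distrib add_divide_distrib)

lemma hat_scale: "hat (\<lambda>x. c * F x) k s = c * hat F k s"
  unfolding hat_def times_divide_eq_right sum_distrib_left by (simp add: mult.left_commute)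

lemma op_add: "op a (\<lambda>x. F x + G x) = (\<lambda>x. op a F x + op a G x)"
  by (auto simp: op_def fun_eq_iff hat_add distrib_left sum.distrib)

lemma op_scale: "op a (\<lambda>x. c * F x) = (\<lambda>x. c * op a F x)"
  by (auto simp: op_def fun_eq_iff hat_scale sum_distrib_left mult.left_commute)

text \<open>The function has level L + 1 but its character only level L, so the unit relating two
  bottom rows may be replaced by anything congruent modulo p^L.\<close>

lemma ps_row_eq:
  assumes F: "F \<in> ps \<eta> (L + 1)" and \<eta>: "unit_char \<eta> L" and K: "x \<in> K" "y \<in> K" and t: "t \<in> units" "t' \<in> units"
    and c: "cg (L + 1) (x $ 2 $ 1) (t * y $ 2 $ 1)" and d: "cg (L + 1) (x $ 2 $ 2) (t * y $ 2 $ 2)"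
    and t': "cg L (inverse t) t'"
  shows "F x = \<eta> t' * F y"
proof -
  have "F (mk (x $ 1 $ 1) (x $ 1 $ 2) (x $ 2 $ 1) (x $ 2 $ 2)) =
      \<eta> (inverse t) * F (mk (y $ 1 $ 1) (y $ 1 $ 2) (y $ 2 $ 1) (y $ 2 $ 2))"
    using K c d t by (intro ps_row[OF F]) simp_all
  moreover have "\<eta> (inverse t) = \<eta> t'"
    using unit_char_cong[OF \<eta> _ _ t'] t units_inverse by blast
  ultimately show ?thesis by simp
qed

lemma pid_2L: "x \<in> pid L \<Longrightarrow> y \<in> pid L \<Longrightarrow> x * y \<in> pid (L + 1)"
  using pid_mult[of x L y L] pid_mono[of "x * y" "L + L" "L + 1"] L_ge_1 by simp

lemma low_pid: "y \<in> pid 0 \<Longrightarrow> \<omega> ^ L * y \<in> pid L"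
  by (simp add: pid_multR unif_pid)

text \<open>Moving \<open>low y\<close> past b turns y into t^2 y, up to a left Borel factor whose
  lower right entry is congruent to t' modulo p^L and up to a term quadratic in \<omega>^L y. The
  character ignores the first, the level the second, because 2L >= L + 1.\<close>

lemma hat_borel:
  assumes F: "F \<in> ps \<eta> (L + 1)" and \<eta>: "unit_char \<eta> L" and b: "b \<in> borel" "b \<in> K" and k: "k \<in> K"
    and s: "s \<in> pid 0"
  shows "hat F (b ** k) s = \<eta> (b $ 1 $ 1) * hat F k (inverse ((b $ 1 $ 1)\<^sup>2) * s)"
proof -
  obtain t z t' where bm: "b = mk t z 0 t'" "t * t' = 1" and int: "t \<in> pid 0" "z \<in> pid 0" "t' \<in> pid 0"
  proof -
    obtain a b' c d where "b = mk a b' c d" by (rule mk_cases)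
    then show ?thesis using that b by (auto simp: borel_mk mk_K)
  qed
  have t: "t \<in> units" "t' \<in> units" using bm int units_mult_iff[of t t'] by auto
  have t': "t' = inverse t" using bm by (metis inverse_unique)
  have t2: "t\<^sup>2 \<in> units" using t by (simp add: units_power)
  obtain a b c d where km: "k = mk a b c d" and ki: "a \<in> pid 0" "b \<in> pid 0" "c \<in> pid 0" "d \<in> pid 0"
    using K_cases[OF k] by metis
  define u where "u = inverse (t\<^sup>2) * s"
  have u: "u \<in> pid 0" using s t2 units_inverse units_pid pid_mult0 unfolding u_def by blast
  have su: "s = u * t\<^sup>2" using t2 units_nonzero[of "t\<^sup>2"] by (simp add: u_def)
  have F1: "F (low y ** (mk t z 0 t' ** k)) = \<eta> t * F (low (t\<^sup>2 * y) ** k)" if y: "y \<in> pid 0" for y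
  proof -
    define \<zeta> where "\<zeta> = \<omega> ^ L * y"
    have \<zeta>: "\<zeta> \<in> pid L" using y low_pid by (simp add: \<zeta>_def)
    \<comment> \<open>The lower right entry of \<open>low y\<close> times b.\<close>
    define \<tau> where "\<tau> = t' + \<zeta> * z"
    have cgt: "cg L \<tau> t'" using \<zeta> int by (simp add: \<tau>_def cg_def pid_multR)
    have \<tau>: "\<tau> \<in> units" using cg_units[OF cg_mono[OF cgt L_ge_1]] t by simp
    have \<zeta>\<zeta>: "\<zeta> * \<zeta> \<in> pid (L + 1)" using \<zeta> pid_2L by blast
    have tt: "t' * (t * x) = x" for x using bm by (metis mult.assoc mult.commute mult_1)
    have c1: "\<zeta> * (t * a + z * c) + t' * c - \<tau> * (\<zeta> * t\<^sup>2 * a + c) = (\<zeta> * \<zeta>) * (- z * t\<^sup>2 * a)"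
      by (simp add: \<tau>_def power2_eq_square algebra_simps tt)
    have c2: "\<zeta> * (t * b + z * d) + t' * d - \<tau> * (\<zeta> * t\<^sup>2 * b + d) = (\<zeta> * \<zeta>) * (- z * t\<^sup>2 * b)"
      by (simp add: \<tau>_def power2_eq_square algebra_simps tt)
    show ?thesis
    proof (rule ps_row_eq[OF F \<eta> _ _ \<tau> t(1)])
      show "low y ** (mk t z 0 t' ** k) \<in> K" "low (t\<^sup>2 * y) ** k \<in> K"
        using low_K[OF y] low_K[OF pid_mult0[OF units_pid[OF t2] y]] k b bm K_mult by simp_all
      show "cg L (inverse \<tau>) t" using cg_inverse[OF cgt \<tau> t(2)] t' by simp
      have p: "- z * t\<^sup>2 * a \<in> pid 0" "- z * t\<^sup>2 * b \<in> pid 0"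
        using int ki t2 by (auto intro!: pid_mult0)
      have e: "(low y ** (mk t z 0 t' ** k)) $ 2 $ 1 = \<zeta> * (t * a + z * c) + t' * c"
          "(low y ** (mk t z 0 t' ** k)) $ 2 $ 2 = \<zeta> * (t * b + z * d) + t' * d"
          "(low (t\<^sup>2 * y) ** k) $ 2 $ 1 = \<zeta> * t\<^sup>2 * a + c"
          "(low (t\<^sup>2 * y) ** k) $ 2 $ 2 = \<zeta> * t\<^sup>2 * b + d"
        by (simp_all add: km low_def lo_def \<zeta>_def mult_ac)
      show "cg (L + 1) ((low y ** (mk t z 0 t' ** k)) $ 2 $ 1) (\<tau> * (low (t\<^sup>2 * y) ** k) $ 2 $ 1)"
        unfolding cg_def e c1 by (rule pid_multR[OF \<zeta>\<zeta> p(1)])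
      show "cg (L + 1) ((low y ** (mk t z 0 t' ** k)) $ 2 $ 2) (\<tau> * (low (t\<^sup>2 * y) ** k) $ 2 $ 2)"
        unfolding cg_def e c2 by (rule pid_multR[OF \<zeta>\<zeta> p(2)])
    qed
  qed
  define g where "g y = \<psi> (- (u * y)) * F (low y ** k)" for y
  have "(\<Sum>y\<in>teich. g (t\<^sup>2 * y)) = (\<Sum>y\<in>teich. g y)"
  proof (rule crs_sum_scale[OF crs_teich t2])
    fix x y assume xy: "x \<in> pid 0" "y \<in> pid 0" "cg 1 x y"
    then have "\<psi> (- (u * x)) = \<psi> (- (u * y))"
      using u by (intro \<psi>_cong cg_uminus cg_multL) (auto intro: pid_mult0)
    then show "g x = g y" using low_cong[OF ps_pf[OF F] k xy(3,1,2)] by (simp add: g_def)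
  qed
  moreover have "\<psi> (- (s * y)) * F (low y ** (mk t z 0 t' ** k)) = \<eta> t * g (t\<^sup>2 * y)" if "y \<in> teich" for y
    using F1[OF teich_int[OF that]] by (simp add: g_def su mult.assoc)
  ultimately show ?thesis
    unfolding hat_def bm g_def by (simp add: sum_distrib_left[symmetric] u_def cong: sum.cong)
qed

text \<open>The torus multiplies the parameter \<open>s\<close> of a component by squares,
  so a weight that is \<open>\<alpha>\<close>-homogeneous under squares twists \<open>\<eta>\<close> by \<open>\<alpha>\<close>.\<close>

lemma op_ps:
  assumes F: "F \<in> ps \<eta> (L + 1)" and \<eta>: "unit_char \<eta> L"
    and a: "\<And>s t. s \<in> pid 0 \<Longrightarrow> t \<in> units \<Longrightarrow> a (t\<^sup>2 * s) = \<alpha> t * a s"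
    and per: "\<And>s s'. s \<in> pid 0 \<Longrightarrow> s' \<in> pid 0 \<Longrightarrow> cg 1 s s' \<Longrightarrow> a s = a s'"
    and \<eta>': "\<And>t. t \<in> units \<Longrightarrow> \<eta>' t = \<eta> t * \<alpha> t"
  shows "op a F \<in> ps \<eta>' (L + 1)"
proof (rule ps_I)
  fix b x assume b: "b \<in> borel" "b \<in> K" and x: "x \<in> K"
  define t where "t = b $ 1 $ 1"
  have t: "t \<in> units"
  proof -
    obtain p q r s where "b = mk p q r s" by (rule mk_cases)
    then show ?thesis using b units_mult_iff[of p s] by (auto simp: borel_mk mk_K t_def)
  qed
  then have t2: "t\<^sup>2 \<in> units" "inverse (t\<^sup>2) \<in> units" "t\<^sup>2 \<noteq> 0"
    by (auto simp: units_power units_inverse units_nonzero)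
  have "op a F (b ** x) = (\<Sum>s\<in>teich. a s * (\<eta> t * hat F x (inverse (t\<^sup>2) * s)))"
    using hat_borel[OF F \<eta> b x] teich_int b x K_mult by (simp add: op_def t_def cong: sum.cong)
  also have "\<dots> = \<eta> t * (\<Sum>s\<in>teich. a (t\<^sup>2 * (inverse (t\<^sup>2) * s)) * hat F x (inverse (t\<^sup>2) * s))"
  proof -
    have "t\<^sup>2 * (inverse (t\<^sup>2) * s) = s" for s
      using t2 by (simp add: mult.assoc[symmetric])
    then show ?thesis by (simp only: sum_distrib_left mult.left_commute)
  qed
  also have "(\<Sum>s\<in>teich. a (t\<^sup>2 * (inverse (t\<^sup>2) * s)) * hat F x (inverse (t\<^sup>2) * s)) =
      (\<Sum>s\<in>teich. a (t\<^sup>2 * s) * hat F x s)"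
  proof (rule crs_sum_scale[OF crs_teich t2(2)])
    fix s s' assume s: "s \<in> pid 0" "s' \<in> pid 0" "cg 1 s s'"
    then have "a (t\<^sup>2 * s) = a (t\<^sup>2 * s')"
      using t2 by (intro per) (auto intro: pid_mult0 cg_multL)
    then show "a (t\<^sup>2 * s) * hat F x s = a (t\<^sup>2 * s') * hat F x s'"
      using hat_cong[OF s(3,1,2)] by simp
  qed
  also have "\<dots> = \<alpha> t * op a F x"
    using a[OF teich_int t] x by (simp add: op_def sum_distrib_left mult.assoc cong: sum.cong)
  finally show "op a F (b ** x) = \<eta>' (b $ 1 $ 1) * op a F x"
    using \<eta>'[OF t] by (simp add: t_def)
next
  fix x y assume "mcg (L + 1) x y" "x \<in> K" "y \<in> K"
  then show "op a F x = op a F y" using pf_mcg[OF op_pf[OF ps_pf[OF F]]] by blast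
qed (simp add: op_def)

section \<open>Functions with components supported in a given set of parameters\<close>

definition psC :: "('a \<Rightarrow> complex) \<Rightarrow> 'a set \<Rightarrow> ('a mat2 \<Rightarrow> complex) set" where
  "psC \<eta> C = {F \<in> ps \<eta> (L + 1). \<forall>k\<in>K. \<forall>s\<in>teich. s \<notin> C \<longrightarrow> hat F k s = 0}"

lemma psC_ps: "F \<in> psC \<eta> C \<Longrightarrow> F \<in> ps \<eta> (L + 1)"
  and psC_hat: "F \<in> psC \<eta> C \<Longrightarrow> k \<in> K \<Longrightarrow> s \<in> teich \<Longrightarrow> s \<notin> C \<Longrightarrow> hat F k s = 0"
  unfolding psC_def by blast+

lemma psC_I:
  "F \<in> ps \<eta> (L + 1) \<Longrightarrow> (\<And>k s. k \<in> K \<Longrightarrow> s \<in> teich \<Longrightarrow> s \<notin> C \<Longrightarrow> hat F k s = 0) \<Longrightarrow> F \<in> psC \<eta> C"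
  unfolding psC_def by blast

lemma psC_add: "F \<in> psC \<eta> C \<Longrightarrow> G \<in> psC \<eta> C \<Longrightarrow> (\<lambda>x. F x + G x) \<in> psC \<eta> C"
  by (rule psC_I) (simp_all add: psC_ps ps_add hat_add psC_hat)

lemma psC_scale: "F \<in> psC \<eta> C \<Longrightarrow> (\<lambda>x. c * F x) \<in> psC \<eta> C"
  by (rule psC_I) (simp_all add: psC_ps ps_scale hat_scale psC_hat)

lemma psC_rt: "g \<in> K \<Longrightarrow> F \<in> psC \<eta> C \<Longrightarrow> rt g F \<in> psC \<eta> C"
  by (rule psC_I) (simp_all add: psC_ps rt_ps hat_rt psC_hat K_mult)

text \<open>Passing from level L + 1 to level L means invariance under \<open>low y\<close>, that
  is, only the component s = 0. For the converse, left multiplication by an element congruent to 1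
  modulo p^L acts like some \<open>low w\<close>, because its bottom row is a unit congruent to 1
  modulo p^L times (\<omega>^L w, 1).\<close>

lemma ps_lower:
  assumes \<eta>: "unit_char \<eta> L"
  shows "ps \<eta> L = psC \<eta> {0}"
proof (intro equalityI subsetI)
  fix F assume F: "F \<in> ps \<eta> L"
  have F1: "F \<in> ps \<eta> (L + 1)"
  proof (rule ps_I)
    fix x y assume "mcg (L + 1) x y" "x \<in> K" "y \<in> K"
    then show "F x = F y" using ps_mcg[OF F mcg_mono] by simp
  qed (use ps_outside[OF F] ps_borel[OF F] in blast)+
  have "hat F k s = 0" if k: "k \<in> K" and s: "s \<in> teich" "s \<noteq> 0" for k s
  proof -
    have "F (low y ** k) = F k" if "y \<in> teich" for y
    proof (rule ps_mcg[OF F])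
      have y: "y \<in> pid 0" using that teich_int by blast
      have "mcg L (low y) (mat 1)"
        using low_pid[OF y] by (simp add: mcg_def low_def lo_def mat_1_mk cg_0_iff)
      then show "mcg L (low y ** k) k" using mcg_multR[of L "low y" "mat 1" k] k low_K[OF y] by simp
      show "low y ** k \<in> K" "k \<in> K" using low_K[OF y] k K_mult by auto
    qed
    then have "hat F k s = (\<Sum>y\<in>teich. \<psi> (- s * y)) * F k / of_nat q"
      by (simp add: hat_def sum_distrib_right cong: sum.cong)
    moreover have "- s \<notin> pid 1" using teich_units[OF s] units_iff_pid teich_int[OF s(1)] by simp
    ultimately show ?thesis using \<psi>_sum[of "- s"] teich_int[OF s(1)] by simp
  qed
  then show "F \<in> psC \<eta> {0}" using F1 by (intro psC_I) auto
next
  fix F assume F: "F \<in> psC \<eta> {0}"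
  note F1 = psC_ps[OF F] and Fp = ps_pf[OF psC_ps[OF F]]
  have F0: "F k = hat F k 0" if k: "k \<in> K" for k
  proof -
    have "F k = (\<Sum>s\<in>teich. hat F k s)" using hat_inversion[OF Fp k] by simp
    also have "\<dots> = (\<Sum>s\<in>teich. if s = 0 then hat F k 0 else 0)"
      using psC_hat[OF F k] by (intro sum.cong) auto
    finally show ?thesis using finite_teich by simp
  qed
  have inv: "F (low y ** k) = F k" if "y \<in> pid 0" "k \<in> K" for y k
    using F0 hat_low[OF Fp that(2,1) pid_0] that low_K K_mult by (simp add: \<psi>_0)
  show "F \<in> ps \<eta> L"
  proof (rule ps_I)
    fix x y assume xy: "mcg L x y" "x \<in> K" "y \<in> K"
    \<comment> \<open>The quotient is taken on the left, where the unipotents \<open>low\<close>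
      act.\<close>
    define g where "g = x ** adj2 y"
    have gK: "g \<in> K" using xy K_adj2 K_mult by (simp add: g_def)
    have xg: "x = g ** y" unfolding g_def by (rule K_adj2_cancel(2)[OF xy(3), symmetric])
    have "mcg L g (mat 1)"
      using mcg_multR[OF xy, of "adj2 y"] K_adj2[OF xy(3)] by (simp add: g_def)
    moreover obtain \<alpha> \<beta> \<gamma> \<delta> where g: "g = mk \<alpha> \<beta> \<gamma> \<delta>" by (rule mk_cases)
    ultimately have \<gamma>: "\<gamma> \<in> pid L" and \<delta>: "cg L \<delta> 1" by (auto simp: mcg_def mat_1_mk cg_0_iff)
    have \<delta>u: "\<delta> \<in> units" using cg_units[OF cg_mono[OF \<delta> L_ge_1]] by simp
    have "\<gamma> / \<delta> \<in> pid L"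
      unfolding divide_inverse using \<gamma> \<delta>u by (intro pid_multR units_pid units_inverse)
    then obtain w where w: "w \<in> pid 0" "\<gamma> / \<delta> = \<omega> ^ L * w" by (rule pid_unif_E)
    have "F x = \<eta> 1 * F (low w ** y)"
    proof (rule ps_row_eq[OF F1 \<eta> xy(2) _ \<delta>u])
      show "low w ** y \<in> K" using low_K[OF w(1)] xy K_mult by simp
      have \<gamma>': "\<gamma> = \<delta> * (\<omega> ^ L * w)" using w(2) units_nonzero[OF \<delta>u] by (simp add: field_simps)
      obtain a b c d where y: "y = mk a b c d" by (rule mk_cases)
      show "cg (L + 1) (x $ 2 $ 1) (\<delta> * (low w ** y) $ 2 $ 1)" "cg (L + 1) (x $ 2 $ 2) (\<delta> * (low w ** y) $ 2 $ 2)"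
        unfolding xg g y low_def lo_def by (simp_all add: \<gamma>' algebra_simps)
      show "cg L (inverse \<delta>) 1" using cg_inverse[OF \<delta> \<delta>u] by simp
    qed simp
    then show "F x = F y" using inv[OF w(1) xy(3)] unit_char_one[OF \<eta>] by simp
  qed (use ps_outside[OF F1] ps_borel[OF F1] in blast)+
qed

end

section \<open>Irreducibility\<close>

context level_char
begin

text \<open>Truncation to the Iwahori subgroup, where c lies in p.\<close>

definition cell :: "('a mat2 \<Rightarrow> complex) \<Rightarrow> 'a mat2 \<Rightarrow> complex" where
  "cell F k = (if k \<in> K \<and> k $ 2 $ 1 \<in> pid 1 then F k else 0)"

text \<open>Supported on c in p, with coordinate x = c / (\<omega> d) in O / p^L. Right translation
  by \<open>lo (\<omega> * z)\<close> shifts x by z, so this is its eigenvector with eigenvalue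
  \<Lambda>(u z).\<close>

definition basic :: "('a \<Rightarrow> complex) \<Rightarrow> 'a \<Rightarrow> 'a mat2 \<Rightarrow> complex" where
  "basic \<eta> u k = (if k \<in> K \<and> k $ 2 $ 1 \<in> pid 1
     then \<eta> (inverse (k $ 2 $ 2)) * \<Lambda> (u * (k $ 2 $ 1 / (\<omega> * k $ 2 $ 2))) else 0)"

lemma unif_div:
  assumes "c \<in> pid 1" "d \<in> units"
  shows "c / (\<omega> * d) \<in> pid 0" "c = \<omega> * (c / (\<omega> * d)) * d"
proof -
  obtain x where x: "x \<in> pid 0" "c = \<omega> * x" using pid_unif_E[OF assms(1)] by auto
  then have "c / (\<omega> * d) = x * inverse d" using uniformizer by (simp add: field_simps)
  then show "c / (\<omega> * d) \<in> pid 0" using x assms by (simp add: pid_mult0 units_inverse)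
  show "c = \<omega> * (c / (\<omega> * d)) * d" using uniformizer units_nonzero[OF assms(2)] by simp
qed

text \<open>The bottom row (c, d) is d times that of \<open>lo (\<omega> * x)\<close> with x = c /
  (\<omega> d); on c in p a function is thus a function of x.\<close>

lemma cell_value:
  assumes F: "F \<in> ps \<eta> (L + 1)" and \<eta>: "unit_char \<eta> L" and k: "k \<in> K" "k $ 2 $ 1 \<in> pid 1"
  shows "F k = \<eta> (inverse (k $ 2 $ 2)) * F (lo (\<omega> * (k $ 2 $ 1 / (\<omega> * k $ 2 $ 2))))"
proof -
  obtain a b c d where km: "k = mk a b c d" by (rule mk_cases)
  have d: "d \<in> units" using K_lower_right_unit1[of a b c d] k km by simp
  then have d': "k $ 2 $ 2 \<in> units" by (simp add: km)
  note u = unif_div[OF _ d, of c]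
  show ?thesis
  proof (rule ps_row_eq[OF F \<eta> k(1) _ d' units_inverse[OF d']])
    show "lo (\<omega> * (k $ 2 $ 1 / (\<omega> * k $ 2 $ 2))) \<in> K"
    proof (rule lo_K)
      have "c \<in> pid 1" using k km by simp
      then show "\<omega> * (k $ 2 $ 1 / (\<omega> * k $ 2 $ 2)) \<in> pid 0"
        using pid_mult0[OF unif_pid'[of 1] u(1)] by (simp only: km mk_nth power_one_right)
    qed
  qed (use km u(2) k uniformizer units_nonzero[OF d] in \<open>simp_all add: lo_def\<close>)
qed

lemma basic_ps:
  assumes \<eta>: "unit_char \<eta> L" and u: "u \<in> pid 0"
  shows "basic \<eta> u \<in> ps \<eta> (L + 1)"
proof (rule ps_I)
  fix B k assume B: "B \<in> borel" "B \<in> K" and k: "k \<in> K"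
  obtain t z v t' where Bm: "B = mk t z v t'" by (rule mk_cases)
  have tt: "t * t' = 1" "v = 0" using B by (auto simp: Bm borel_mk)
  have t: "t \<in> units" "t' \<in> units" using B units_mult_iff[of t t'] tt by (auto simp: Bm mk_K)
  have t': "t' = inverse t" using tt by (metis inverse_unique)
  obtain a b c d where km: "k = mk a b c d" by (rule mk_cases)
  have c: "t' * c \<in> pid 1 \<longleftrightarrow> c \<in> pid 1"
    using t pid_multL[of t' c 1] pid_multL[of t "t' * c" 1] tt by (auto simp: mult.assoc[symmetric])
  have Bk: "B ** k \<in> K" using B k K_mult by blast
  show "basic \<eta> u (B ** k) = \<eta> (B $ 1 $ 1) * basic \<eta> u k"
  proof (cases "c \<in> pid 1")
    case True
    then have d: "d \<in> units" using K_lower_right_unit1[of a b c d] k km by simp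
    have "\<eta> (inverse (t' * d)) = \<eta> t * \<eta> (inverse d)"
      using unit_char_mult[OF \<eta> t(1) units_inverse[OF d]] by (simp add: t')
    moreover have "t' * c / (\<omega> * (t' * d)) = c / (\<omega> * d)" using units_nonzero[OF t(2)] by simp
    ultimately show ?thesis using True c Bk k by (simp add: basic_def Bm km tt)
  next
    case False
    then show ?thesis using c by (simp add: basic_def Bm km tt)
  qed
next
  fix x y assume m: "mcg (L + 1) x y" and xy: "x \<in> K" "y \<in> K"
  obtain a b c d where x: "x = mk a b c d" by (rule mk_cases)
  obtain a' b' c' d' where y: "y = mk a' b' c' d'" by (rule mk_cases)
  have cc: "cg (L + 1) c c'" and dd: "cg (L + 1) d d'" using m by (auto simp: mcg_def x y)
  have c1: "c \<in> pid 1 \<longleftrightarrow> c' \<in> pid 1"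
    using cg_pid[OF cg_mono[OF cc, of 1]] cg_pid[OF cg_mono[OF cg_sym[OF cc], of 1]] by auto
  show "basic \<eta> u x = basic \<eta> u y"
  proof (cases "c \<in> pid 1")
    case True
    then have d: "d \<in> units" "d' \<in> units" using K_lower_right_unit1 xy x y c1 by blast+
    have ddL: "cg L d d'" using cg_mono[OF dd] by simp
    have "\<eta> (inverse d) = \<eta> (inverse d')"
      using unit_char_cong[OF \<eta> units_inverse units_inverse cg_inverse[OF ddL]] d by blast
    moreover have "\<Lambda> (u * (c / (\<omega> * d))) = \<Lambda> (u * (c' / (\<omega> * d')))"
    proof -
      have i: "c / (\<omega> * d) \<in> pid 0" "c' / (\<omega> * d') \<in> pid 0" using unif_div True c1 d by blast+
      obtain e e' where e: "c = \<omega> * e" "e \<in> pid 0" "c' = \<omega> * e'" "e' \<in> pid 0"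
        using pid_unif_E[OF True] pid_unif_E[of c' 1] True c1 by (metis power_one_right)
      \<comment> \<open>Dividing by \<omega> costs one level: c modulo p^(L+1) determines the
        coordinate modulo p^L, which is what \<open>\<Lambda>\<close> sees.\<close>
      have "cg (1 + L) (\<omega> ^ 1 * e) (\<omega> ^ 1 * e')" using cc e by (simp add: add.commute)
      then have "cg L e e'" by (simp only: cg_unif)
      then have "cg L (e / d) (e' / d')" using d e ddL by (intro cg_divide)
      then have "cg L (c / (\<omega> * d)) (c' / (\<omega> * d'))" using uniformizer by (simp add: e)
      then show ?thesis using u i by (intro add_char_cong[OF \<Lambda>_add_char] cg_multL pid_mult0)
    qed
    ultimately show ?thesis using True c1 xy by (simp add: basic_def x y)
  next
    case False
    then show ?thesis using c1 by (simp add: basic_def x y)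
  qed
qed (simp add: basic_def)

text \<open>At the identity \<open>low y\<close> has coordinate \<omega>^(L-1) y, where \<Lambda>(u
  x) becomes \<psi>(u y). So the residue of u names a component that is certainly nonzero.\<close>

lemma hat_basic_one:
  assumes \<eta>: "unit_char \<eta> L" and u: "u \<in> pid 0" and s: "s \<in> teich" "cg 1 u s"
  shows "hat (basic \<eta> u) (mat 1) s = 1"
proof -
  have "\<psi> (- (s * y)) * basic \<eta> u (low y ** mat 1) = 1" if y: "y \<in> teich" for y
  proof -
    have y0: "y \<in> pid 0" using y teich_int by blast
    have wL: "\<omega> ^ L = \<omega> * \<omega> ^ (L - 1)" using L_ge_1 by (simp add: power_eq_if)
    have "basic \<eta> u (low y ** mat 1) = \<Lambda> (u * (\<omega> ^ (L - 1) * y))"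
    proof -
      have "\<omega> ^ L * y \<in> pid 1" using low_pid[OF y0] L_ge_1 by (rule pid_mono)
      moreover have "\<omega> ^ L * y / \<omega> = \<omega> ^ (L - 1) * y" using uniformizer by (simp add: wL)
      ultimately show ?thesis
        using low_K[OF y0] unit_char_one[OF \<eta>] by (simp add: basic_def low_def lo_def)
    qed
    also have "\<dots> = \<psi> (u * y)" by (simp add: \<psi>_def mult.left_commute)
    also have "\<dots> = \<psi> (s * y)"
      using u s y0 teich_int by (intro \<psi>_cong cg_multR pid_mult0) auto
    finally have "basic \<eta> u (low y ** mat 1) = \<psi> (s * y)" .
    moreover have "\<psi> (- (s * y)) * \<psi> (s * y) = 1"
      using add_char_minus[OF \<psi>_add_char] s y0 teich_int pid_mult0 by blast
    ultimately show ?thesis by simp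
  qed
  then show ?thesis using q_nonzero by (simp add: hat_def card_teich cong: sum.cong)
qed

lemma psC_nontrivial:
  assumes \<eta>: "unit_char \<eta> L" and \<delta>: "\<delta> \<in> units"
  shows "\<exists>F\<in>psC \<eta> (sq_class \<delta>). F \<noteq> (\<lambda>_. 0)"
proof -
  define a :: "'a \<Rightarrow> complex" where "a s = (if s \<in> sq_class \<delta> then 1 else 0)" for s
  define F where "F = op a (basic \<eta> \<delta>)"
  have d0: "\<delta> \<in> pid 0" using \<delta> by simp
  note B = basic_ps[OF \<eta> d0]
  have "F \<in> ps \<eta> (L + 1)"
    unfolding F_def
  proof (rule op_ps[OF B \<eta>, where \<alpha> = "\<lambda>_. 1"])
    show "a (t\<^sup>2 * s) = 1 * a s" if "s \<in> pid 0" "t \<in> units" for s t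
      using sq_class_scale[OF that(2,1) \<delta>] by (simp add: a_def)
    show "a s = a s'" if "s \<in> pid 0" "s' \<in> pid 0" "cg 1 s s'" for s s'
      using sq_class_cong[OF that(3,1,2)] by (simp add: a_def)
  qed simp
  moreover have hF: "hat F k s = a s * hat (basic \<eta> \<delta>) k s" if "k \<in> K" "s \<in> teich" for k s
    unfolding F_def using hat_op[OF ps_pf[OF B] that] .
  ultimately have "F \<in> psC \<eta> (sq_class \<delta>)" by (intro psC_I) (simp_all add: a_def)
  moreover obtain s where s: "s \<in> teich" "cg 1 \<delta> s" using teich_exists d0 by blast
  have "hat F (mat 1) s = 1"
    using hF[OF K_one s(1)] hat_basic_one[OF \<eta> d0 s] sq_class_cong[OF s(2) d0 teich_int[OF s(1)]]
      sq_class_self[OF \<delta>] by (simp add: a_def)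
  then have "F \<noteq> (\<lambda>_. 0)" by (auto simp: hat_def)
  ultimately show ?thesis by blast
qed

text \<open>Right translation by diag(r, 1/r) multiplies the coordinate c / (\<omega> d) by r^2,
  hence the index u by r^2.\<close>

lemma basic_torus:
  assumes \<eta>: "unit_char \<eta> L" and u: "u \<in> pid 0" and r: "r \<in> units" and u': "u' \<in> pid 0" "cg L u' (u * r\<^sup>2)"
  shows "basic \<eta> u' = (\<lambda>k. inverse (\<eta> r) * rt (dg r) (basic \<eta> u) k)"
proof
  fix k
  show "basic \<eta> u' k = inverse (\<eta> r) * rt (dg r) (basic \<eta> u) k"
  proof (cases "k \<in> K")
    case k: True
    obtain a b c d where km: "k = mk a b c d" by (rule mk_cases)
    have rk: "k ** dg r = mk (a * r) (b * inverse r) (c * r) (d * inverse r)"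
      by (simp add: km dg_mk)
    have rk': "k ** dg r \<in> K" using k r dg_K K_mult by blast
    have c0: "c \<in> pid 0" using k km mk_K by simp
    have cr: "c * r \<in> pid 1 \<longleftrightarrow> c \<in> pid 1"
      using units_iff_pid[OF c0] units_iff_pid[OF pid_mult0[OF c0 units_pid[OF r]]]
        units_mult_iff[OF c0 units_pid[OF r]] r by blast
    show ?thesis
    proof (cases "c \<in> pid 1")
      case True
      then have d: "d \<in> units" using K_lower_right_unit1 k km by blast
      have "\<eta> (inverse (d * inverse r)) = \<eta> r * \<eta> (inverse d)"
        using unit_char_mult[OF \<eta> r units_inverse[OF d]] by (simp add: mult.commute)
      moreover have "\<Lambda> (u' * (c / (\<omega> * d))) = \<Lambda> (u * (c * r / (\<omega> * (d * inverse r))))"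
      proof -
        have "u * (c * r / (\<omega> * (d * inverse r))) = (u * r\<^sup>2) * (c / (\<omega> * d))"
          using units_nonzero[OF r] by (simp add: power2_eq_square field_simps)
        moreover have "\<Lambda> (u' * (c / (\<omega> * d))) = \<Lambda> ((u * r\<^sup>2) * (c / (\<omega> * d)))"
          using u u' unif_div(1)[OF True d] units_pid[OF units_power[OF r]]
          by (intro add_char_cong[OF \<Lambda>_add_char] cg_multR pid_mult0)
        ultimately show ?thesis by simp
      qed
      ultimately show ?thesis
        using True cr k rk' unit_char_nonzero[OF \<eta> r] unfolding rt_eq[OF k] rk basic_def by (simp add: km)
    next
      case False
      then show ?thesis using cr k unfolding rt_eq[OF k] rk basic_def by (simp add: km)
    qed
  qed (simp add: basic_def rt_def)
qed

text \<open>Truncation is realised inside the group action by averaging over upper unipotents with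
  entry in p^L. On c in p they act trivially at level L + 1; for a unit c they act like left
  translation by \<open>low (- c^2 * y)\<close>, so the average is the component s = 0, which is
  absent.\<close>

lemma cell_average:
  assumes F: "F \<in> psC \<eta> C" and \<eta>: "unit_char \<eta> L" and C: "0 \<notin> C"
  shows "cell F = (\<lambda>k. (\<Sum>y\<in>teich. rt (mk 1 (\<omega> ^ L * y) 0 1) F k) / of_nat q)"
proof
  fix k
  note F1 = psC_ps[OF F]
  have upK: "mk 1 (\<omega> ^ L * y) 0 1 \<in> K" if "y \<in> pid 0" for y
    using that unif_pid' by (simp add: mk_K pid_mult0)
  show "cell F k = (\<Sum>y\<in>teich. rt (mk 1 (\<omega> ^ L * y) 0 1) F k) / of_nat q"
  proof (cases "k \<in> K")
    case k: True
    obtain a b c d where km: "k = mk a b c d" by (rule mk_cases)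
    have int: "a \<in> pid 0" "b \<in> pid 0" "c \<in> pid 0" "d \<in> pid 0" "a * d - b * c = 1"
      using k by (auto simp: km mk_K)
    show ?thesis
    proof (cases "c \<in> pid 1")
      case True
      have "rt (mk 1 (\<omega> ^ L * y) 0 1) F k = F k" if "y \<in> teich" for y
      proof -
        have y: "y \<in> pid 0" using that teich_int by blast
        have "c * (\<omega> ^ L * y) \<in> pid (1 + L)" using pid_mult[OF True low_pid[OF y]] .
        then have "F (k ** mk 1 (\<omega> ^ L * y) 0 1) = \<eta> 1 * F k"
          using k upK[OF y]
          by (intro ps_row_eq[OF F1 \<eta> K_mult[OF k upK[OF y]] k units_one units_one])
            (simp_all add: km cg_def add.commute)
        then show ?thesis using unit_char_one[OF \<eta>] k by (simp add: rt_eq)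
      qed
      then show ?thesis using True k q_nonzero by (simp add: cell_def km card_teich cong: sum.cong)
    next
      case False
      then have c: "c \<in> units" using int units_iff_pid by blast
      then have c2: "- (c\<^sup>2) \<in> units" by (simp add: units_power)
      have eq: "rt (mk 1 (\<omega> ^ L * y) 0 1) F k = F (low (- (c\<^sup>2) * y) ** k)" if "y \<in> teich" for y
      proof -
        have y: "y \<in> pid 0" using that teich_int by blast
        define z where "z = \<omega> ^ L * y"
        have z: "z \<in> pid L" using low_pid[OF y] by (simp add: z_def)
        \<comment> \<open>The common factor of the two bottom rows modulo p^(L+1), found from their
          left entries; the right entries agree by the determinant relation up to a multiple of
          z^2.\<close>
        define \<tau> where "\<tau> = 1 - z * c * a"
        have \<tau>c: "cg L \<tau> 1" using z int by (simp add: \<tau>_def cg_def pid_multR)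
        have \<tau>: "\<tau> \<in> units" using cg_units[OF cg_mono[OF \<tau>c L_ge_1]] by simp
        have zz: "z * z \<in> pid (L + 1)" using z pid_2L by blast
        have e: "(low (- (c\<^sup>2) * y) ** k) $ 2 $ 1 = \<tau> * c"
            "(low (- (c\<^sup>2) * y) ** k) $ 2 $ 2 = d - z * c\<^sup>2 * b"
            "(k ** mk 1 (\<omega> ^ L * y) 0 1) $ 2 $ 1 = c" "(k ** mk 1 (\<omega> ^ L * y) 0 1) $ 2 $ 2 = c * z + d"
          by (simp_all add: km low_def lo_def z_def \<tau>_def power2_eq_square algebra_simps)
        have "d - z * c\<^sup>2 * b - \<tau> * (c * z + d) = z * c * (a * d - b * c - 1) + (z * z) * (c * c * a)"
          by (simp add: \<tau>_def power2_eq_square algebra_simps)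
        then have e2: "d - z * c\<^sup>2 * b - \<tau> * (c * z + d) = (z * z) * (c * c * a)" using int by simp
        have "F (low (- (c\<^sup>2) * y) ** k) = \<eta> 1 * F (k ** mk 1 (\<omega> ^ L * y) 0 1)"
        proof (rule ps_row_eq[OF F1 \<eta> _ _ \<tau> units_one])
          show "low (- (c\<^sup>2) * y) ** k \<in> K"
            using low_K[OF pid_mult0[OF units_pid[OF c2] y]] k by (rule K_mult)
          show "k ** mk 1 (\<omega> ^ L * y) 0 1 \<in> K" using K_mult[OF k upK[OF y]] .
          show "cg L (inverse \<tau>) 1" using cg_inverse[OF \<tau>c \<tau>] by simp
          show "cg (L + 1) ((low (- (c\<^sup>2) * y) ** k) $ 2 $ 1) (\<tau> * (k ** mk 1 (\<omega> ^ L * y) 0 1) $ 2 $ 1)"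
            unfolding e by simp
          show "cg (L + 1) ((low (- (c\<^sup>2) * y) ** k) $ 2 $ 2) (\<tau> * (k ** mk 1 (\<omega> ^ L * y) 0 1) $ 2 $ 2)"
            unfolding e cg_def e2 using int by (intro pid_multR[OF zz] pid_mult0)
        qed
        then show ?thesis using unit_char_one[OF \<eta>] k by (simp add: rt_eq)
      qed
      have "(\<Sum>y\<in>teich. F (low (- (c\<^sup>2) * y) ** k)) = (\<Sum>y\<in>teich. F (low y ** k))"
        by (rule crs_sum_scale[OF crs_teich c2, of "\<lambda>y. F (low y ** k)"])
          (rule low_cong[OF ps_pf[OF F1] k])
      also have "\<dots> = of_nat q * hat F k 0"
        using q_nonzero by (simp add: hat_def \<psi>_0)
      also have "\<dots> = 0" using psC_hat[OF F k teich_0 C] by simp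
      finally show ?thesis using eq False by (simp add: cell_def km cong: sum.cong)
    qed
  qed (simp add: cell_def rt_def)
qed

text \<open>Fourier inversion on O / p^L in the coordinate x of the cell. The coefficients outside
  the square class vanish because averaging over shifts by \<omega>^(L-1) y computes a component
  \<open>hat G\<close> outside that class.\<close>

lemma basic_expansion:
  assumes G: "G \<in> psC \<eta> (sq_class \<delta>)" and \<eta>: "unit_char \<eta> L" and S: "crs L S" and \<delta>: "\<delta> \<in> units"
  obtains w where "cell G = (\<lambda>k. \<Sum>u\<in>{u\<in>S. u \<in> sq_class \<delta>}. w u * basic \<eta> u k)"
proof -
  note G1 = psC_ps[OF G]
  define \<phi> where "\<phi> x = G (lo (\<omega> * x))" for x
  define w where "w u = (\<Sum>z\<in>S. \<Lambda> (- (u * z)) * \<phi> z) / of_nat (card S)" for u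
  have N: "(of_nat (card S) :: complex) \<noteq> 0" using crs_card_pos[OF S] by simp
  have wx: "\<omega> * x \<in> pid 0" if "x \<in> pid 0" for x
    using that unif_pid'[of 1] pid_mult0 by simp
  have \<phi>per: "\<phi> x = \<phi> y" if "x \<in> pid 0" "y \<in> pid 0" "cg L x y" for x y
  proof -
    have "cg (1 + L) (\<omega> ^ 1 * x) (\<omega> ^ 1 * y)" using that(3) by (rule cg_unif')
    then have "mcg (L + 1) (lo (\<omega> * x)) (lo (\<omega> * y))" by (simp add: mcg_def lo_def add.commute)
    then show ?thesis unfolding \<phi>_def using that wx by (intro ps_mcg[OF G1]) auto
  qed
  \<comment> \<open>The sum defining \<open>w u\<close> is invariant under the shifts z +
    \<omega>^(L-1) y; performing the sum over y first produces \<open>hat\<close> at s congruent to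
    u.\<close>
  have w0: "w u = 0" if u: "u \<in> S" "u \<notin> sq_class \<delta>" for u
  proof -
    have u0: "u \<in> pid 0" using u crs_int[OF S] by blast
    obtain s where s: "s \<in> teich" "cg 1 u s" using teich_exists[OF u0] by blast
    have sC: "s \<notin> sq_class \<delta>" using sq_class_cong[OF s(2) u0 teich_int[OF s(1)]] u by simp
    define g where "g z = \<Lambda> (- (u * z)) * \<phi> z" for z
    have gper: "g x = g y" if "x \<in> pid 0" "y \<in> pid 0" "cg L x y" for x y
      using that u0 \<phi>per[OF that] add_char_cong[OF \<Lambda>_add_char, of "- (u * x)" "- (u * y)"]
      by (simp add: g_def pid_mult0 cg_uminus cg_multL)
    have shift: "(\<Sum>z\<in>S. g z) = (\<Sum>z\<in>S. g (z + \<omega> ^ (L - 1) * y))" if "y \<in> pid 0" for y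
      using that unif_pid' pid_mult0 by (intro crs_sum_shift[OF S _ gper, symmetric]) auto
    have inner: "(\<Sum>y\<in>teich. g (z + \<omega> ^ (L - 1) * y)) = 0" if z: "z \<in> pid 0" for z
    proof -
      have "g (z + \<omega> ^ (L - 1) * y) = \<Lambda> (- (u * z)) * (\<psi> (- (s * y)) * G (low y ** lo (\<omega> * z)))"
        if y: "y \<in> teich" for y
      proof -
        have y0: "y \<in> pid 0" using y teich_int by blast
        have "\<Lambda> (- (u * (z + \<omega> ^ (L - 1) * y))) = \<Lambda> (- (u * z) + \<omega> ^ (L - 1) * (- (u * y)))"
          by (simp add: algebra_simps)
        also have "\<dots> = \<Lambda> (- (u * z)) * \<Lambda> (\<omega> ^ (L - 1) * (- (u * y)))"
          using u0 z y0 unif_pid' pid_mult0 by (intro add_char_add[OF \<Lambda>_add_char]) auto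
        also have "\<Lambda> (\<omega> ^ (L - 1) * (- (u * y))) = \<psi> (- (s * y))"
          unfolding \<psi>_def[symmetric] using u0 y0 s teich_int pid_mult0 
          by (intro \<psi>_cong cg_uminus cg_multR) auto
        finally have "\<Lambda> (- (u * (z + \<omega> ^ (L - 1) * y))) = \<Lambda> (- (u * z)) * \<psi> (- (s * y))" .
        moreover have "\<omega> * (z + \<omega> ^ (L - 1) * y) = \<omega> ^ L * y + \<omega> * z"
          using L_ge_1 by (simp add: power_eq_if algebra_simps)
        ultimately show ?thesis by (simp add: g_def \<phi>_def low_def lo_add)
      qed
      then have "(\<Sum>y\<in>teich. g (z + \<omega> ^ (L - 1) * y)) =
          \<Lambda> (- (u * z)) * (\<Sum>y\<in>teich. \<psi> (- (s * y)) * G (low y ** lo (\<omega> * z)))"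
        by (simp add: sum_distrib_left cong: sum.cong)
      also have "\<dots> = \<Lambda> (- (u * z)) * (of_nat q * hat G (lo (\<omega> * z)) s)"
        using q_nonzero by (simp add: hat_def)
      finally have "(\<Sum>y\<in>teich. g (z + \<omega> ^ (L - 1) * y)) =
          \<Lambda> (- (u * z)) * (of_nat q * hat G (lo (\<omega> * z)) s)" .
      then show ?thesis using psC_hat[OF G lo_K[OF wx[OF z]] s(1) sC] by simp
    qed
    have "of_nat q * (\<Sum>z\<in>S. g z) = (\<Sum>y\<in>teich. \<Sum>z\<in>S. g z)" by (simp add: card_teich)
    also have "\<dots> = (\<Sum>y\<in>teich. \<Sum>z\<in>S. g (z + \<omega> ^ (L - 1) * y))"
      by (intro sum.cong refl shift teich_int)
    also have "\<dots> = 0"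
      by (subst sum.swap) (intro sum.neutral ballI inner crs_int[OF S])
    finally show ?thesis using q_nonzero by (simp add: w_def g_def)
  qed
  have inv: "\<phi> x = (\<Sum>u\<in>S. w u * \<Lambda> (u * x))" if x: "x \<in> pid 0" for x
  proof -
    have "(\<Sum>u\<in>S. w u * \<Lambda> (u * x)) = (\<Sum>u\<in>S. \<Sum>z\<in>S. \<phi> z * \<Lambda> (u * (x - z))) / of_nat (card S)"
    proof -
      have "w u * \<Lambda> (u * x) = (\<Sum>z\<in>S. \<phi> z * \<Lambda> (u * (x - z))) / of_nat (card S)" if u: "u \<in> S" for u
      proof -
        have "\<Lambda> (- (u * z)) * \<Lambda> (u * x) = \<Lambda> (u * (x - z))" if "z \<in> S" for z
          using add_char_add[OF \<Lambda>_add_char, of "- (u * z)" "u * x"] u that x crs_int[OF S] pid_mult0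
          by (simp add: algebra_simps)
        then have "\<Lambda> (- (u * z)) * \<phi> z * \<Lambda> (u * x) = \<phi> z * \<Lambda> (u * (x - z))" if "z \<in> S" for z
          using that by (metis mult.assoc mult.commute)
        then have "(\<Sum>z\<in>S. \<Lambda> (- (u * z)) * \<phi> z) * \<Lambda> (u * x) = (\<Sum>z\<in>S. \<phi> z * \<Lambda> (u * (x - z)))"
          unfolding sum_distrib_right by (intro sum.cong refl)
        then show ?thesis by (simp add: w_def)
      qed
      then show ?thesis by (simp add: sum_divide_distrib cong: sum.cong)
    qed
    also have "(\<Sum>u\<in>S. \<Sum>z\<in>S. \<phi> z * \<Lambda> (u * (x - z))) = (\<Sum>z\<in>S. \<phi> z * (\<Sum>u\<in>S. \<Lambda> (u * (x - z))))"
      by (subst sum.swap) (simp add: sum_distrib_left)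
    also have "\<dots> = (\<Sum>z\<in>S. if cg L x z then of_nat (card S) * \<phi> x else 0)"
    proof (intro sum.cong refl)
      fix z assume "z \<in> S"
      then have z: "z \<in> pid 0" using crs_int[OF S] by blast
      show "\<phi> z * (\<Sum>u\<in>S. \<Lambda> (u * (x - z))) = (if cg L x z then of_nat (card S) * \<phi> x else 0)"
        using prim_char_sum[OF prim S pid_diff[OF x z]] \<phi>per[OF x z] by (simp add: cg_def)
    qed
    also have "\<dots> = of_nat (card S) * \<phi> x" by (rule crs_sum_single[OF S x])
    finally show ?thesis using N by simp
  qed
  have "cell G = (\<lambda>k. \<Sum>u\<in>{u\<in>S. u \<in> sq_class \<delta>}. w u * basic \<eta> u k)"
  proof
    fix k
    show "cell G k = (\<Sum>u\<in>{u\<in>S. u \<in> sq_class \<delta>}. w u * basic \<eta> u k)"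
    proof (cases "k \<in> K \<and> k $ 2 $ 1 \<in> pid 1")
      case True
      obtain a b c d where km: "k = mk a b c d" by (rule mk_cases)
      have d: "d \<in> units" using K_lower_right_unit1[of a b c d] True km by simp
      have x: "c / (\<omega> * d) \<in> pid 0" using unif_div d True km by simp
      have "cell G k = \<eta> (inverse d) * \<phi> (c / (\<omega> * d))"
        using cell_value[OF G1 \<eta>, of k] True by (simp add: cell_def \<phi>_def km)
      also have "\<dots> = (\<Sum>u\<in>S. w u * basic \<eta> u k)"
        using True unfolding inv[OF x] by (simp add: basic_def km sum_distrib_left mult.left_commute)
      also have "\<dots> = (\<Sum>u\<in>{u\<in>S. u \<in> sq_class \<delta>}. w u * basic \<eta> u k)"
        using crs_finite[OF S] w0 by (intro sum.mono_neutral_right) auto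
      finally show ?thesis .
    qed (auto simp: cell_def basic_def)
  qed
  then show ?thesis by (rule that)
qed

text \<open>The q + 1 points of the projective line over the residue field: for (c, d) either c lies
  in p, or d - c y lies in p for exactly one Teichmueller y. \<open>h y\<close> moves d - c y into
  the lower left corner.\<close>

lemma cell_cover:
  assumes G: "G \<in> pf" "\<And>x. x \<notin> K \<Longrightarrow> G x = 0"
  defines "h \<equiv> \<lambda>y. mk (- y) (- 1) 1 0"
  shows "G = (\<lambda>k. cell G k + (\<Sum>y\<in>teich. rt (h y) (cell (rt (adj2 (h y)) G)) k))"
proof
  fix k
  have hK: "h y \<in> K" if "y \<in> pid 0" for y using that by (simp add: h_def mk_K)
  show "G k = cell G k + (\<Sum>y\<in>teich. rt (h y) (cell (rt (adj2 (h y)) G)) k)"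
  proof (cases "k \<in> K")
    case k: True
    obtain a b c d where km: "k = mk a b c d" by (rule mk_cases)
    have int: "c \<in> pid 0" "d \<in> pid 0" using k by (auto simp: km mk_K)
    have H: "rt (h y) (cell (rt (adj2 (h y)) G)) k = (if d - c * y \<in> pid 1 then G k else 0)"
      if "y \<in> teich" for y
    proof -
      have hy: "h y \<in> K" using hK teich_int that by blast
      have "(k ** h y) $ 2 $ 1 = d - c * y" by (simp add: km h_def)
      moreover have "rt (adj2 (h y)) G (k ** h y) = G k"
        using K_mult[OF k hy] by (simp add: rt_eq K_adj2_cancel(1)[OF hy])
      ultimately show ?thesis using K_mult[OF k hy] by (simp add: rt_eq[OF k] cell_def)
    qed
    show ?thesis
    proof (cases "c \<in> pid 1")
      case True
      then have d: "d \<in> units" using K_lower_right_unit1 k km by blast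
      have "d - c * y \<notin> pid 1" if "y \<in> teich" for y
      proof -
        have cy: "c * y \<in> pid 1" using True teich_int[OF that] by (rule pid_multR)
        have "d \<notin> pid 1" using d units_iff_pid int by blast
        then show ?thesis using pid_add[OF _ cy, of "d - c * y"] by auto
      qed
      then show ?thesis using True H k by (simp add: cell_def km cong: sum.cong)
    next
      case False
      then have c: "c \<in> units" using int units_iff_pid by blast
      have dc: "d / c \<in> pid 0"
        unfolding divide_inverse using int c by (simp add: pid_mult0 units_inverse)
      have "d - c * y \<in> pid 1 \<longleftrightarrow> cg 1 (d / c) y" if "y \<in> teich" for y
      proof -
        have y: "y \<in> pid 0" using that teich_int by blast
        have e: "d - c * y = c * (d / c - y)" using units_nonzero[OF c] by (simp add: field_simps)
        show ?thesis
          unfolding e cg_def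
          using units_iff_pid[OF pid_mult0[OF int(1) pid_diff[OF dc y]]] units_iff_pid[OF pid_diff[OF dc y]]
            units_mult_iff[OF int(1) pid_diff[OF dc y]] c by blast
      qed
      then have "(\<Sum>y\<in>teich. rt (h y) (cell (rt (adj2 (h y)) G)) k) = (\<Sum>y\<in>teich. if cg 1 (d / c) y then G k else 0)"
        using H by (simp cong: sum.cong)
      also have "\<dots> = G k" by (rule crs_sum_single[OF crs_teich dc])
      finally show ?thesis using False by (simp add: cell_def km)
    qed
  qed (simp add: cell_def rt_def G)
qed

theorem psC_irreducible:
  assumes \<eta>: "unit_char \<eta> L" and \<delta>: "\<delta> \<in> units"
    and U: "U \<subseteq> psC \<eta> (sq_class \<delta>)"
    and add: "\<And>F G. F \<in> U \<Longrightarrow> G \<in> U \<Longrightarrow> (\<lambda>x. F x + G x) \<in> U"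
    and scale: "\<And>c F. F \<in> U \<Longrightarrow> (\<lambda>x. c * F x) \<in> U"
    and rtU: "\<And>g F. g \<in> K \<Longrightarrow> F \<in> U \<Longrightarrow> rt g F \<in> U"
    and F: "F \<in> U" "F \<noteq> (\<lambda>_. 0)"
  shows "psC \<eta> (sq_class \<delta>) \<subseteq> U"
proof -
  have C0: "0 \<notin> sq_class \<delta>" using sq_class_units[OF \<delta>, of 0] units_nonzero by blast
  have zero: "(\<lambda>_. 0) \<in> U" using scale[OF F(1), of 0] by simp
  have sumU: "(\<lambda>x. \<Sum>i\<in>I. f i x) \<in> U" if "\<And>i. i \<in> I \<Longrightarrow> f i \<in> U" for f and I :: "'a set"
    using that
  proof (induction I rule: infinite_finite_induct)
    case (insert i I)
    then show ?case using add[of "f i" "\<lambda>x. \<Sum>i\<in>I. f i x"] by simp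
  qed (use zero in auto)
  have psC: "G \<in> psC \<eta> (sq_class \<delta>)" if "G \<in> U" for G using that U by blast
  have upK: "mk 1 (\<omega> ^ L * y) 0 1 \<in> K" if "y \<in> teich" for y
    using teich_int[OF that] unif_pid' by (simp add: mk_K pid_mult0)
  have cellU: "cell G \<in> U" if "G \<in> U" for G
  proof -
    have "(\<lambda>k. \<Sum>y\<in>teich. rt (mk 1 (\<omega> ^ L * y) 0 1) G k) \<in> U"
      using that upK by (intro sumU rtU)
    from scale[OF this, of "inverse (of_nat q)"] show ?thesis
      unfolding cell_average[OF psC[OF that] \<eta> C0] by (simp add: divide_inverse mult.commute)
  qed
  have wx: "\<omega> * x \<in> pid 0" if "x \<in> pid 0" for x
    using that unif_pid'[of 1] pid_mult0 by simp
  have w1: "\<omega> * x \<in> pid 1" if "x \<in> pid 0" for x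
    using that unif_pid[of 1] pid_multR by simp
  \<comment> \<open>Vectors of \<open>U\<close> supported on c in p, read in the coordinate x.
    Shifts of x are right translations by \<open>lo (\<omega> * z)\<close>, which preserve this
    support, so \<open>translation_eigenvector\<close> applies.\<close>
  define S where "S = {\<phi>. \<exists>G\<in>U. (\<forall>k\<in>K. k $ 2 $ 1 \<notin> pid 1 \<longrightarrow> G k = 0) \<and> (\<forall>x\<in>pid 0. \<phi> x = G (lo (\<omega> * x)))}"
  \<comment> \<open>Translating by g0 brings a nonzero value to the identity, which truncation
    retains.\<close>
  obtain g0 where g0: "F g0 \<noteq> 0" using F(2) by auto
  have g0K: "g0 \<in> K" using ps_outside[OF psC_ps[OF psC[OF F(1)]]] g0 by blast
  define F0 where "F0 = cell (rt g0 F)"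
  have F0: "F0 \<in> U" unfolding F0_def by (intro cellU rtU g0K F)
  have F01: "F0 (mat 1) \<noteq> 0" using g0 by (simp add: F0_def cell_def rt_def) (simp add: mat_1_mk)
  have S1: "(\<lambda>x. F0 (lo (\<omega> * x))) \<in> S"
    using F0 by (auto simp: S_def F0_def cell_def intro!: bexI[of _ "cell (rt g0 F)"])
  have S2: "(\<lambda>x. F0 (lo (\<omega> * x))) 0 \<noteq> 0" using F01 by (simp add: lo_def mat_1_mk)
  have S3: "(\<lambda>x. \<phi> x + \<phi>' x) \<in> S" if \<phi>: "\<phi> \<in> S" "\<phi>' \<in> S" for \<phi> \<phi>'
  proof -
    obtain G G' where "G \<in> U" "\<forall>k\<in>K. k $ 2 $ 1 \<notin> pid 1 \<longrightarrow> G k = 0" "\<forall>x\<in>pid 0. \<phi> x = G (lo (\<omega> * x))"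
      "G' \<in> U" "\<forall>k\<in>K. k $ 2 $ 1 \<notin> pid 1 \<longrightarrow> G' k = 0" "\<forall>x\<in>pid 0. \<phi>' x = G' (lo (\<omega> * x))"
      using \<phi> unfolding S_def by blast
    then show ?thesis unfolding S_def using add[of G G'] by (auto intro!: bexI[of _ "\<lambda>x. G x + G' x"])
  qed
  have S4: "(\<lambda>x. c * \<phi> x) \<in> S" if \<phi>: "\<phi> \<in> S" for c \<phi>
  proof -
    obtain G where "G \<in> U" "\<forall>k\<in>K. k $ 2 $ 1 \<notin> pid 1 \<longrightarrow> G k = 0" "\<forall>x\<in>pid 0. \<phi> x = G (lo (\<omega> * x))"
      using \<phi> unfolding S_def by blast
    then show ?thesis unfolding S_def using scale[of G c] by (auto intro!: bexI[of _ "\<lambda>x. c * G x"])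
  qed
  have S5: "(\<lambda>x. \<phi> (x + z)) \<in> S" if z: "z \<in> pid 0" and \<phi>: "\<phi> \<in> S" for z \<phi>
  proof -
    obtain G where G: "G \<in> U" "\<forall>k\<in>K. k $ 2 $ 1 \<notin> pid 1 \<longrightarrow> G k = 0" "\<forall>x\<in>pid 0. \<phi> x = G (lo (\<omega> * x))"
      using \<phi> unfolding S_def by blast
    have zK: "lo (\<omega> * z) \<in> K" using wx[OF z] by simp
    have "rt (lo (\<omega> * z)) G k = 0" if k: "k \<in> K" "k $ 2 $ 1 \<notin> pid 1" for k
    proof -
      obtain a b c d where km: "k = mk a b c d" by (rule mk_cases)
      have "d * (\<omega> * z) \<in> pid 1" using w1[OF z] k pid_multL by (simp add: km mk_K)
      then have "c + d * (\<omega> * z) \<notin> pid 1" using k pid_diff[of "c + d * (\<omega> * z)" 1 "d * (\<omega> * z)"] by (auto simp: km)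
      then show ?thesis using G(2) K_mult[OF k(1) zK] k by (simp add: rt_eq km lo_def)
    qed
    moreover have "\<phi> (x + z) = rt (lo (\<omega> * z)) G (lo (\<omega> * x))" if "x \<in> pid 0" for x
      using G(3) that z wx by (simp add: rt_def lo_add pid_add distrib_left)
    ultimately show ?thesis unfolding S_def using rtU[OF zK G(1)] by blast
  qed
  have S6: "\<phi> x = \<phi> y" if \<phi>: "\<phi> \<in> S" and xy: "x \<in> pid 0" "y \<in> pid 0" "cg L x y" for \<phi> x y
  proof -
    obtain G where G: "G \<in> U" "\<forall>x\<in>pid 0. \<phi> x = G (lo (\<omega> * x))"
      using \<phi> unfolding S_def by blast
    have "cg (1 + L) (\<omega> ^ 1 * x) (\<omega> ^ 1 * y)" using xy(3) by (rule cg_unif')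
    then have "mcg (L + 1) (lo (\<omega> * x)) (lo (\<omega> * y))" by (simp add: mcg_def lo_def add.commute)
    then have "G (lo (\<omega> * x)) = G (lo (\<omega> * y))"
      using xy wx by (intro ps_mcg[OF psC_ps[OF psC[OF G(1)]]]) auto
    then show ?thesis using G xy by simp
  qed
  obtain \<phi> \<Lambda>' where \<phi>: "\<phi> \<in> S" "\<phi> 0 \<noteq> 0" "add_char L \<Lambda>'" "\<And>x. x \<in> pid 0 \<Longrightarrow> \<phi> x = \<phi> 0 * \<Lambda>' x"
    using translation_eigenvector[OF S3 S4 S5 S6 S1 pid_0 S2] by blast
  obtain G where G: "G \<in> U" "\<And>k. k \<in> K \<Longrightarrow> k $ 2 $ 1 \<notin> pid 1 \<Longrightarrow> G k = 0"
      "\<And>x. x \<in> pid 0 \<Longrightarrow> \<phi> x = G (lo (\<omega> * x))"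
    using \<phi>(1) unfolding S_def by blast
  obtain u where u: "u \<in> pid 0" "\<And>x. x \<in> pid 0 \<Longrightarrow> \<Lambda>' x = \<Lambda> (u * x)"
    using prim_char_dual[OF prim \<phi>(3)] by blast
  note Gps = psC_ps[OF psC[OF G(1)]]
  have Gb: "G k = \<phi> 0 * basic \<eta> u k" for k
  proof (cases "k \<in> K \<and> k $ 2 $ 1 \<in> pid 1")
    case True
    obtain a b c d where km: "k = mk a b c d" by (rule mk_cases)
    have d: "d \<in> units" using K_lower_right_unit1[of a b c d] True km by simp
    have x: "c / (\<omega> * d) \<in> pid 0" using unif_div d True km by simp
    have "G k = \<eta> (inverse d) * \<phi> (c / (\<omega> * d))"
      using cell_value[OF Gps \<eta>, of k] True G(3)[OF x] by (simp add: km)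
    then show ?thesis using \<phi>(4)[OF x] u(2)[OF x] True by (simp add: basic_def km)
  next
    case False
    then show ?thesis using G(2) ps_outside[OF Gps] by (auto simp: basic_def)
  qed
  have bu: "basic \<eta> u \<in> U"
    using scale[OF G(1), of "inverse (\<phi> 0)"] \<phi>(2) by (simp add: Gb[abs_def] mult.assoc[symmetric])
  \<comment> \<open>The index u of the eigenvector is not under control, but its nonzero component
    at s congruent to u forces u into the class of \<open>\<delta>\<close>.\<close>
  obtain s where s: "s \<in> teich" "cg 1 u s" using teich_exists u by blast
  have "s \<in> sq_class \<delta>"
    using psC_hat[OF psC[OF bu] K_one s(1)] hat_basic_one[OF \<eta> u(1) s] by auto
  then have uC: "u \<in> sq_class \<delta>" using sq_class_cong[OF s(2) u(1) teich_int[OF s(1)]] by simp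
  have bu': "basic \<eta> u' \<in> U" if u': "u' \<in> sq_class \<delta>" for u'
  proof -
    have u'u: "u' \<in> units" and uu: "u \<in> units" using sq_class_units[OF \<delta>] u' uC by auto
    obtain r1 r2 where r: "r1 \<in> units" "cg 1 u (\<delta> * r1\<^sup>2)" "r2 \<in> units" "cg 1 u' (\<delta> * r2\<^sup>2)"
      using u' uC unfolding sq_class_def by blast
    \<comment> \<open>Two indices in one class differ by a square modulo p; lifting it to a square
      modulo p^L makes the corresponding basic vectors torus translates of each other.\<close>
    have "cg 1 (u' / u) ((\<delta> * r2\<^sup>2) / (\<delta> * r1\<^sup>2))"
      using r uu \<delta> by (intro cg_divide) (auto intro!: units_mult units_power units_pid)
    moreover have "(\<delta> * r2\<^sup>2) / (\<delta> * r1\<^sup>2) = (r2 / r1)\<^sup>2"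
      using units_nonzero[OF \<delta>] by (simp add: power_divide)
    ultimately have "cg 1 (u' / u) ((r2 / r1)\<^sup>2)" by simp
    then obtain r where r': "r \<in> units" "cg (Suc L) (u' / u) (r\<^sup>2)"
      using unit_sqrt[OF units_divide[OF u'u uu] units_divide[OF r(3,1)]] by blast
    have "cg L (u * (u' / u)) (u * r\<^sup>2)"
      using cg_multL[OF cg_mono[OF r'(2)] u(1), of L] by simp
    then have "cg L u' (u * r\<^sup>2)" using units_nonzero[OF uu] by simp
    then show ?thesis
      using basic_torus[OF \<eta> u(1) r'(1) units_pid[OF u'u]] scale[OF rtU[OF dg_K[OF r'(1)] bu]] by simp
  qed
  obtain R where R: "crs L R" using crs_power_exists[OF crs_teich] by blast
  have cellall: "cell G \<in> U" if G: "G \<in> psC \<eta> (sq_class \<delta>)" for G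
  proof -
    obtain w where w: "cell G = (\<lambda>k. \<Sum>u\<in>{u\<in>R. u \<in> sq_class \<delta>}. w u * basic \<eta> u k)"
      using basic_expansion[OF G \<eta> R \<delta>] by blast
    show ?thesis unfolding w by (intro sumU scale bu') simp
  qed
  show ?thesis
  proof
    fix G assume G: "G \<in> psC \<eta> (sq_class \<delta>)"
    have hK: "mk (- y) (- 1) 1 0 \<in> K" if "y \<in> teich" for y
      using teich_int[OF that] by (simp add: mk_K)
    have "cell (rt (adj2 (mk (- y) (- 1) 1 0)) G) \<in> U" if "y \<in> teich" for y
      using hK[OF that] K_adj2(1) by (intro cellall psC_rt[OF _ G])
    then have "(\<lambda>k. cell G k + (\<Sum>y\<in>teich. rt (mk (- y) (- 1) 1 0) (cell (rt (adj2 (mk (- y) (- 1) 1 0)) G)) k)) \<in> U"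
      using hK cellall[OF G] by (intro add sumU rtU)
    then show "G \<in> U"
      using cell_cover[OF ps_pf[OF psC_ps[OF G]] ps_outside[OF psC_ps[OF G]]] by simp
  qed
qed

end

section \<open>Projections and twists\<close>

context level_char
begin

definition pr :: "'a \<Rightarrow> ('a mat2 \<Rightarrow> complex) \<Rightarrow> 'a mat2 \<Rightarrow> complex" where
  "pr \<delta> = op (\<lambda>s. if s \<in> sq_class \<delta> then 1 else 0)"

lemma hat_pr: "F \<in> pf \<Longrightarrow> k \<in> K \<Longrightarrow> s \<in> teich \<Longrightarrow> hat (pr \<delta> F) k s = (if s \<in> sq_class \<delta> then hat F k s else 0)"
  by (simp add: pr_def hat_op)

lemma pr_psC:
  assumes F: "F \<in> ps \<eta> (L + 1)" and \<eta>: "unit_char \<eta> L" and \<delta>: "\<delta> \<in> units"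
  shows "pr \<delta> F \<in> psC \<eta> (sq_class \<delta>)"
proof (rule psC_I)
  show "pr \<delta> F \<in> ps \<eta> (L + 1)"
    unfolding pr_def
    by (rule op_ps[OF F \<eta>, where \<alpha> = "\<lambda>_. 1"]) (simp_all add: sq_class_scale \<delta> sq_class_cong)
qed (simp add: hat_pr ps_pf[OF F])

lemma pr_id:
  assumes F: "F \<in> psC \<eta> (sq_class \<delta>)"
  shows "pr \<delta> F = F"
proof
  fix k
  note F1 = psC_ps[OF F]
  show "pr \<delta> F k = F k"
  proof (cases "k \<in> K")
    case True
    have "pr \<delta> F k = (\<Sum>s\<in>teich. hat F k s)"
      unfolding pr_def op_def using True psC_hat[OF F True] by (auto intro!: sum.cong)
    then show ?thesis using hat_inversion[OF ps_pf[OF F1] True] by simp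
  qed (simp add: pr_def op_def ps_outside[OF F1])
qed

lemma pr_other:
  assumes F: "F \<in> psC \<eta> C" and C: "\<And>s. s \<in> teich \<Longrightarrow> s \<in> C \<Longrightarrow> s \<notin> sq_class \<delta>"
  shows "pr \<delta> F = (\<lambda>_. 0)"
proof
  fix k
  have "hat F k s = 0" if "k \<in> K" "s \<in> teich" "s \<in> sq_class \<delta>" for s
    using psC_hat[OF F that(1,2)] C that by blast
  then show "pr \<delta> F k = 0"
    unfolding pr_def op_def by (cases "k \<in> K") (auto intro!: sum.neutral)
qed

text \<open>The nonzero parameters s are exhausted by the two square classes, so killing both
  projections leaves s = 0 only.\<close>

lemma pr_kernel:
  assumes F: "F \<in> ps \<eta> (L + 1)" and \<eta>: "unit_char \<eta> L" and \<delta>: "\<delta> \<in> units"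
    and dich: "\<And>s. s \<in> units \<Longrightarrow> s \<in> sq_class 1 \<longleftrightarrow> s \<notin> sq_class \<delta>"
  shows "F \<in> ps \<eta> L \<longleftrightarrow> pr 1 F = (\<lambda>_. 0) \<and> pr \<delta> F = (\<lambda>_. 0)"
proof
  assume "F \<in> ps \<eta> L"
  then have F0: "F \<in> psC \<eta> {0}" using ps_lower[OF \<eta>] by simp
  have "0 \<notin> sq_class d" if "d \<in> units" for d
    using sq_class_units[OF that, of 0] units_nonzero by blast
  then show "pr 1 F = (\<lambda>_. 0) \<and> pr \<delta> F = (\<lambda>_. 0)"
    using pr_other[OF F0] \<delta> by auto
next
  assume 0: "pr 1 F = (\<lambda>_. 0) \<and> pr \<delta> F = (\<lambda>_. 0)"
  have "hat F k s = 0" if k: "k \<in> K" and s: "s \<in> teich" "s \<notin> {0}" for k s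
  proof -
    have h0: "hat (\<lambda>_. 0) k s = 0" by (simp add: hat_def)
    have "s \<in> sq_class 1 \<or> s \<in> sq_class \<delta>" using dich teich_units s by blast
    then show ?thesis
      using hat_pr[OF ps_pf[OF F] k s(1), of 1] hat_pr[OF ps_pf[OF F] k s(1), of \<delta>] 0 h0 by auto
  qed
  then have "F \<in> psC \<eta> {0}" using F by (intro psC_I)
  then show "F \<in> ps \<eta> L" using ps_lower[OF \<eta>] by simp
qed

text \<open>The weight is \<alpha>(r) at s = \<delta> r^2 and 0 off the class. Modulo p the root r
  is determined up to sign, and \<alpha>(-1) = 1 removes the ambiguity.\<close>

lemma sq_weight_exists:
  assumes \<alpha>: "unit_char \<alpha> 1" "\<alpha> (- 1) = 1" and \<delta>: "\<delta> \<in> units"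
  obtains a where "\<And>s t. s \<in> pid 0 \<Longrightarrow> t \<in> units \<Longrightarrow> a (t\<^sup>2 * s) = \<alpha> t * a s"
    "\<And>s s'. s \<in> pid 0 \<Longrightarrow> s' \<in> pid 0 \<Longrightarrow> cg 1 s s' \<Longrightarrow> a s = a s'"
    "\<And>s. s \<in> pid 0 \<Longrightarrow> s \<in> sq_class \<delta> \<longleftrightarrow> a s \<noteq> 0"
proof -
  define a where "a s = (if s \<in> sq_class \<delta> then \<alpha> (SOME r. r \<in> units \<and> cg 1 s (\<delta> * r\<^sup>2)) else 0)" for s
  have val: "a s = \<alpha> r" if s: "s \<in> pid 0" and r: "r \<in> units" "cg 1 s (\<delta> * r\<^sup>2)" for s r
  proof -
    have sC: "s \<in> sq_class \<delta>" using s r by (auto simp: sq_class_def)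
    define r' where "r' = (SOME r. r \<in> units \<and> cg 1 s (\<delta> * r\<^sup>2))"
    have r': "r' \<in> units \<and> cg 1 s (\<delta> * r'\<^sup>2)"
      unfolding r'_def by (rule someI[of _ r]) (use r in blast)
    then have "cg 1 (\<delta> * r'\<^sup>2) (\<delta> * r\<^sup>2)" using r cg_trans cg_sym by blast
    then have "cg 1 (r'\<^sup>2) (r\<^sup>2)" using cg_cancelL \<delta> by blast
    then have "cg 1 r' r \<or> cg 1 r' (- r)" using cg_squareE r r' by blast
    then show ?thesis
    proof
      assume "cg 1 r' r"
      then show ?thesis using unit_char_cong[OF \<alpha>(1), of r' r] r r' sC by (simp add: a_def r'_def)
    next
      assume "cg 1 r' (- r)"
      moreover have "\<alpha> (- r) = \<alpha> r"
        using unit_char_mult[OF \<alpha>(1), of "- 1" r] \<alpha>(2) r by simp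
      ultimately show ?thesis using unit_char_cong[OF \<alpha>(1), of r' "- r"] r r' sC by (simp add: a_def r'_def)
    qed
  qed
  have rt: "\<exists>r\<in>units. cg 1 s (\<delta> * r\<^sup>2)" if "s \<in> sq_class \<delta>" for s
    using that by (auto simp: sq_class_def)
  show ?thesis
  proof (rule that)
    fix s t assume s: "s \<in> pid 0" and t: "t \<in> units"
    have ts: "t\<^sup>2 * s \<in> pid 0" using s t by (simp add: pid_mult0 units_power)
    show "a (t\<^sup>2 * s) = \<alpha> t * a s"
    proof (cases "s \<in> sq_class \<delta>")
      case True
      then obtain r where r: "r \<in> units" "cg 1 s (\<delta> * r\<^sup>2)" using rt by blast
      have "cg 1 (t\<^sup>2 * s) (t\<^sup>2 * (\<delta> * r\<^sup>2))" using r t by (intro cg_multL) (auto simp: units_power)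
      then have "cg 1 (t\<^sup>2 * s) (\<delta> * (t * r)\<^sup>2)" by (simp add: power_mult_distrib mult_ac)
      then have "a (t\<^sup>2 * s) = \<alpha> (t * r)" using val[OF ts units_mult[OF t r(1)]] by blast
      then show ?thesis using val[OF s r] unit_char_mult[OF \<alpha>(1) t r(1)] by simp
    next
      case False
      then show ?thesis using sq_class_scale[OF t s \<delta>] by (simp add: a_def)
    qed
  next
    fix s s' assume s: "s \<in> pid 0" "s' \<in> pid 0" "cg 1 s s'"
    show "a s = a s'"
    proof (cases "s \<in> sq_class \<delta>")
      case True
      then obtain r where r: "r \<in> units" "cg 1 s (\<delta> * r\<^sup>2)" using rt by blast
      moreover from this have "cg 1 s' (\<delta> * r\<^sup>2)" using s cg_trans cg_sym by blast
      ultimately show ?thesis using val s by metis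
    next
      case False
      then show ?thesis using sq_class_cong[OF s(3,1,2)] by (simp add: a_def)
    qed
  next
    fix s assume s: "s \<in> pid 0"
    show "s \<in> sq_class \<delta> \<longleftrightarrow> a s \<noteq> 0"
    proof
      assume "s \<in> sq_class \<delta>"
      then obtain r where "r \<in> units" "cg 1 s (\<delta> * r\<^sup>2)" using rt by blast
      then show "a s \<noteq> 0" using val[OF s] unit_char_nonzero[OF \<alpha>(1)] by simp
    qed (auto simp: a_def split: if_splits)
  qed
qed

lemma psC_iso:
  assumes \<eta>: "unit_char \<eta> L" and \<eta>': "unit_char \<eta>' L" and \<alpha>: "unit_char \<alpha> 1" "\<alpha> (- 1) = 1"
    and tw: "\<And>t. t \<in> units \<Longrightarrow> \<eta>' t = \<eta> t * \<alpha> t" and \<delta>: "\<delta> \<in> units"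
  obtains a where "bij_betw (op a) (psC \<eta> (sq_class \<delta>)) (psC \<eta>' (sq_class \<delta>))"
proof -
  obtain a where a: "\<And>s t. s \<in> pid 0 \<Longrightarrow> t \<in> units \<Longrightarrow> a (t\<^sup>2 * s) = \<alpha> t * a s"
    "\<And>s s'. s \<in> pid 0 \<Longrightarrow> s' \<in> pid 0 \<Longrightarrow> cg 1 s s' \<Longrightarrow> a s = a s'"
    "\<And>s. s \<in> pid 0 \<Longrightarrow> s \<in> sq_class \<delta> \<longleftrightarrow> a s \<noteq> 0"
    using sq_weight_exists[OF \<alpha> \<delta>] by blast
  \<comment> \<open>With \<open>inverse 0 = 0\<close> the weight \<open>b\<close> also vanishes off
    the class, so it is homogeneous for the inverse of \<open>\<alpha>\<close> everywhere.\<close>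
  define b where "b s = inverse (a s)" for s
  have b: "b (t\<^sup>2 * s) = inverse (\<alpha> t) * b s" if "s \<in> pid 0" "t \<in> units" for s t
    using a(1)[OF that] by (simp add: b_def)
  have b2: "b s = b s'" if "s \<in> pid 0" "s' \<in> pid 0" "cg 1 s s'" for s s'
    unfolding b_def using a(2)[OF that] by simp
  have map: "op a F \<in> psC \<eta>' (sq_class \<delta>)" if F: "F \<in> psC \<eta> (sq_class \<delta>)" for F
  proof (rule psC_I)
    show "op a F \<in> ps \<eta>' (L + 1)" by (rule op_ps[OF psC_ps[OF F] \<eta> a(1,2) tw])
    show "hat (op a F) k s = 0" if "k \<in> K" "s \<in> teich" "s \<notin> sq_class \<delta>" for k s
      using hat_op[OF ps_pf[OF psC_ps[OF F]] that(1,2)] psC_hat[OF F that] by simp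
  qed
  have map': "op b F \<in> psC \<eta> (sq_class \<delta>)" if F: "F \<in> psC \<eta>' (sq_class \<delta>)" for F
  proof (rule psC_I)
    show "op b F \<in> ps \<eta> (L + 1)"
      by (rule op_ps[OF psC_ps[OF F] \<eta>' b b2]) (use tw unit_char_nonzero[OF \<alpha>(1)] in auto)
    show "hat (op b F) k s = 0" if "k \<in> K" "s \<in> teich" "s \<notin> sq_class \<delta>" for k s
      using hat_op[OF ps_pf[OF psC_ps[OF F]] that(1,2)] psC_hat[OF F that] by simp
  qed
  have weight: "(\<Sum>s\<in>teich. (w s * w' s) * hat F k s) = (\<Sum>s\<in>teich. hat F k s)"
    if F: "F \<in> psC \<eta>0 (sq_class \<delta>)" and k: "k \<in> K"
      and w: "\<And>s. s \<in> pid 0 \<Longrightarrow> s \<in> sq_class \<delta> \<Longrightarrow> w s * w' s = 1" for F k w w' \<eta>0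
  proof (intro sum.cong refl)
    fix s assume s: "s \<in> teich"
    show "(w s * w' s) * hat F k s = hat F k s"
      using w[OF teich_int[OF s]] psC_hat[OF F k s] by (cases "s \<in> sq_class \<delta>") auto
  qed
  have inv: "op w (op w' F) = F"
    if F: "F \<in> psC \<eta>0 (sq_class \<delta>)"
      and w: "\<And>s. s \<in> pid 0 \<Longrightarrow> s \<in> sq_class \<delta> \<Longrightarrow> w s * w' s = 1" for F w w' \<eta>0
  proof
    fix k
    note F1 = psC_ps[OF F]
    show "op w (op w' F) k = F k"
      unfolding op_op[OF ps_pf[OF F1]]
      using weight[OF F _ w] hat_inversion[OF ps_pf[OF F1]] ps_outside[OF F1] by (simp add: op_def)
  qed
  have "bij_betw (op a) (psC \<eta> (sq_class \<delta>)) (psC \<eta>' (sq_class \<delta>))"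
    by (rule bij_betwI[of _ _ _ "op b"]) (use map map' inv a(3) b_def in auto)
  then show ?thesis by (rule that)
qed

end

section \<open>Intertwining maps\<close>

context nonarch_local_field
begin

lemma up_K: "z \<in> pid 0 \<Longrightarrow> mk 1 z 0 1 \<in> K"
  by (simp add: mk_K)

text \<open>The vector supported on the Borel subgroup modulo \<open>p^l\<close> is an eigenvector of the Borel subgroup;
  its image under an intertwining map can only live on the closed or on the open cell.\<close>

lemma ps_intertwiner:
  assumes l: "1 \<le> l" and \<eta>: "unit_char \<eta> l" and \<eta>': "unit_char \<eta>' l"
    and nontriv: "2 \<le> l \<Longrightarrow> \<exists>x\<in>pid (l - 1). \<eta>' (1 + x) \<noteq> 1"
    and map: "\<And>F. F \<in> ps \<eta> l \<Longrightarrow> f F \<in> ps \<eta>' l"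
    and scale: "\<And>c F. F \<in> ps \<eta> l \<Longrightarrow> f (\<lambda>x. c * F x) = (\<lambda>x. c * f F x)"
    and rtf: "\<And>g F. g \<in> K \<Longrightarrow> F \<in> ps \<eta> l \<Longrightarrow> f (rt g F) = rt g (f F)"
    and inj: "inj_on f (ps \<eta> l)"
  shows "(\<forall>t\<in>units. \<eta> t = \<eta>' t) \<or> (\<forall>t\<in>units. \<eta> t * \<eta>' t = 1)"
proof -
  define e where "e k = (if k \<in> K \<and> k $ 2 $ 1 \<in> pid l then \<eta> (inverse (k $ 2 $ 2)) else 0)" for k
  have e: "e \<in> ps \<eta> l"
  proof (rule ps_I)
    fix B k assume B: "B \<in> borel" "B \<in> K" and k: "k \<in> K"
    obtain t z v t' where Bm: "B = mk t z v t'" by (rule mk_cases)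
    have tt: "t * t' = 1" "v = 0" using B by (auto simp: Bm borel_mk)
    have t: "t \<in> units" "t' \<in> units" using B units_mult_iff[of t t'] tt by (auto simp: Bm mk_K)
    have t': "t' = inverse t" using tt by (metis inverse_unique)
    obtain a b c d where km: "k = mk a b c d" by (rule mk_cases)
    have c: "t' * c \<in> pid l \<longleftrightarrow> c \<in> pid l"
      using t pid_multL[of t' c l] pid_multL[of t "t' * c" l] tt by (auto simp: mult.assoc[symmetric])
    have Bk: "B ** k \<in> K" using B k K_mult by blast
    show "e (B ** k) = \<eta> (B $ 1 $ 1) * e k"
    proof (cases "c \<in> pid l")
      case True
      then have d: "d \<in> units" using K_lower_right_unit k km l by blast
      have "\<eta> (inverse (t' * d)) = \<eta> t * \<eta> (inverse d)"
        using unit_char_mult[OF \<eta> t(1) units_inverse[OF d]] by (simp add: t')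
      then show ?thesis using True c Bk k by (simp add: e_def Bm km tt)
    next
      case False
      then show ?thesis using c by (simp add: e_def Bm km tt)
    qed
  next
    fix x y assume m: "mcg l x y" and xy: "x \<in> K" "y \<in> K"
    obtain a b c d where x: "x = mk a b c d" by (rule mk_cases)
    obtain a' b' c' d' where y: "y = mk a' b' c' d'" by (rule mk_cases)
    have cc: "cg l c c'" and dd: "cg l d d'" using m by (auto simp: mcg_def x y)
    have c1: "c \<in> pid l \<longleftrightarrow> c' \<in> pid l"
      using cg_pid[OF cc] cg_pid[OF cg_sym[OF cc]] by auto
    show "e x = e y"
    proof (cases "c \<in> pid l")
      case True
      then have d: "d \<in> units" "d' \<in> units" using K_lower_right_unit xy x y c1 l by blast+
      have "\<eta> (inverse d) = \<eta> (inverse d')"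
        using unit_char_cong[OF \<eta> units_inverse units_inverse cg_inverse[OF dd]] d by blast
      then show ?thesis using True c1 xy by (simp add: e_def x y)
    next
      case False
      then show ?thesis using c1 by (simp add: e_def x y)
    qed
  qed (simp add: e_def)
  have e_up: "rt (mk 1 z 0 1) e = e" if z: "z \<in> pid 0" for z
  proof
    fix k
    show "rt (mk 1 z 0 1) e k = e k"
    proof (cases "k \<in> K")
      case k: True
      obtain a b c d where km: "k = mk a b c d" by (rule mk_cases)
      have ku: "k ** mk 1 z 0 1 \<in> K" using K_mult[OF k up_K[OF z]] .
      show ?thesis
      proof (cases "c \<in> pid l")
        case True
        then have d: "d \<in> units" using K_lower_right_unit k km l by blast
        have d': "c * z + d \<in> units" using K_lower_right_unit[of a "a * z + b" c "c * z + d" l] ku km True l by simp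
        have "cg l (c * z + d) d" using True z by (simp add: cg_def pid_multR)
        then have "\<eta> (inverse (c * z + d)) = \<eta> (inverse d)"
          using unit_char_cong[OF \<eta> units_inverse units_inverse cg_inverse] d d' by blast
        then show ?thesis using True ku unfolding rt_eq[OF k] e_def using k by (simp add: km)
      next
        case False
        then show ?thesis unfolding rt_eq[OF k] e_def by (simp add: km)
      qed
    qed (simp add: rt_def e_def)
  qed
  have e_dg: "rt (dg t) e = (\<lambda>k. \<eta> t * e k)" if t: "t \<in> units" for t
  proof
    fix k
    show "rt (dg t) e k = \<eta> t * e k"
    proof (cases "k \<in> K")
      case k: True
      obtain a b c d where km: "k = mk a b c d" by (rule mk_cases)
      have ku: "k ** dg t \<in> K" using K_mult[OF k dg_K[OF t]] .
      have ct: "c * t \<in> pid l \<longleftrightarrow> c \<in> pid l"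
        using pid_multR[of c l t] pid_multR[of "c * t" l "inverse t"] t units_inverse[OF t] units_nonzero[OF t]
        by (auto simp: mult.assoc)
      show ?thesis
      proof (cases "c \<in> pid l")
        case True
        then have d: "d \<in> units" using K_lower_right_unit k km l by blast
        have "\<eta> (inverse (d * inverse t)) = \<eta> t * \<eta> (inverse d)"
          using unit_char_mult[OF \<eta> t units_inverse[OF d]] by (simp add: mult.commute)
        then show ?thesis using True ku ct k unfolding rt_eq[OF k] e_def by (simp add: km dg_mk)
      next
        case False
        then show ?thesis using ct unfolding rt_eq[OF k] e_def by (simp add: km dg_mk)
      qed
    qed (simp add: rt_def e_def)
  qed
  define \<Phi> where "\<Phi> = f e"
  have \<Phi>: "\<Phi> \<in> ps \<eta>' l" using map[OF e] by (simp add: \<Phi>_def)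
  have \<Phi>up: "\<Phi> (k ** mk 1 z 0 1) = \<Phi> k" if "k \<in> K" "z \<in> pid 0" for k z
  proof -
    have "rt (mk 1 z 0 1) \<Phi> = \<Phi>" unfolding \<Phi>_def using rtf[OF up_K[OF that(2)] e] e_up[OF that(2)] by simp
    then show ?thesis using rt_eq[OF that(1)] by metis
  qed
  have \<Phi>dg: "\<Phi> (k ** dg t) = \<eta> t * \<Phi> k" if "k \<in> K" "t \<in> units" for k t
  proof -
    have "rt (dg t) \<Phi> = (\<lambda>k. \<eta> t * \<Phi> k)" unfolding \<Phi>_def using rtf[OF dg_K[OF that(2)] e] e_dg[OF that(2)] scale[OF e] by simp
    then show ?thesis using rt_eq[OF that(1), of "dg t" \<Phi>] by simp
  qed
  have \<Phi>nz: "\<Phi> \<noteq> (\<lambda>_. 0)"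
  proof
    assume "\<Phi> = (\<lambda>_. 0)"
    then have "f e = f (\<lambda>x. 0 * e x)" using scale[OF e, of 0] by (simp add: \<Phi>_def)
    then have "e = (\<lambda>x. 0 * e x)" using inj e ps_scale[OF e, of 0] by (auto dest: inj_onD)
    then have "e (mat 1) = 0" by (metis mult_zero_left)
    then show False using unit_char_one[OF \<eta>] K_one by (simp add: e_def mat_1_mk)
  qed
  \<comment> \<open>A representative of the open cell; whether \<Phi> vanishes there decides between
    the two alternatives.\<close>
  define w where "w = mk 0 (- 1) 1 (0::'a)"
  have wK: "w \<in> K" by (simp add: w_def mk_K)
  have row: "\<Phi> k = \<eta>' (inverse t) * \<Phi> k'"
    if "k \<in> K" "k' \<in> K" "t \<in> units" "cg l (k $ 2 $ 1) (t * k' $ 2 $ 1)" "cg l (k $ 2 $ 2) (t * k' $ 2 $ 2)" for k k' t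
    using ps_row[OF \<Phi>, of "k $ 1 $ 1" "k $ 1 $ 2" "k $ 2 $ 1" "k $ 2 $ 2" "k' $ 1 $ 1" "k' $ 1 $ 2" "k' $ 2 $ 1" "k' $ 2 $ 2" t] that
    by simp
  show ?thesis
  proof (cases "\<Phi> w = 0")
    case False
    \<comment> \<open>\<open>w\<close> exchanges the diagonal entries, so the right torus action at
      \<open>w\<close> is the inverse of the left one.\<close>
    have "\<eta> t * \<eta>' t = 1" if t: "t \<in> units" for t
    proof -
      have "\<Phi> (w ** dg t) = \<eta>' (inverse t) * \<Phi> w"
        using t units_nonzero[OF t] by (intro row K_mult wK dg_K) (simp_all add: w_def dg_mk)
      then have "\<eta> t = \<eta>' (inverse t)" using \<Phi>dg[OF wK t] False by simp
      then show ?thesis using unit_char_inverse[OF \<eta>' t] unit_char_nonzero[OF \<eta>' t] by simp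
    qed
    then show ?thesis by blast
  next
    case w0: True
    have zero: "\<Phi> k = 0" if k: "k \<in> K" "k $ 2 $ 1 \<notin> pid l" for k
    proof -
      obtain a b c d where km: "k = mk a b c d" by (rule mk_cases)
      have int: "c \<in> pid 0" "d \<in> pid 0" using k by (auto simp: km mk_K)
      show ?thesis
      proof (cases "c \<in> pid 1")
        case False
        then have c: "c \<in> units" using int units_iff_pid by blast
        have z: "- d / c \<in> pid 0" unfolding divide_inverse using int c by (simp add: pid_mult0 units_inverse)
        have "\<Phi> k = \<Phi> (k ** mk 1 (- d / c) 0 1)" using \<Phi>up[OF k(1) z] by simp
        also have "\<dots> = \<eta>' (inverse c) * \<Phi> w"
          using units_nonzero[OF c] by (intro row K_mult k up_K z wK c) (simp_all add: km w_def)
        finally show ?thesis using w0 by simp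
      next
        case True
        have c0: "c \<noteq> 0" "1 \<le> val c" "val c < int l" using True k int by (auto simp: km pid_iff)
        then have "2 \<le> l" by simp
        then obtain x where x: "x \<in> pid (l - 1)" "\<eta>' (1 + x) \<noteq> 1" using nontriv by blast
        have d: "d \<in> units" using K_lower_right_unit[OF _ True] k km by blast
        have x1: "x \<in> pid 1" using x(1) \<open>2 \<le> l\<close> by (elim pid_mono) simp
        define t where "t = 1 + x"
        have t: "t \<in> units" using one_add_pid_units[OF x1] by (simp add: t_def)
        \<comment> \<open>The intermediate cells, 1 <= val c < l, are excluded: with this z the
          upper unipotent fixes \<Phi> and multiplies the bottom row by 1 + x modulo p^l, since c x
          lies in p^l, while \<open>\<eta>'\<close> is nontrivial at 1 + x.\<close>
        define z where "z = d * x / c"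
        have "x / c \<in> pid 0" using x(1) c0 \<open>2 \<le> l\<close> by (cases "x = 0") (auto simp: pid_iff val_divide of_nat_diff)
        then have z: "z \<in> pid 0" using pid_mult0[OF int(2), of "x / c"] by (simp add: z_def)
        have "c * x \<in> pid (1 + (l - 1))" using pid_mult[OF True x(1)] .
        then have cx: "c * x \<in> pid l" using l by simp
        have "\<Phi> k = \<Phi> (k ** mk 1 z 0 1)" using \<Phi>up[OF k(1) z] by simp
        also have "\<dots> = \<eta>' (inverse t) * \<Phi> k"
        proof (intro row K_mult k up_K z t)
          show "cg l ((k ** mk 1 z 0 1) $ 2 $ 1) (t * k $ 2 $ 1)"
            using cx pid_uminus[of "c * x" l] by (simp add: km t_def cg_def algebra_simps)
          show "cg l ((k ** mk 1 z 0 1) $ 2 $ 2) (t * k $ 2 $ 2)"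
            using c0 by (simp add: km t_def z_def algebra_simps)
        qed
        finally have "(\<eta>' (inverse t) - 1) * \<Phi> k = 0" by (simp add: algebra_simps)
        moreover have "\<eta>' (inverse t) \<noteq> 1"
          using unit_char_inverse[OF \<eta>' t] x(2) unit_char_nonzero[OF \<eta>' t] by (simp add: t_def)
        ultimately show ?thesis by simp
      qed
    qed
    have closed: "\<Phi> k = \<eta>' (inverse (k $ 2 $ 2)) * \<Phi> (mat 1)" if k: "k \<in> K" "k $ 2 $ 1 \<in> pid l" for k
    proof -
      obtain a b c d where km: "k = mk a b c d" by (rule mk_cases)
      have d: "d \<in> units" using K_lower_right_unit[of a b c d l] k km l by simp
      show ?thesis using k d by (intro row K_one) (simp_all add: km mat_1_mk cg_0_iff)
    qed
    have one: "\<Phi> (mat 1) \<noteq> 0"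
    proof
      assume 0: "\<Phi> (mat 1) = 0"
      have "\<Phi> k = 0" for k
        using zero[of k] closed[of k] ps_outside[OF \<Phi>, of k] 0 by (cases "k \<in> K"; cases "k $ 2 $ 1 \<in> pid l") auto
      then show False using \<Phi>nz by blast
    qed
    have "\<eta> t = \<eta>' t" if t: "t \<in> units" for t
    proof -
      have "\<Phi> (dg t) = \<eta>' t * \<Phi> (mat 1)"
        using closed[OF dg_K[OF t]] by (simp add: dg_mk)
      then show ?thesis using \<Phi>dg[OF K_one t] one by simp
    qed
    then show ?thesis by blast
  qed
qed

section \<open>The standard intertwining operator at level 1\<close>

definition weyl :: "'a \<Rightarrow> 'a mat2" where
  "weyl x = mk 0 (- 1) 1 x"

text \<open>The integral of F(w n k) over the unipotent radical, which at level 1 is a finite sum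
  over the residue field; \<open>weyl x\<close> is w times the upper unipotent with entry x.\<close>

definition intertwine :: "('a mat2 \<Rightarrow> complex) \<Rightarrow> 'a mat2 \<Rightarrow> complex" where
  "intertwine F k = (if k \<in> K then \<Sum>x\<in>teich. F (weyl x ** k) else 0)"

lemma weyl_K: "x \<in> pid 0 \<Longrightarrow> weyl x \<in> K"
  by (simp add: weyl_def mk_K)

lemma weyl_cong:
  assumes "F \<in> ps \<eta> 1" "k \<in> K" "x \<in> pid 0" "y \<in> pid 0" "cg 1 x y"
  shows "F (weyl x ** k) = F (weyl y ** k)"
proof (rule ps_mcg[OF assms(1)])
  have "mcg 1 (weyl x) (weyl y)" using assms(5) by (simp add: mcg_def weyl_def)
  then show "mcg 1 (weyl x ** k) (weyl y ** k)"
    by (rule mcg_multR) (use assms weyl_K in auto)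
qed (use assms weyl_K K_mult in auto)

text \<open>Moving a Borel element past \<open>weyl x\<close> inverts its torus part and changes x
  by an affine substitution with unit slope, which the sum absorbs.\<close>

lemma intertwine_ps:
  assumes F: "F \<in> ps \<eta> 1" and \<eta>: "unit_char \<eta> 1" and \<eta>': "\<And>t. t \<in> units \<Longrightarrow> \<eta>' t * \<eta> t = 1"
  shows "intertwine F \<in> ps \<eta>' 1"
proof (rule ps_I)
  fix B k assume B: "B \<in> borel" "B \<in> K" and k: "k \<in> K"
  obtain t z v t' where Bm: "B = mk t z v t'" by (rule mk_cases)
  have tt: "t * t' = 1" "v = 0" using B by (auto simp: Bm borel_mk)
  have t: "t \<in> units" "t' \<in> units" and z: "z \<in> pid 0"
    using B units_mult_iff[of t t'] tt by (auto simp: Bm mk_K)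
  have t': "inverse t = t'" "inverse t' = t" using tt by (metis inverse_unique mult.commute)+
  have eq: "F (weyl x ** (B ** k)) = \<eta> t' * F (weyl (t' * t' * x + z * t') ** k)" if x: "x \<in> teich" for x
  proof -
    have x0: "x \<in> pid 0" using x teich_int by blast
    have x': "t' * t' * x + z * t' \<in> pid 0" using t z x0 by (auto intro!: pid_add pid_mult0)
    have tu: "t * (t' * u) = u" "t' * (t * u) = u" for u
      using tt by (metis mult.assoc mult.commute mult_1)+
    have "weyl x ** B = dg t' ** weyl (t' * t' * x + z * t')"
      by (simp add: weyl_def Bm tt dg_mk t' algebra_simps tu)
    then have "weyl x ** (B ** k) = dg t' ** (weyl (t' * t' * x + z * t') ** k)"
      by (simp add: matrix_mul_assoc)
    moreover have "dg t' \<in> borel" using units_nonzero[OF t(2)] by (simp add: dg_mk borel_mk)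
    ultimately show ?thesis
      using ps_borel[OF F _ dg_K[OF t(2)] K_mult[OF weyl_K[OF x'] k]] by (simp add: dg_mk)
  qed
  have "intertwine F (B ** k) = \<eta> t' * (\<Sum>x\<in>teich. F (weyl (t' * t' * x + z * t') ** k))"
    using eq B k K_mult by (simp add: intertwine_def sum_distrib_left cong: sum.cong)
  also have "(\<Sum>x\<in>teich. F (weyl (t' * t' * x + z * t') ** k)) = (\<Sum>x\<in>teich. F (weyl x ** k))"
  proof (rule crs_sum_reindex[OF crs_teich, where g = "\<lambda>x. F (weyl x ** k)"])
    show "t' * t' * s + z * t' \<in> pid 0" if "s \<in> teich" for s
      using t z teich_int[OF that] by (auto intro!: pid_add pid_mult0)
    show "s = u" if "s \<in> teich" "u \<in> teich" "cg 1 (t' * t' * s + z * t') (t' * t' * u + z * t')" for s u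
    proof -
      have "cg 1 (t' * t' * s) (t' * t' * u)" using that(3) by (simp add: cg_def)
      then have "cg 1 s u" using cg_cancelL units_mult[OF t(2) t(2)] by blast
      then show ?thesis using teich_inj that by blast
    qed
    show "F (weyl x ** k) = F (weyl y ** k)" if "x \<in> pid 0" "y \<in> pid 0" "cg 1 x y" for x y
      using weyl_cong[OF F k that] .
  qed
  moreover have "\<eta> t' = \<eta>' t"
  proof -
    have "\<eta> t * \<eta> t' = \<eta> t * \<eta>' t"
      using unit_char_mult[OF \<eta> t] tt unit_char_one[OF \<eta>] \<eta>'[OF t(1)] by (simp add: mult.commute)
    then show ?thesis using unit_char_nonzero[OF \<eta> t(1)] by simp
  qed
  ultimately show "intertwine F (B ** k) = \<eta>' (B $ 1 $ 1) * intertwine F k"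
    using k by (simp add: intertwine_def Bm)
next
  fix x y assume xy: "mcg 1 x y" "x \<in> K" "y \<in> K"
  have "F (weyl s ** x) = F (weyl s ** y)" if "s \<in> teich" for s
    using xy weyl_K[OF teich_int[OF that]] K_mult by (intro ps_mcg[OF F] mcg_multL) auto
  then show "intertwine F x = intertwine F y" using xy by (simp add: intertwine_def cong: sum.cong)
qed (simp add: intertwine_def)

text \<open>In the double sum, \<open>weyl 0 ** weyl x\<close> is a Borel element with diagonal
  entries -1, giving q \<eta>(-1) F. For y nonzero, \<open>weyl y ** weyl x\<close> has bottom row y
  times that of \<open>weyl (x - 1 / y)\<close>; these terms total a character sum over the residue
  units, zero for nontrivial \<eta>.\<close>

lemma intertwine_twice:
  assumes F: "F \<in> ps \<eta> 1" and \<eta>: "unit_char \<eta> 1" and nt: "\<exists>t\<in>units. \<eta> t \<noteq> 1"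
  shows "intertwine (intertwine F) = (\<lambda>k. of_nat q * \<eta> (- 1) * F k)"
proof
  fix k
  show "intertwine (intertwine F) k = of_nat q * \<eta> (- 1) * F k"
  proof (cases "k \<in> K")
    case k: True
    \<comment> \<open>The inverse character extended by 0 to nonunits, so that its sum can run over
      the full residue system.\<close>
    define h where "h y = (if y \<in> units then \<eta> (inverse y) else 0)" for y
    have hsum: "(\<Sum>y\<in>teich. h y) = 0"
    proof -
      obtain t where t: "t \<in> units" "\<eta> t \<noteq> 1" using nt by blast
      have per: "h x = h y" if "x \<in> pid 0" "y \<in> pid 0" "cg 1 x y" for x y
        using cg_units[OF that(3)] cg_units[OF cg_sym[OF that(3)]] 
          unit_char_cong[OF \<eta> units_inverse units_inverse cg_inverse[OF that(3)]]
        by (auto simp: h_def)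
      have ht: "h (t * y) = \<eta> (inverse t) * h y" if "y \<in> teich" for y
        using units_mult_iff[OF units_pid[OF t(1)] teich_int[OF that]] t
          unit_char_mult[OF \<eta> units_inverse[OF t(1)] units_inverse] by (auto simp: h_def)
      have "(\<Sum>y\<in>teich. h (t * y)) = (\<Sum>y\<in>teich. h y)"
        by (rule crs_sum_scale[OF crs_teich t(1)]) (rule per)
      then have "(\<Sum>y\<in>teich. h y) = \<eta> (inverse t) * (\<Sum>y\<in>teich. h y)"
        using ht by (simp add: sum_distrib_left cong: sum.cong)
      moreover have "\<eta> (inverse t) \<noteq> 1" using unit_char_inverse[OF \<eta> t(1)] t(2) unit_char_nonzero[OF \<eta> t(1)] by simp
      ultimately show ?thesis by simp
    qed
    have term0: "(\<Sum>x\<in>teich. F (weyl 0 ** (weyl x ** k))) = of_nat q * \<eta> (- 1) * F k"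
    proof -
      have "F (weyl 0 ** (weyl x ** k)) = \<eta> (- 1) * F k" if "x \<in> teich" for x
      proof -
        have x0: "x \<in> pid 0" using that teich_int by blast
        have "weyl 0 ** (weyl x ** k) = mk (- 1) (- x) 0 (- 1) ** k"
          unfolding matrix_mul_assoc by (simp add: weyl_def)
        moreover have "mk (- 1) (- x) 0 (- 1) \<in> borel" "mk (- 1) (- x) 0 (- 1) \<in> K"
          using x0 by (simp_all add: borel_mk mk_K)
        ultimately show ?thesis using ps_borel[OF F _ _ k] by simp
      qed
      then show ?thesis by (simp add: card_teich cong: sum.cong)
    qed
    have termy: "(\<Sum>x\<in>teich. F (weyl y ** (weyl x ** k))) = h y * intertwine F k" if y: "y \<in> teich" "y \<noteq> 0" for y
    proof -
      have yu: "y \<in> units" using teich_units y by blast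
      have iy: "- inverse y \<in> pid 0" using units_inverse[OF yu] by simp
      have "F (weyl y ** (weyl x ** k)) = \<eta> (inverse y) * F (weyl (x + - inverse y) ** k)" if "x \<in> teich" for x
      proof -
        have x0: "x \<in> pid 0" using that teich_int by blast
        have x1: "x + - inverse y \<in> pid 0" using x0 iy by (rule pid_add)
        obtain a b c d where km: "k = mk a b c d" by (rule mk_cases)
        have K1: "weyl y ** (weyl x ** k) \<in> K" "weyl (x + - inverse y) ** k \<in> K"
          using weyl_K x0 x1 units_pid[OF yu] k K_mult by blast+
        show ?thesis
          using K1 units_nonzero[OF yu] unfolding km weyl_def mk_mult
          by (intro ps_row[OF F _ _ yu]) (simp_all add: algebra_simps)
      qed
      then have "(\<Sum>x\<in>teich. F (weyl y ** (weyl x ** k))) = \<eta> (inverse y) * (\<Sum>x\<in>teich. F (weyl (x + - inverse y) ** k))"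
        by (simp add: sum_distrib_left cong: sum.cong)
      also have "(\<Sum>x\<in>teich. F (weyl (x + - inverse y) ** k)) = (\<Sum>x\<in>teich. F (weyl x ** k))"
        by (rule crs_sum_shift[OF crs_teich iy, of "\<lambda>x. F (weyl x ** k)"]) (rule weyl_cong[OF F k])
      finally show ?thesis using yu k by (simp add: h_def intertwine_def)
    qed
    have "intertwine (intertwine F) k = (\<Sum>x\<in>teich. \<Sum>y\<in>teich. F (weyl y ** (weyl x ** k)))"
      using k weyl_K teich_int K_mult by (simp add: intertwine_def cong: sum.cong)
    also have "\<dots> = (\<Sum>y\<in>teich. \<Sum>x\<in>teich. F (weyl y ** (weyl x ** k)))"
      by (rule sum.swap)
    also have "\<dots> = (\<Sum>y\<in>teich. (if y = 0 then of_nat q * \<eta> (- 1) * F k else 0) + h y * intertwine F k)"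
      using term0 termy by (intro sum.cong refl) (auto simp: h_def units_iff)
    also have "\<dots> = of_nat q * \<eta> (- 1) * F k + (\<Sum>y\<in>teich. h y) * intertwine F k"
      using finite_teich by (simp add: sum.distrib sum_distrib_right)
    finally show ?thesis using hsum by simp
  qed (simp add: intertwine_def ps_outside[OF F])
qed

lemma intertwine_add: "intertwine (\<lambda>x. F x + G x) = (\<lambda>x. intertwine F x + intertwine G x)"
  by (auto simp: intertwine_def fun_eq_iff sum.distrib)

lemma intertwine_scale: "intertwine (\<lambda>x. c * F x) = (\<lambda>x. c * intertwine F x)"
  by (auto simp: intertwine_def fun_eq_iff sum_distrib_left)

lemma intertwine_rt: "g \<in> K \<Longrightarrow> intertwine (rt g F) = rt g (intertwine F)"
  unfolding intertwine_def rt_def fun_eq_iff using weyl_K teich_int K_mult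
  by (simp add: matrix_mul_assoc cong: sum.cong)

lemma intertwine_bij:
  assumes \<eta>: "unit_char \<eta> 1" and \<eta>': "unit_char \<eta>' 1" and inv: "\<And>t. t \<in> units \<Longrightarrow> \<eta> t * \<eta>' t = 1"
    and nt: "\<exists>t\<in>units. \<eta> t \<noteq> 1"
  shows "bij_betw intertwine (ps \<eta> 1) (ps \<eta>' 1)"
proof -
  have nt': "\<exists>t\<in>units. \<eta>' t \<noteq> 1" using nt inv by (metis mult.right_neutral)
  have m1: "- 1 \<in> units" by simp
  define c where "c = of_nat q * \<eta> (- 1)"
  define c' where "c' = of_nat q * \<eta>' (- 1)"
  have nz: "c \<noteq> 0" "c' \<noteq> 0"
    using unit_char_nonzero[OF \<eta> m1] unit_char_nonzero[OF \<eta>' m1] q_pos by (auto simp: c_def c'_def)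
  have map: "intertwine F \<in> ps \<eta>' 1" if "F \<in> ps \<eta> 1" for F
    using intertwine_ps[OF that \<eta>] inv by (simp add: mult.commute)
  have map': "intertwine F \<in> ps \<eta> 1" if "F \<in> ps \<eta>' 1" for F
    using intertwine_ps[OF that \<eta>'] inv by simp
  have sq: "intertwine (intertwine F) = (\<lambda>k. c * F k)" if "F \<in> ps \<eta> 1" for F
    unfolding c_def by (rule intertwine_twice[OF that \<eta> nt])
  have sq': "intertwine (intertwine F) = (\<lambda>k. c' * F k)" if "F \<in> ps \<eta>' 1" for F
    unfolding c'_def by (rule intertwine_twice[OF that \<eta>' nt'])
  have "inj_on intertwine (ps \<eta> 1)"
  proof (rule inj_onI)
    fix F G assume FG: "F \<in> ps \<eta> 1" "G \<in> ps \<eta> 1" "intertwine F = intertwine G"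
    then have "(\<lambda>k. c * F k) = (\<lambda>k. c * G k)" using sq by metis
    then show "F = G" using nz by (simp add: fun_eq_iff)
  qed
  moreover have "intertwine ` ps \<eta> 1 = ps \<eta>' 1"
  proof (intro equalityI subsetI)
    fix G assume G: "G \<in> ps \<eta>' 1"
    have "intertwine (\<lambda>k. inverse c' * intertwine G k) = G"
      unfolding intertwine_scale sq'[OF G] using nz by (simp add: mult.assoc[symmetric])
    moreover have "(\<lambda>k. inverse c' * intertwine G k) \<in> ps \<eta> 1" by (intro ps_scale map' G)
    ultimately show "G \<in> intertwine ` ps \<eta> 1" by force
  qed (use map in blast)
  ultimately show ?thesis by (simp add: bij_betw_def)
qed

end

section \<open>Generalities on representations\<close>

lemma complex_cring: "cring complex_ring"
proof (rule cringI)
  show "abelian_group complex_ring"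
    by (rule abelian_groupI) (auto simp: complex_ring_def intro: exI[of _ "- _"])
  show "comm_monoid complex_ring"
    by (rule comm_monoidI) (auto simp: complex_ring_def)
qed (simp add: complex_ring_def distrib_right)

lemma complex_ring_simps:
  "carrier complex_ring = UNIV" "mult complex_ring = (*)" "one complex_ring = 1"
  "ring.zero complex_ring = 0" "ring.add complex_ring = (+)"
  by (simp_all add: complex_ring_def)

text \<open>The module laws with scalars in ordinary complex arithmetic in place of the operations
  of \<open>complex_ring\<close>.\<close>

lemma complex_module:
  assumes "Module.module complex_ring V"
  shows "\<zero>\<^bsub>V\<^esub> \<in> carrier V"
    and "u \<in> carrier V \<Longrightarrow> v \<in> carrier V \<Longrightarrow> u \<oplus>\<^bsub>V\<^esub> v \<in> carrier V"
    and "v \<in> carrier V \<Longrightarrow> c \<odot>\<^bsub>V\<^esub> v \<in> carrier V"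
    and "u \<in> carrier V \<Longrightarrow> v \<in> carrier V \<Longrightarrow> w \<in> carrier V \<Longrightarrow>
      u \<oplus>\<^bsub>V\<^esub> v \<oplus>\<^bsub>V\<^esub> w = u \<oplus>\<^bsub>V\<^esub> (v \<oplus>\<^bsub>V\<^esub> w)"
    and "u \<in> carrier V \<Longrightarrow> v \<in> carrier V \<Longrightarrow> u \<oplus>\<^bsub>V\<^esub> v = v \<oplus>\<^bsub>V\<^esub> u"
    and "v \<in> carrier V \<Longrightarrow> \<zero>\<^bsub>V\<^esub> \<oplus>\<^bsub>V\<^esub> v = v"
    and "v \<in> carrier V \<Longrightarrow> v \<oplus>\<^bsub>V\<^esub> \<zero>\<^bsub>V\<^esub> = v"
    and "v \<in> carrier V \<Longrightarrow> (- 1) \<odot>\<^bsub>V\<^esub> v = \<ominus>\<^bsub>V\<^esub> v"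
    and "v \<in> carrier V \<Longrightarrow> \<ominus>\<^bsub>V\<^esub> v \<oplus>\<^bsub>V\<^esub> v = \<zero>\<^bsub>V\<^esub>"
    and "v \<in> carrier V \<Longrightarrow> 1 \<odot>\<^bsub>V\<^esub> v = v"
    and "v \<in> carrier V \<Longrightarrow> (c + d) \<odot>\<^bsub>V\<^esub> v = c \<odot>\<^bsub>V\<^esub> v \<oplus>\<^bsub>V\<^esub> d \<odot>\<^bsub>V\<^esub> v"
    and "u \<in> carrier V \<Longrightarrow> v \<in> carrier V \<Longrightarrow> c \<odot>\<^bsub>V\<^esub> (u \<oplus>\<^bsub>V\<^esub> v) = c \<odot>\<^bsub>V\<^esub> u \<oplus>\<^bsub>V\<^esub> c \<odot>\<^bsub>V\<^esub> v"
    and "v \<in> carrier V \<Longrightarrow> (c * d) \<odot>\<^bsub>V\<^esub> v = c \<odot>\<^bsub>V\<^esub> (d \<odot>\<^bsub>V\<^esub> v)"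
    and "v \<in> carrier V \<Longrightarrow> 0 \<odot>\<^bsub>V\<^esub> v = \<zero>\<^bsub>V\<^esub>"
    and "c \<odot>\<^bsub>V\<^esub> \<zero>\<^bsub>V\<^esub> = \<zero>\<^bsub>V\<^esub>"
    and "u \<in> carrier V \<Longrightarrow> v \<in> carrier V \<Longrightarrow> w \<in> carrier V \<Longrightarrow>
      u \<oplus>\<^bsub>V\<^esub> w = v \<oplus>\<^bsub>V\<^esub> w \<Longrightarrow> u = v"
proof -
  interpret V: Module.module complex_ring V by fact
  have C: "c \<in> carrier complex_ring" for c by (simp only: complex_ring_simps UNIV_I)
  note laws = V.smult_l_distr[OF C C, unfolded complex_ring_simps] V.smult_assoc1[OF C C, unfolded complex_ring_simps]
    V.smult_one[unfolded complex_ring_simps] V.smult_l_null[unfolded complex_ring_simps]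
  have one: "\<ominus>\<^bsub>complex_ring\<^esub> 1 = - 1"
  proof -
    have "\<ominus>\<^bsub>complex_ring\<^esub> 1 \<oplus>\<^bsub>complex_ring\<^esub> 1 = \<zero>\<^bsub>complex_ring\<^esub>" by (rule V.R.l_neg[OF C])
    then show ?thesis unfolding complex_ring_simps by (simp only: eq_neg_iff_add_eq_0)
  qed
  show "\<zero>\<^bsub>V\<^esub> \<in> carrier V" by (rule V.zero_closed)
  show "u \<in> carrier V \<Longrightarrow> v \<in> carrier V \<Longrightarrow> u \<oplus>\<^bsub>V\<^esub> v \<in> carrier V" by (rule V.a_closed)
  show "v \<in> carrier V \<Longrightarrow> c \<odot>\<^bsub>V\<^esub> v \<in> carrier V" by (rule V.smult_closed[OF C])
  show "u \<in> carrier V \<Longrightarrow> v \<in> carrier V \<Longrightarrow> w \<in> carrier V \<Longrightarrow>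
      u \<oplus>\<^bsub>V\<^esub> v \<oplus>\<^bsub>V\<^esub> w = u \<oplus>\<^bsub>V\<^esub> (v \<oplus>\<^bsub>V\<^esub> w)" by (rule V.a_assoc)
  show "u \<in> carrier V \<Longrightarrow> v \<in> carrier V \<Longrightarrow> u \<oplus>\<^bsub>V\<^esub> v = v \<oplus>\<^bsub>V\<^esub> u" by (rule V.a_comm)
  show "v \<in> carrier V \<Longrightarrow> \<zero>\<^bsub>V\<^esub> \<oplus>\<^bsub>V\<^esub> v = v" by (rule V.l_zero)
  show "v \<in> carrier V \<Longrightarrow> v \<oplus>\<^bsub>V\<^esub> \<zero>\<^bsub>V\<^esub> = v" by (rule V.r_zero)
  show "v \<in> carrier V \<Longrightarrow> (- 1) \<odot>\<^bsub>V\<^esub> v = \<ominus>\<^bsub>V\<^esub> v"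
    using V.smult_l_minus[OF C, of v 1] laws(3)[of v] by (simp only: one)
  show "v \<in> carrier V \<Longrightarrow> \<ominus>\<^bsub>V\<^esub> v \<oplus>\<^bsub>V\<^esub> v = \<zero>\<^bsub>V\<^esub>" by (rule V.l_neg)
  show "v \<in> carrier V \<Longrightarrow> 1 \<odot>\<^bsub>V\<^esub> v = v" by (rule laws)
  show "v \<in> carrier V \<Longrightarrow> (c + d) \<odot>\<^bsub>V\<^esub> v = c \<odot>\<^bsub>V\<^esub> v \<oplus>\<^bsub>V\<^esub> d \<odot>\<^bsub>V\<^esub> v" by (rule laws)
  show "u \<in> carrier V \<Longrightarrow> v \<in> carrier V \<Longrightarrow> c \<odot>\<^bsub>V\<^esub> (u \<oplus>\<^bsub>V\<^esub> v) = c \<odot>\<^bsub>V\<^esub> u \<oplus>\<^bsub>V\<^esub> c \<odot>\<^bsub>V\<^esub> v"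
    by (rule V.smult_r_distr[OF C])
  show "v \<in> carrier V \<Longrightarrow> (c * d) \<odot>\<^bsub>V\<^esub> v = c \<odot>\<^bsub>V\<^esub> (d \<odot>\<^bsub>V\<^esub> v)" by (rule laws)
  show "v \<in> carrier V \<Longrightarrow> 0 \<odot>\<^bsub>V\<^esub> v = \<zero>\<^bsub>V\<^esub>" by (rule laws)
  show "c \<odot>\<^bsub>V\<^esub> \<zero>\<^bsub>V\<^esub> = \<zero>\<^bsub>V\<^esub>" by (rule V.smult_r_null[OF C])
  show "u \<in> carrier V \<Longrightarrow> v \<in> carrier V \<Longrightarrow> w \<in> carrier V \<Longrightarrow>
      u \<oplus>\<^bsub>V\<^esub> w = v \<oplus>\<^bsub>V\<^esub> w \<Longrightarrow> u = v"
    using V.add.r_cancel[of u w v] by blast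
qed

lemma complex_moduleI:
  assumes "abelian_group V"
    and "\<And>c v. v \<in> carrier V \<Longrightarrow> c \<odot>\<^bsub>V\<^esub> v \<in> carrier V"
    and "\<And>c d v. v \<in> carrier V \<Longrightarrow> (c + d) \<odot>\<^bsub>V\<^esub> v = c \<odot>\<^bsub>V\<^esub> v \<oplus>\<^bsub>V\<^esub> d \<odot>\<^bsub>V\<^esub> v"
    and "\<And>c u v. u \<in> carrier V \<Longrightarrow> v \<in> carrier V \<Longrightarrow> c \<odot>\<^bsub>V\<^esub> (u \<oplus>\<^bsub>V\<^esub> v) = c \<odot>\<^bsub>V\<^esub> u \<oplus>\<^bsub>V\<^esub> c \<odot>\<^bsub>V\<^esub> v"
    and "\<And>c d v. v \<in> carrier V \<Longrightarrow> (c * d) \<odot>\<^bsub>V\<^esub> v = c \<odot>\<^bsub>V\<^esub> (d \<odot>\<^bsub>V\<^esub> v)"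
    and "\<And>v. v \<in> carrier V \<Longrightarrow> 1 \<odot>\<^bsub>V\<^esub> v = v"
  shows "Module.module complex_ring V"
  using assms by (intro moduleI complex_cring) (simp_all add: complex_ring_simps)

section \<open>Representations, invariant subspaces and equivalences\<close>

lemma rep_module: "representation G V \<Longrightarrow> Module.module complex_ring V"
  and rep_act: "representation G V \<Longrightarrow> g \<in> carrier G \<Longrightarrow> linear_between V V (act V g)"
  by (simp_all add: representation_def)

lemma linear_closed: "linear_between V W f \<Longrightarrow> v \<in> carrier V \<Longrightarrow> f v \<in> carrier W"
  and linear_add: "linear_between V W f \<Longrightarrow> u \<in> carrier V \<Longrightarrow> v \<in> carrier V \<Longrightarrow>
    f (u \<oplus>\<^bsub>V\<^esub> v) = f u \<oplus>\<^bsub>W\<^esub> f v"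
  and linear_smult: "linear_between V W f \<Longrightarrow> v \<in> carrier V \<Longrightarrow> f (c \<odot>\<^bsub>V\<^esub> v) = c \<odot>\<^bsub>W\<^esub> f v"
  by (auto simp: linear_between_def)

lemma rep_closed:
  assumes "representation G V"
  shows "\<zero>\<^bsub>V\<^esub> \<in> carrier V"
    and "u \<in> carrier V \<Longrightarrow> v \<in> carrier V \<Longrightarrow> u \<oplus>\<^bsub>V\<^esub> v \<in> carrier V"
    and "v \<in> carrier V \<Longrightarrow> c \<odot>\<^bsub>V\<^esub> v \<in> carrier V"
    and "v \<in> carrier V \<Longrightarrow> g \<in> carrier G \<Longrightarrow> act V g v \<in> carrier V"
  using complex_module(1-3)[OF rep_module[OF assms]] linear_closed[OF rep_act[OF assms]] by blast+

lemma linear_zero: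
  assumes "Module.module complex_ring V" "Module.module complex_ring W" "linear_between V W f"
  shows "f \<zero>\<^bsub>V\<^esub> = \<zero>\<^bsub>W\<^esub>"
proof -
  note zV = complex_module(1)[OF assms(1)]
  have "f (0 \<odot>\<^bsub>V\<^esub> \<zero>\<^bsub>V\<^esub>) = 0 \<odot>\<^bsub>W\<^esub> f \<zero>\<^bsub>V\<^esub>" by (rule linear_smult[OF assms(3) zV])
  then show ?thesis
    using complex_module(14)[OF assms(1) zV] complex_module(14)[OF assms(2) linear_closed[OF assms(3) zV]] by simp
qed

text \<open>All axioms are equations and pass along a surjection that respects the operations; this
  serves both for cosets and for functions lifted to the cover.\<close>

lemma representation_image:
  assumes V: "representation G V"
    and car: "carrier W = p ` carrier V"
    and add: "\<And>u v. u \<in> carrier V \<Longrightarrow> v \<in> carrier V \<Longrightarrow> p u \<oplus>\<^bsub>W\<^esub> p v = p (u \<oplus>\<^bsub>V\<^esub> v)"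
    and zero: "\<zero>\<^bsub>W\<^esub> = p \<zero>\<^bsub>V\<^esub>"
    and smult: "\<And>c v. v \<in> carrier V \<Longrightarrow> c \<odot>\<^bsub>W\<^esub> p v = p (c \<odot>\<^bsub>V\<^esub> v)"
    and act: "\<And>g v. g \<in> carrier G \<Longrightarrow> v \<in> carrier V \<Longrightarrow> act W g (p v) = p (act V g v)"
    and one: "\<one>\<^bsub>G\<^esub> \<in> carrier G" and mult: "\<And>g h. g \<in> carrier G \<Longrightarrow> h \<in> carrier G \<Longrightarrow> g \<otimes>\<^bsub>G\<^esub> h \<in> carrier G"
  shows "representation G W"
proof -
  note M = complex_module[OF rep_module[OF V]]
  have "abelian_group W"
  proof (rule abelian_groupI)
    fix x assume "x \<in> carrier W"
    then obtain v where v: "v \<in> carrier V" "x = p v" using car by auto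
    have "(- 1) \<odot>\<^bsub>V\<^esub> v \<in> carrier V" using M(3) v by blast
    then show "\<exists>y\<in>carrier W. y \<oplus>\<^bsub>W\<^esub> x = \<zero>\<^bsub>W\<^esub>"
      using v M(8,9) by (intro bexI[of _ "p ((- 1) \<odot>\<^bsub>V\<^esub> v)"]) (simp_all add: add zero car)
  next
    fix x y assume "x \<in> carrier W" "y \<in> carrier W"
    then obtain u v where uv: "u \<in> carrier V" "x = p u" "v \<in> carrier V" "y = p v" using car by auto
    then show "x \<oplus>\<^bsub>W\<^esub> y = y \<oplus>\<^bsub>W\<^esub> x" using M(5)[of u v] by (simp add: add)
  qed (auto simp: car add zero M(1,2,4,6))
  then have "Module.module complex_ring W"
    by (rule complex_moduleI) (auto simp: car smult add M)
  moreover have "linear_between W W (act W g)" if "g \<in> carrier G" for g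
    using that rep_closed[OF V] linear_add[OF rep_act[OF V that]] linear_smult[OF rep_act[OF V that]]
    by (auto simp: linear_between_def car act add smult)
  ultimately show ?thesis
    using V rep_closed[OF V] one mult unfolding representation_def by (auto simp: car act)
qed

lemma invariant_subspaceI:
  assumes V: "representation G V" and sub: "P \<subseteq> carrier V" and zero: "\<zero>\<^bsub>V\<^esub> \<in> P"
    and add: "\<And>u v. u \<in> P \<Longrightarrow> v \<in> P \<Longrightarrow> u \<oplus>\<^bsub>V\<^esub> v \<in> P"
    and smult: "\<And>c v. v \<in> P \<Longrightarrow> c \<odot>\<^bsub>V\<^esub> v \<in> P"
    and act: "\<And>g v. g \<in> carrier G \<Longrightarrow> v \<in> P \<Longrightarrow> act V g v \<in> P"
  shows "invariant_subspace G V P"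
proof -
  interpret V: Module.module complex_ring V using V by (rule rep_module)
  have "\<ominus>\<^bsub>V\<^esub> v \<in> P" if "v \<in> P" for v
    using that sub smult[of v "- 1"] complex_module(8)[OF rep_module[OF V]] by (metis subsetD)
  then have "submodule P complex_ring V"
    using sub zero add smult by (intro V.submoduleI) blast+
  then show ?thesis using act by (simp add: invariant_subspace_def)
qed

lemma invariant_subspaceD:
  assumes "invariant_subspace G V P"
  shows "P \<subseteq> carrier V" "\<zero>\<^bsub>V\<^esub> \<in> P" "u \<in> P \<Longrightarrow> v \<in> P \<Longrightarrow> u \<oplus>\<^bsub>V\<^esub> v \<in> P"
    "v \<in> P \<Longrightarrow> c \<odot>\<^bsub>V\<^esub> v \<in> P" "g \<in> carrier G \<Longrightarrow> v \<in> P \<Longrightarrow> act V g v \<in> P"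
proof -
  interpret submodule P complex_ring V using assms by (simp add: invariant_subspace_def)
  show "P \<subseteq> carrier V" "\<zero>\<^bsub>V\<^esub> \<in> P" "u \<in> P \<Longrightarrow> v \<in> P \<Longrightarrow> u \<oplus>\<^bsub>V\<^esub> v \<in> P" "v \<in> P \<Longrightarrow> c \<odot>\<^bsub>V\<^esub> v \<in> P"
    using subset one_closed m_closed smult_closed by (auto simp: complex_ring_simps)
  show "g \<in> carrier G \<Longrightarrow> v \<in> P \<Longrightarrow> act V g v \<in> P"
    using assms by (simp add: invariant_subspace_def)
qed

lemma sub_rep_simps [simp]:
  "carrier (sub_rep V P) = P" "ring.zero (sub_rep V P) = ring.zero V" "ring.add (sub_rep V P) = ring.add V"
  "smult (sub_rep V P) = smult V" "act (sub_rep V P) = act V"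
  by (simp_all add: sub_rep_def)

lemma sub_representation:
  assumes V: "representation G V" and P: "invariant_subspace G V P"
  shows "representation G (sub_rep V P)"
proof -
  note M = complex_module[OF rep_module[OF V]]
  note D = invariant_subspaceD[OF P]
  have car: "v \<in> carrier V" if "v \<in> P" for v using that D by blast
  have "abelian_group (sub_rep V P)"
  proof (rule abelian_groupI)
    fix x assume "x \<in> carrier (sub_rep V P)"
    then show "\<exists>y\<in>carrier (sub_rep V P). y \<oplus>\<^bsub>sub_rep V P\<^esub> x = \<zero>\<^bsub>sub_rep V P\<^esub>"
      using D(4)[of x "- 1"] car[of x] M(8,9) by (intro bexI[of _ "(- 1) \<odot>\<^bsub>V\<^esub> x"]) auto
  next
    fix x y assume "x \<in> carrier (sub_rep V P)" "y \<in> carrier (sub_rep V P)"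
    then show "x \<oplus>\<^bsub>sub_rep V P\<^esub> y = y \<oplus>\<^bsub>sub_rep V P\<^esub> x" using M(5) car by simp
  qed (auto simp: D(2,3) car M(4,6))
  then have "Module.module complex_ring (sub_rep V P)"
    by (rule complex_moduleI) (auto simp: D(4) car M(10-13))
  moreover have "linear_between (sub_rep V P) (sub_rep V P) (act V g)" if "g \<in> carrier G" for g
    using that D car linear_add[OF rep_act[OF V that]] linear_smult[OF rep_act[OF V that]]
    by (auto simp: linear_between_def)
  ultimately show ?thesis
    using V car unfolding representation_def by auto
qed

lemma rep_equiv_sym:
  assumes V: "representation G V" and e: "rep_equiv G V W"
  shows "rep_equiv G W V"
proof -
  obtain f where f: "bij_betw f (carrier V) (carrier W)" "linear_between V W f"
    "\<And>g v. g \<in> carrier G \<Longrightarrow> v \<in> carrier V \<Longrightarrow> f (act V g v) = act W g (f v)"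
    using e by (auto simp: rep_equiv_def)
  define h where "h = inv_into (carrier V) f"
  have h: "h w \<in> carrier V" "f (h w) = w" if "w \<in> carrier W" for w
    using that f(1) by (auto simp: h_def bij_betw_def inv_into_into f_inv_into_f)
  have hf: "h (f v) = v" if "v \<in> carrier V" for v
    using that f(1) by (simp add: h_def bij_betw_def)
  note cl = rep_closed[OF V]
  show ?thesis
    unfolding rep_equiv_def
  proof (intro exI[of _ h] conjI ballI)
    show "bij_betw h (carrier W) (carrier V)"
      unfolding h_def using f(1) by (rule bij_betw_inv_into)
    show "linear_between W V h"
      unfolding linear_between_def
    proof (intro conjI ballI allI)
      fix u v assume uv: "u \<in> carrier W" "v \<in> carrier W"
      have "h (f (h u \<oplus>\<^bsub>V\<^esub> h v)) = h u \<oplus>\<^bsub>V\<^esub> h v" using h uv cl by (intro hf) auto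
      then show "h (u \<oplus>\<^bsub>W\<^esub> v) = h u \<oplus>\<^bsub>V\<^esub> h v"
        using linear_add[OF f(2)] h uv by simp
    next
      fix c v assume v: "v \<in> carrier W"
      have "h (f (c \<odot>\<^bsub>V\<^esub> h v)) = c \<odot>\<^bsub>V\<^esub> h v" using h v cl by (intro hf) auto
      then show "h (c \<odot>\<^bsub>W\<^esub> v) = c \<odot>\<^bsub>V\<^esub> h v"
        using linear_smult[OF f(2)] h v by simp
    qed (use h in auto)
    fix g w assume g: "g \<in> carrier G" "w \<in> carrier W"
    have "h (f (act V g (h w))) = act V g (h w)" using h g cl by (intro hf) auto
    then show "h (act W g w) = act V g (h w)" using f(3) h g by simp
  qed
qed

lemma rep_equiv_trans:
  assumes "rep_equiv G U V" "rep_equiv G V W"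
  shows "rep_equiv G U W"
proof -
  obtain f where f: "bij_betw f (carrier U) (carrier V)" "linear_between U V f"
    "\<And>g v. g \<in> carrier G \<Longrightarrow> v \<in> carrier U \<Longrightarrow> f (act U g v) = act V g (f v)"
    using assms(1) by (auto simp: rep_equiv_def)
  obtain h where h: "bij_betw h (carrier V) (carrier W)" "linear_between V W h"
    "\<And>g v. g \<in> carrier G \<Longrightarrow> v \<in> carrier V \<Longrightarrow> h (act V g v) = act W g (h v)"
    using assms(2) by (auto simp: rep_equiv_def)
  have fc: "f v \<in> carrier V" if "v \<in> carrier U" for v using linear_closed[OF f(2) that] .
  show ?thesis
    unfolding rep_equiv_def
    using bij_betw_trans[OF f(1) h(1)] f(3) h(3) fc linear_closed[OF h(2)]
      linear_add[OF f(2)] linear_add[OF h(2)] linear_smult[OF f(2)] linear_smult[OF h(2)]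
    by (intro exI[of _ "h \<circ> f"]) (auto simp: linear_between_def)
qed

lemma irreducible_rep_equiv:
  assumes V: "representation G V" and e: "rep_equiv G V W" and W: "irreducible_rep G W"
  shows "irreducible_rep G V"
proof -
  obtain f where f: "bij_betw f (carrier V) (carrier W)" "linear_between V W f"
    "\<And>g v. g \<in> carrier G \<Longrightarrow> v \<in> carrier V \<Longrightarrow> f (act V g v) = act W g (f v)"
    using e by (auto simp: rep_equiv_def)
  have Wr: "representation G W" "carrier W \<noteq> {\<zero>\<^bsub>W\<^esub>}"
    "\<And>U. invariant_subspace G W U \<Longrightarrow> U = {\<zero>\<^bsub>W\<^esub>} \<or> U = carrier W"
    using W by (auto simp: irreducible_rep_def)
  have f0: "f \<zero>\<^bsub>V\<^esub> = \<zero>\<^bsub>W\<^esub>" by (rule linear_zero[OF rep_module[OF V] rep_module[OF Wr(1)] f(2)])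
  have inj: "inj_on f (carrier V)" and im: "f ` carrier V = carrier W"
    using f(1) by (auto simp: bij_betw_def)
  note z = rep_closed(1)[OF V]
  show ?thesis
    unfolding irreducible_rep_def
  proof (intro conjI allI impI V)
    show "carrier V \<noteq> {\<zero>\<^bsub>V\<^esub>}" using Wr(2) im f0 by auto
    fix U assume U: "invariant_subspace G V U"
    note D = invariant_subspaceD[OF U]
    have Uc: "v \<in> carrier V" if "v \<in> U" for v using that D by blast
    have "invariant_subspace G W (f ` U)"
    proof (rule invariant_subspaceI[OF Wr(1)])
      show "f ` U \<subseteq> carrier W" using Uc linear_closed[OF f(2)] by blast
      show "\<zero>\<^bsub>W\<^esub> \<in> f ` U" using D(2) f0 by force
      fix w w' assume "w \<in> f ` U" "w' \<in> f ` U"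
      then obtain u u' where u: "u \<in> U" "w = f u" "u' \<in> U" "w' = f u'" by blast
      then show "w \<oplus>\<^bsub>W\<^esub> w' \<in> f ` U"
        unfolding u(2,4) linear_add[OF f(2) Uc[OF u(1)] Uc[OF u(3)], symmetric] using D(3)[OF u(1,3)] by blast
      show "c \<odot>\<^bsub>W\<^esub> w \<in> f ` U" for c
        unfolding u(2) linear_smult[OF f(2) Uc[OF u(1)], symmetric] using D(4)[OF u(1)] by blast
      show "act W g w \<in> f ` U" if "g \<in> carrier G" for g
        unfolding u(2) f(3)[OF that Uc[OF u(1)], symmetric] using D(5)[OF that u(1)] by blast
    qed
    then have "f ` U = f ` {\<zero>\<^bsub>V\<^esub>} \<or> f ` U = f ` carrier V" using Wr(3) f0 im by auto
    then show "U = {\<zero>\<^bsub>V\<^esub>} \<or> U = carrier V"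
      using inj_on_image_eq_iff[OF inj D(1), of "{\<zero>\<^bsub>V\<^esub>}"] inj_on_image_eq_iff[OF inj D(1), of "carrier V"] z
      by simp
  qed
qed

text \<open>The pair (\<pi>, \<pi>') is onto A x B with kernel U, hence identifies the quotient with
  the direct sum; the summands are the images of the kernels of \<pi>' and of \<pi>. This avoids
  choosing a complement of U.\<close>

lemma quotient_direct_sum:
  fixes G :: "('g, 'h) monoid_scheme" and V :: "('g, 'v) rep"
  assumes V: "representation G V" and A: "representation G A" and B: "representation G B"
    and \<pi>: "linear_between V A \<pi>" "linear_between V B \<pi>'"
    and eq: "\<And>g v. g \<in> carrier G \<Longrightarrow> v \<in> carrier V \<Longrightarrow> \<pi> (act V g v) = act A g (\<pi> v)"
      "\<And>g v. g \<in> carrier G \<Longrightarrow> v \<in> carrier V \<Longrightarrow> \<pi>' (act V g v) = act B g (\<pi>' v)"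
    and onto: "\<And>a b. a \<in> carrier A \<Longrightarrow> b \<in> carrier B \<Longrightarrow> \<exists>v\<in>carrier V. \<pi> v = a \<and> \<pi>' v = b"
    and U: "U = {v \<in> carrier V. \<pi> v = \<zero>\<^bsub>A\<^esub> \<and> \<pi>' v = \<zero>\<^bsub>B\<^esub>}"
    and one: "\<one>\<^bsub>G\<^esub> \<in> carrier G" and mult: "\<And>g h. g \<in> carrier G \<Longrightarrow> h \<in> carrier G \<Longrightarrow> g \<otimes>\<^bsub>G\<^esub> h \<in> carrier G"
  shows "\<exists>P Q. internal_direct_sum G (quot_rep V U) P Q \<and>
      representation G (sub_rep (quot_rep V U) P) \<and> rep_equiv G (sub_rep (quot_rep V U) P) A \<and>
      representation G (sub_rep (quot_rep V U) Q) \<and> rep_equiv G (sub_rep (quot_rep V U) Q) B"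
proof -
  note MV = complex_module[OF rep_module[OF V]]
  note MA = complex_module[OF rep_module[OF A]]
  note MB = complex_module[OF rep_module[OF B]]
  note cl = rep_closed[OF V]
  note cA = linear_closed[OF \<pi>(1)] and cB = linear_closed[OF \<pi>(2)]
  define W where "W = quot_rep V U"
  \<comment> \<open>Cosets of U described as fibres of (\<pi>, \<pi>'); from here on operations on
    cosets are computed on values of the two maps.\<close>
  define E where "E v = {x \<in> carrier V. \<pi> x = \<pi> v \<and> \<pi>' x = \<pi>' v}" for v
  have \<pi>0: "\<pi> \<zero>\<^bsub>V\<^esub> = \<zero>\<^bsub>A\<^esub>" "\<pi>' \<zero>\<^bsub>V\<^esub> = \<zero>\<^bsub>B\<^esub>"
    using linear_zero[OF rep_module[OF V]] rep_module A B \<pi> by blast+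
  define sb where "sb x v = x \<oplus>\<^bsub>V\<^esub> (- 1) \<odot>\<^bsub>V\<^esub> v" for x v
  have sub: "sb x v \<in> carrier V" "sb x v \<oplus>\<^bsub>V\<^esub> v = x" if "x \<in> carrier V" "v \<in> carrier V" for x v
  proof -
    have "(- 1) \<odot>\<^bsub>V\<^esub> v \<in> carrier V" using MV(3) that by blast
    then show "sb x v \<in> carrier V" "sb x v \<oplus>\<^bsub>V\<^esub> v = x"
      using that MV(2,4,7,8,9) by (simp_all add: sb_def)
  qed
  have \<pi>sub: "\<pi> (sb x v) = a" if "x \<in> carrier V" "v \<in> carrier V" "a \<in> carrier A" "\<pi> x = a \<oplus>\<^bsub>A\<^esub> \<pi> v" for x v a
    using linear_add[OF \<pi>(1) sub(1)[OF that(1,2)] that(2)] sub(2)[OF that(1,2)] that(4)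
    by (intro MA(16)[OF cA[OF sub(1)[OF that(1,2)]] that(3) cA[OF that(2)]]) simp
  have \<pi>'sub: "\<pi>' (sb x v) = b" if "x \<in> carrier V" "v \<in> carrier V" "b \<in> carrier B" "\<pi>' x = b \<oplus>\<^bsub>B\<^esub> \<pi>' v" for x v b
    using linear_add[OF \<pi>(2) sub(1)[OF that(1,2)] that(2)] sub(2)[OF that(1,2)] that(4)
    by (intro MB(16)[OF cB[OF sub(1)[OF that(1,2)]] that(3) cB[OF that(2)]]) simp
  have coset: "U +>\<^bsub>V\<^esub> v = E v" if v: "v \<in> carrier V" for v
  proof (intro equalityI subsetI)
    fix x assume "x \<in> U +>\<^bsub>V\<^esub> v"
    then obtain u where "u \<in> U" "x = u \<oplus>\<^bsub>V\<^esub> v" by (auto simp: a_r_coset_def')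
    then show "x \<in> E v"
      using v linear_add[OF \<pi>(1)] linear_add[OF \<pi>(2)] cA cB MV(2) MA(6) MB(6) by (auto simp: E_def U)
  next
    fix x assume x: "x \<in> E v"
    then have "sb x v \<in> U"
      using \<pi>sub[of x v "\<zero>\<^bsub>A\<^esub>"] \<pi>'sub[of x v "\<zero>\<^bsub>B\<^esub>"] v cA cB sub(1) MA(1,6) MB(1,6) by (auto simp: E_def U)
    then show "x \<in> U +>\<^bsub>V\<^esub> v"
      using sub(2)[of x v] x v by (auto simp: a_r_coset_def' E_def intro!: bexI[of _ "sb x v"])
  qed
  have Eeq: "E v = E w \<longleftrightarrow> \<pi> v = \<pi> w \<and> \<pi>' v = \<pi>' w" if "v \<in> carrier V" for v w
    using that by (auto simp: E_def)
  have self: "v \<in> E v" if "v \<in> carrier V" for v using that by (simp add: E_def)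
  have car: "carrier W = E ` carrier V"
    using coset by (auto simp: W_def quot_rep_def A_RCOSETS_def' a_r_coset_def')
  have add: "E v \<oplus>\<^bsub>W\<^esub> E w = E (v \<oplus>\<^bsub>V\<^esub> w)" if v: "v \<in> carrier V" and w: "w \<in> carrier V" for v w
  proof -
    have "E v \<oplus>\<^bsub>W\<^esub> E w = {x \<oplus>\<^bsub>V\<^esub> y | x y. x \<in> E v \<and> y \<in> E w}"
      by (auto simp: W_def quot_rep_def set_add_def' )
    also have "\<dots> = E (v \<oplus>\<^bsub>V\<^esub> w)"
    proof (intro equalityI subsetI)
      fix x assume "x \<in> {x \<oplus>\<^bsub>V\<^esub> y | x y. x \<in> E v \<and> y \<in> E w}"
      then show "x \<in> E (v \<oplus>\<^bsub>V\<^esub> w)"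
        using v w linear_add[OF \<pi>(1)] linear_add[OF \<pi>(2)] MV(2) by (auto simp: E_def)
    next
      fix x assume x: "x \<in> E (v \<oplus>\<^bsub>V\<^esub> w)"
      then have xc: "x \<in> carrier V" by (simp add: E_def)
      have "sb x w \<in> E v"
        using x xc v w \<pi>sub[of x w "\<pi> v"] \<pi>'sub[of x w "\<pi>' v"] linear_add[OF \<pi>(1)] linear_add[OF \<pi>(2)] cA cB sub(1)
        by (auto simp: E_def)
      then show "x \<in> {x \<oplus>\<^bsub>V\<^esub> y | x y. x \<in> E v \<and> y \<in> E w}"
        using sub(2)[OF xc w] self[OF w] by force
    qed
    finally show ?thesis .
  qed
  have zero: "\<zero>\<^bsub>W\<^esub> = E \<zero>\<^bsub>V\<^esub>"
    by (auto simp: W_def quot_rep_def E_def U \<pi>0)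
  have smult: "c \<odot>\<^bsub>W\<^esub> E v = E (c \<odot>\<^bsub>V\<^esub> v)" if v: "v \<in> carrier V" for c v
  proof -
    have "U +>\<^bsub>V\<^esub> (c \<odot>\<^bsub>V\<^esub> x) = E (c \<odot>\<^bsub>V\<^esub> v)" if "x \<in> E v" for x
      using that v cl(3) linear_smult[OF \<pi>(1)] linear_smult[OF \<pi>(2)] by (subst coset) (auto simp: E_def)
    then show ?thesis using self[OF v] by (auto simp: W_def quot_rep_def)
  qed
  have act: "act W g (E v) = E (act V g v)" if g: "g \<in> carrier G" and v: "v \<in> carrier V" for g v
  proof -
    have "U +>\<^bsub>V\<^esub> (act V g x) = E (act V g v)" if "x \<in> E v" for x
      using that v g cl(4) eq by (subst coset) (auto simp: E_def)
    then show ?thesis using self[OF v] by (auto simp: W_def quot_rep_def)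
  qed
  have W: "representation G W"
    by (rule representation_image[OF V car add zero smult act one mult])
  define P where "P = E ` {v \<in> carrier V. \<pi>' v = \<zero>\<^bsub>B\<^esub>}"
  define Q where "Q = E ` {v \<in> carrier V. \<pi> v = \<zero>\<^bsub>A\<^esub>}"
  have act0: "act A g \<zero>\<^bsub>A\<^esub> = \<zero>\<^bsub>A\<^esub>" "act B g \<zero>\<^bsub>B\<^esub> = \<zero>\<^bsub>B\<^esub>" if "g \<in> carrier G" for g
    using linear_zero[OF _ _ rep_act[OF _ that]] rep_module A B by blast+
  have P: "invariant_subspace G W P"
  proof (rule invariant_subspaceI[OF W])
    show "P \<subseteq> carrier W" by (auto simp: P_def car)
    show "\<zero>\<^bsub>W\<^esub> \<in> P" using cl(1) \<pi>0 by (auto simp: P_def zero)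
    show "u \<oplus>\<^bsub>W\<^esub> v \<in> P" if "u \<in> P" "v \<in> P" for u v
      using that cl(2) linear_add[OF \<pi>(2)] MB(1,6) by (fastforce simp: P_def add)
    show "c \<odot>\<^bsub>W\<^esub> v \<in> P" if "v \<in> P" for c v
      using that cl(3) linear_smult[OF \<pi>(2)] MB(15) by (auto simp: P_def smult)
    show "act W g v \<in> P" if "g \<in> carrier G" "v \<in> P" for g v
      using that cl(4) eq act0 by (auto simp: P_def act)
  qed
  have Q: "invariant_subspace G W Q"
  proof (rule invariant_subspaceI[OF W])
    show "Q \<subseteq> carrier W" by (auto simp: Q_def car)
    show "\<zero>\<^bsub>W\<^esub> \<in> Q" using cl(1) \<pi>0 by (auto simp: Q_def zero)
    show "u \<oplus>\<^bsub>W\<^esub> v \<in> Q" if "u \<in> Q" "v \<in> Q" for u v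
      using that cl(2) linear_add[OF \<pi>(1)] MA(1,6) by (fastforce simp: Q_def add)
    show "c \<odot>\<^bsub>W\<^esub> v \<in> Q" if "v \<in> Q" for c v
      using that cl(3) linear_smult[OF \<pi>(1)] MA(15) by (auto simp: Q_def smult)
    show "act W g v \<in> Q" if "g \<in> carrier G" "v \<in> Q" for g v
      using that cl(4) eq act0 by (auto simp: Q_def act)
  qed
  have "P <+>\<^bsub>W\<^esub> Q = carrier W"
  proof (intro equalityI subsetI)
    fix S assume "S \<in> P <+>\<^bsub>W\<^esub> Q"
    then show "S \<in> carrier W"
      using cl(2) by (auto simp: set_add_def' P_def Q_def add car)
  next
    fix S assume "S \<in> carrier W"
    then obtain v where v: "v \<in> carrier V" "S = E v" by (auto simp: car)
    obtain a where a: "a \<in> carrier V" "\<pi> a = \<pi> v" "\<pi>' a = \<zero>\<^bsub>B\<^esub>" using onto[OF cA[OF v(1)] MB(1)] by blast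
    obtain b where b: "b \<in> carrier V" "\<pi> b = \<zero>\<^bsub>A\<^esub>" "\<pi>' b = \<pi>' v" using onto[OF MA(1) cB[OF v(1)]] by blast
    have "S = E a \<oplus>\<^bsub>W\<^esub> E b"
      using v a b add linear_add[OF \<pi>(1) a(1) b(1)] linear_add[OF \<pi>(2) a(1) b(1)] cA cB MA(7) MB(6)
      by (simp add: Eeq)
    then show "S \<in> P <+>\<^bsub>W\<^esub> Q" using a b unfolding set_add_def' P_def Q_def by blast
  qed
  moreover have "P \<inter> Q = {\<zero>\<^bsub>W\<^esub>}"
    using P Q invariant_subspaceD(2) Eeq \<pi>0 cl(1) by (fastforce simp: P_def Q_def zero)
  ultimately have ids: "internal_direct_sum G W P Q"
    using P Q by (simp add: internal_direct_sum_def)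
  have eA: "rep_equiv G (sub_rep W P) A"
  proof -
    \<comment> \<open>\<pi> is constant on a coset, so its image there is a singleton.\<close>
    define f where "f S = the_elem (\<pi> ` S)" for S
    have f: "f (E v) = \<pi> v" if "v \<in> carrier V" for v
    proof -
      have "\<pi> ` E v = {\<pi> v}" using that by (auto simp: E_def)
      then show ?thesis by (simp add: f_def)
    qed
    show ?thesis
      unfolding rep_equiv_def
    proof (intro exI[of _ f] conjI ballI)
      show "bij_betw f (carrier (sub_rep W P)) (carrier A)"
        unfolding bij_betw_def
      proof
        show "inj_on f (carrier (sub_rep W P))"
          by (rule inj_onI) (clarsimp simp: P_def f Eeq)
        show "f ` carrier (sub_rep W P) = carrier A"
        proof (intro equalityI subsetI)
          fix a assume "a \<in> carrier A"
          then obtain v where "v \<in> carrier V" "\<pi> v = a" "\<pi>' v = \<zero>\<^bsub>B\<^esub>" using onto[OF _ MB(1)] by blast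
          then show "a \<in> f ` carrier (sub_rep W P)" using f by (force simp: P_def)
        qed (auto simp: P_def f cA)
      qed
      show "linear_between (sub_rep W P) A f"
        unfolding linear_between_def
        using cl cA linear_add[OF \<pi>(1)] linear_smult[OF \<pi>(1)] by (auto simp: P_def f add smult)
      show "f (act (sub_rep W P) g S) = act A g (f S)" if "g \<in> carrier G" "S \<in> carrier (sub_rep W P)" for g S
        using that cl(4) eq by (auto simp: P_def f act)
    qed
  qed
  have eB: "rep_equiv G (sub_rep W Q) B"
  proof -
    define f where "f S = the_elem (\<pi>' ` S)" for S
    have f: "f (E v) = \<pi>' v" if "v \<in> carrier V" for v
    proof -
      have "\<pi>' ` E v = {\<pi>' v}" using that by (auto simp: E_def)
      then show ?thesis by (simp add: f_def)
    qed
    show ?thesis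
      unfolding rep_equiv_def
    proof (intro exI[of _ f] conjI ballI)
      show "bij_betw f (carrier (sub_rep W Q)) (carrier B)"
        unfolding bij_betw_def
      proof
        show "inj_on f (carrier (sub_rep W Q))"
          by (rule inj_onI) (clarsimp simp: Q_def f Eeq)
        show "f ` carrier (sub_rep W Q) = carrier B"
        proof (intro equalityI subsetI)
          fix a assume "a \<in> carrier B"
          then obtain v where "v \<in> carrier V" "\<pi>' v = a" "\<pi> v = \<zero>\<^bsub>A\<^esub>" using onto[OF MA(1)] by blast
          then show "a \<in> f ` carrier (sub_rep W Q)" using f by (force simp: Q_def)
        qed (auto simp: Q_def f cB)
      qed
      show "linear_between (sub_rep W Q) B f"
        unfolding linear_between_def
        using cl cB linear_add[OF \<pi>(2)] linear_smult[OF \<pi>(2)] by (auto simp: Q_def f add smult)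
      show "f (act (sub_rep W Q) g S) = act B g (f S)" if "g \<in> carrier G" "S \<in> carrier (sub_rep W Q)" for g S
        using that cl(4) eq by (auto simp: Q_def f act)
    qed
  qed
  show ?thesis
    using ids eA eB sub_representation[OF W P] sub_representation[OF W Q] unfolding W_def by blast
qed

section \<open>Representations on spaces of complex functions\<close>

definition fun_rep :: "('x \<Rightarrow> complex) set \<Rightarrow> ('g \<Rightarrow> ('x \<Rightarrow> complex) \<Rightarrow> 'x \<Rightarrow> complex) \<Rightarrow> ('g, 'x \<Rightarrow> complex) rep" where
  "fun_rep C T = \<lparr>carrier = C, mult = undefined, one = undefined,
      ring.zero = (\<lambda>_. 0), ring.add = (\<lambda>f g x. f x + g x),
      smult = (\<lambda>c f x. c * f x), act = T\<rparr>"

lemma fun_rep_simps [simp]: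
  "carrier (fun_rep C T) = C" "ring.zero (fun_rep C T) = (\<lambda>_. 0)" "ring.add (fun_rep C T) = (\<lambda>f g x. f x + g x)"
  "smult (fun_rep C T) = (\<lambda>c f x. c * f x)" "act (fun_rep C T) = T"
  by (simp_all add: fun_rep_def)

lemma fun_rep_representation:
  assumes zero: "(\<lambda>_. 0) \<in> C" and add: "\<And>f g. f \<in> C \<Longrightarrow> g \<in> C \<Longrightarrow> (\<lambda>x. f x + g x) \<in> C"
    and scale: "\<And>c f. f \<in> C \<Longrightarrow> (\<lambda>x. c * f x) \<in> C"
    and T: "\<And>g f. g \<in> carrier G \<Longrightarrow> f \<in> C \<Longrightarrow> T g f \<in> C"
    and T_add: "\<And>g f f'. T g (\<lambda>x. f x + f' x) = (\<lambda>x. T g f x + T g f' x)"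
    and T_scale: "\<And>g c f. T g (\<lambda>x. c * f x) = (\<lambda>x. c * T g f x)"
    and T_one: "\<And>f. f \<in> C \<Longrightarrow> T \<one>\<^bsub>G\<^esub> f = f"
    and T_mult: "\<And>g h f. g \<in> carrier G \<Longrightarrow> h \<in> carrier G \<Longrightarrow> f \<in> C \<Longrightarrow> T (g \<otimes>\<^bsub>G\<^esub> h) f = T g (T h f)"
  shows "representation G (fun_rep C T)"
proof -
  have "abelian_group (fun_rep C T)"
  proof (rule abelian_groupI)
    fix f assume "f \<in> carrier (fun_rep C T)"
    then show "\<exists>g\<in>carrier (fun_rep C T). g \<oplus>\<^bsub>fun_rep C T\<^esub> f = \<zero>\<^bsub>fun_rep C T\<^esub>"
      using scale[of f "- 1"] by (intro bexI[of _ "\<lambda>x. - 1 * f x"]) auto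
  qed (auto simp: zero add add_ac)
  then have "Module.module complex_ring (fun_rep C T)"
    by (rule complex_moduleI) (auto simp: scale algebra_simps)
  moreover have "linear_between (fun_rep C T) (fun_rep C T) (T g)" if "g \<in> carrier G" for g
    using that by (auto simp: linear_between_def T T_add T_scale)
  ultimately show ?thesis
    by (simp add: representation_def T_one T_mult)
qed

section \<open>The characters of the torus\<close>

context tame_field
begin

section \<open>The splitting over the maximal compact subgroup\<close>

definition spl :: "'a mat2 \<Rightarrow> 'a" where
  "spl g = split_factor (g $ 2 $ 1) (g $ 2 $ 2)"

lemma kubota_spl:
  assumes "g \<in> K" "h \<in> K"
  shows "kubota val n g h * spl g * spl h = spl (g ** h)"
proof -
  obtain a b c d where g: "g = mk a b c d" "a * d - b * c = 1"
    "a \<in> pid 0" "b \<in> pid 0" "c \<in> pid 0" "d \<in> pid 0" by (rule K_cases[OF assms(1)])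
  obtain a' b' c' d' where h: "h = mk a' b' c' d'" "a' * d' - b' * c' = 1"
    "a' \<in> pid 0" "b' \<in> pid 0" "c' \<in> pid 0" "d' \<in> pid 0" by (rule K_cases[OF assms(2)])
  show ?thesis
    using kubota_split_scalar[OF g(3-6) h(3-6) g(2) h(2)]
    by (simp only: kubota_def kubota_X_def spl_def g(1) h(1) mk_mult mk_nth)
qed

lemma spl_root:
  assumes "g \<in> K"
  shows "spl g \<in> roots_of_unity n"
proof -
  obtain a b c d where g: "g = mk a b c d" "a * d - b * c = 1"
    "a \<in> pid 0" "b \<in> pid 0" "c \<in> pid 0" "d \<in> pid 0" by (rule K_cases[OF assms])
  have "d \<in> units" if "c \<noteq> 0" "val c > 0"
    using K_lower_right_unit[of a b c d 1] assms that by (simp add: g pid_iff)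
  then show ?thesis by (auto simp: spl_def g split_factor_def intro!: root_powi tame_root)
qed

lemma spl_nonzero: "g \<in> K \<Longrightarrow> spl g \<noteq> 0"
  using spl_root root_nonzero by blast

text \<open>The splitting agrees with h |-> (h, 1) on the congruence subgroups, so vectors fixed
  under \<open>emb\<close> become functions of that level.\<close>

lemma spl_congr:
  assumes "g \<in> congr_subgroup val l" "1 \<le> l"
  shows "spl g = 1"
proof -
  obtain a b c d where g: "g = mk a b c d" by (rule mk_cases)
  have "cg l d 1" using assms(1) by (auto simp: congr_subgroup_iff g mcg_def mat_1_mk)
  then have d: "cg 1 d 1" using assms(2) by (rule cg_mono)
  have "tame d = 1" using tame_cong[OF d] cg_units[OF d] by simp
  then show ?thesis by (simp add: spl_def g split_factor_def)
qed

lemma spl_borel: "g \<in> borel \<Longrightarrow> spl g = 1"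
  by (simp add: borel_def spl_def split_factor_def)

lemma kubota_root: "g \<in> K \<Longrightarrow> h \<in> K \<Longrightarrow> kubota val n g h \<in> roots_of_unity n"
proof -
  assume gh: "g \<in> K" "h \<in> K"
  have "kubota val n g h = spl (g ** h) / (spl g * spl h)"
    using kubota_spl[OF gh] spl_nonzero gh by (simp add: field_simps)
  then show ?thesis using gh spl_root K_mult by (simp add: root_divide root_mult)
qed

lemma K_cover_simps:
  "carrier (K_cover val n) = K \<times> roots_of_unity n" "\<one>\<^bsub>K_cover val n\<^esub> = (mat 1, 1)"
  "(g, z) \<otimes>\<^bsub>K_cover val n\<^esub> (h, w) = (g ** h, kubota val n g h * z * w)"
  by (simp_all add: K_cover_def cover_sub_def cover_def preim_def)

lemma K_cover_one: "\<one>\<^bsub>K_cover val n\<^esub> \<in> carrier (K_cover val n)"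
  by (simp add: K_cover_simps)

lemma K_cover_mult:
  "x \<in> carrier (K_cover val n) \<Longrightarrow> y \<in> carrier (K_cover val n) \<Longrightarrow> x \<otimes>\<^bsub>K_cover val n\<^esub> y \<in> carrier (K_cover val n)"
  by (cases x; cases y) (auto simp: K_cover_simps K_mult root_mult kubota_root)

section \<open>The cocycle on the torus\<close>

lemma kubota_torus_unit:
  assumes "s \<noteq> 0" "t \<in> units"
  shows "kubota val n (dg s) (dg t) = tame t powi val s" "kubota val n (dg t) (dg s) = tame t powi (- val s)"
proof -
  have t0: "t \<noteq> 0" using assms units_nonzero by blast
  have 1: "kubota val n (dg s) (dg t) = hilbert val n (inverse t) (inverse s)"
    "kubota val n (dg t) (dg s) = hilbert val n (inverse s) (inverse t)"
    using assms t0 by (simp_all add: kubota_def kubota_X_def dg_mk)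
  show "kubota val n (dg t) (dg s) = tame t powi (- val s)"
    unfolding 1 using assms t0 hilbert_unit_right[of "inverse s" "inverse t"]
    by (simp add: units_inverse tame_inverse val_inverse power_int_inverse power_int_minus)
  show "kubota val n (dg s) (dg t) = tame t powi val s"
    unfolding 1 using assms t0 hilbert_unit_left[of "inverse t" "inverse s"]
    by (simp add: units_inverse tame_inverse val_inverse power_int_inverse power_int_minus)
qed

lemma dg_mult: "dg s ** dg t = dg (s * t)"
  by (simp add: dg_mk mult.commute)

lemma dg_one: "dg 1 = mat 1"
  by (simp add: dg_mk mat_1_mk)

text \<open>The tame character is trivial on 1 + p, so these elements commute with the whole torus.
  Primitivity, a statement about the centre, can therefore be read on 1 + p^m.\<close>

lemma torus_center_principal:
  assumes t: "cg 1 t 1"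
  shows "(dg t, 1) \<in> torus_center val n"
proof -
  have tu: "t \<in> units" using cg_units[OF t] by simp
  have tt: "tame t = 1" using tame_cong[OF t tu] by simp
  have "kubota val n (dg t) (dg s) = 1" "kubota val n (dg s) (dg t) = 1" if "s \<noteq> 0" for s
    using kubota_torus_unit[OF that tu] tt by simp_all
  then show ?thesis
    using units_nonzero[OF tu]
    by (auto simp: torus_center_def group_center_def cover_sub_def cover_def preim_def torus_def dg_mult mult.commute)
qed

end

locale cover_setting = odd_local_field + tame_field +
  fixes \<epsilon> :: "'a \<Rightarrow> complex" and chi chi0 :: "'a cov \<Rightarrow> complex" and m :: nat
  assumes n2: "2 \<le> n"
    and eps: "faithful_character n \<epsilon>"
    and primitive: "primitive_mod val n chi m"
    and chi0: "genuine_character val n \<epsilon> (torus_maxab val n) chi0"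
      "\<forall>z \<in> torus_center val n. chi0 z = chi z"
begin

lemma eps_mult: "z \<in> roots_of_unity n \<Longrightarrow> w \<in> roots_of_unity n \<Longrightarrow> \<epsilon> (z * w) = \<epsilon> z * \<epsilon> w"
  and eps_nonzero: "z \<in> roots_of_unity n \<Longrightarrow> \<epsilon> z \<noteq> 0"
  and eps_inj: "z \<in> roots_of_unity n \<Longrightarrow> w \<in> roots_of_unity n \<Longrightarrow> \<epsilon> z = \<epsilon> w \<Longrightarrow> z = w"
  using eps by (auto simp: faithful_character_def hom_def complex_units_def inj_on_def)

lemma eps_one: "\<epsilon> 1 = 1"
  using eps_mult[of 1 1] eps_nonzero[of 1] by simp

lemma eps_divide: "z \<in> roots_of_unity n \<Longrightarrow> w \<in> roots_of_unity n \<Longrightarrow> \<epsilon> (z / w) = \<epsilon> z / \<epsilon> w"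
  using eps_mult[of "z / w" w] eps_nonzero[of w] root_nonzero[of w] by (simp add: root_divide field_simps)

lemma eps_inverse: "z \<in> roots_of_unity n \<Longrightarrow> \<epsilon> (inverse z) = inverse (\<epsilon> z)"
  using eps_divide[of 1 z] by (simp add: eps_one divide_inverse)

lemma root_power: "z \<in> roots_of_unity n \<Longrightarrow> z ^ k \<in> roots_of_unity n"
  using root_powi[of z "int k"] by simp

lemma eps_power: "z \<in> roots_of_unity n \<Longrightarrow> \<epsilon> (z ^ k) = \<epsilon> z ^ k"
  by (induction k) (simp_all add: eps_one eps_mult root_power)

lemma m_ge_1: "1 \<le> m"
  using primitive by (simp add: primitive_mod_def)

text \<open>The value of \<open>theta\<close> on units: (\<omega>, t)_n is the inverse of
  \<open>tame t\<close>.\<close>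

definition th :: "'a \<Rightarrow> 'a" where
  "th t = inverse (tame t)"

lemma th_root: "t \<in> units \<Longrightarrow> th t \<in> roots_of_unity n"
  by (simp add: th_def root_inverse tame_root)

lemma th_mult: "s \<in> units \<Longrightarrow> t \<in> units \<Longrightarrow> th (s * t) = th s * th t"
  by (simp add: th_def tame_mult)

lemma th_power: "t \<in> units \<Longrightarrow> th (t ^ k) = th t ^ k"
  by (simp add: th_def tame_power power_inverse)

lemma theta_th: "t \<in> units \<Longrightarrow> theta val \<omega> n t = th t"
  using hilbert_unit_right[of \<omega> t] uniformizer by (simp add: theta_def th_def)

lemma th_principal: "cg 1 t 1 \<Longrightarrow> th t = 1"
  using tame_cong[of t 1] cg_units[of 1 t 1] by (simp add: th_def)

definition \<eta>0 :: "'a \<Rightarrow> complex" where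
  "\<eta>0 t = chi0 (dg t, 1)"

definition \<eta> :: "nat \<Rightarrow> 'a \<Rightarrow> complex" where
  "\<eta> i t = \<eta>0 t * \<epsilon> (th t) ^ (2 * i)"

lemma maxab_unit: "t \<in> units \<Longrightarrow> z \<in> roots_of_unity n \<Longrightarrow> (dg t, z) \<in> torus_maxab val n"
  by (auto simp: torus_maxab_def preim_def units_iff)

lemma chi0_mult:
  assumes "s \<in> units" "z \<in> roots_of_unity n" "t \<in> units" "w \<in> roots_of_unity n"
  shows "chi0 (dg (s * t), z * w) = chi0 (dg s, z) * chi0 (dg t, w)"
proof -
  have "chi0 ((dg s, z) \<otimes>\<^bsub>(cover val n)\<lparr>carrier := torus_maxab val n\<rparr>\<^esub> (dg t, w)) =
      chi0 (dg s, z) \<otimes>\<^bsub>complex_units\<^esub> chi0 (dg t, w)"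
    using chi0(1) maxab_unit assms by (intro hom_mult) (auto simp: genuine_character_def)
  moreover have "kubota val n (dg s) (dg t) = 1"
    using kubota_torus_unit(1)[OF units_nonzero[OF assms(1)] assms(3)] assms(1) by (simp add: units_iff)
  ultimately show ?thesis by (simp add: cover_def complex_units_def dg_mult)
qed

lemma chi0_genuine: "z \<in> roots_of_unity n \<Longrightarrow> chi0 (mat 1, z) = \<epsilon> z"
  using chi0(1) by (simp add: genuine_character_def)

lemma chi0_eq: "t \<in> units \<Longrightarrow> z \<in> roots_of_unity n \<Longrightarrow> chi0 (dg t, z) = \<eta>0 t * \<epsilon> z"
  using chi0_mult[of t 1 1 z] by (simp add: \<eta>0_def dg_one chi0_genuine)

text \<open>For t in 1 + p^m the element diag(t, 1/t) is central, so chi0 takes there the value of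
  chi, which is 1 by primitivity.\<close>

lemma \<eta>0_unit_char: "unit_char \<eta>0 m"
  unfolding unit_char_def
proof (intro conjI ballI impI)
  fix s t assume "s \<in> units" "t \<in> units"
  then show "\<eta>0 (s * t) = \<eta>0 s * \<eta>0 t" using chi0_mult[of s 1 t 1] by (simp add: \<eta>0_def)
next
  fix t assume t: "t \<in> units"
  have "chi0 (dg t, 1) \<in> carrier complex_units"
    using chi0(1) maxab_unit[OF t root_one] by (auto simp: genuine_character_def hom_def)
  then show "\<eta>0 t \<noteq> 0" by (simp add: \<eta>0_def complex_units_def)
  assume tm: "cg m t 1"
  have t1: "cg 1 t 1" using cg_mono[OF tm m_ge_1] .
  have "cg m (inverse t) 1" using cg_inverse[OF tm t] by simp
  then have "dg t \<in> congr_subgroup val m"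
    using dg_K[OF t] tm by (simp add: congr_subgroup_iff mcg_def dg_mk mat_1_mk)
  then have "(dg t, 1) \<in> torus_center val n \<inter> emb ` congr_subgroup val m"
    using torus_center_principal[OF t1] by (auto simp: emb_def)
  then show "\<eta>0 t = 1"
    using primitive chi0(2) by (auto simp: primitive_mod_def \<eta>0_def)
qed

lemma eps_th_unit_char: "unit_char (\<lambda>t. \<epsilon> (th t) ^ k) 1"
  unfolding unit_char_def
  by (auto simp: th_mult eps_mult th_root power_mult_distrib eps_nonzero th_principal eps_one)

lemma \<eta>_unit_char: "unit_char (\<eta> i) m"
  using \<eta>0_unit_char unit_char_mono[OF eps_th_unit_char m_ge_1, of "2 * i"]
  unfolding unit_char_def \<eta>_def by simp

lemma \<eta>_principal: "cg 1 t 1 \<Longrightarrow> \<eta> i t = \<eta>0 t"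
  by (simp add: \<eta>_def th_principal eps_one)

text \<open>Minimality of m fails to say anything below level 1, whence the bound 2 <= m.\<close>

lemma \<eta>0_nontrivial:
  assumes "2 \<le> m"
  obtains x where "x \<in> pid (m - 1)" "\<eta>0 (1 + x) \<noteq> 1"
proof -
  have "\<not> (\<forall>k \<in> torus_center val n \<inter> emb ` congr_subgroup val (m - 1). chi k = 1)"
  proof
    assume "\<forall>k \<in> torus_center val n \<inter> emb ` congr_subgroup val (m - 1). chi k = 1"
    moreover have "m - 1 \<ge> 1" using assms by linarith
    ultimately have "m \<le> m - 1" using primitive unfolding primitive_mod_def by blast
    then show False using assms by linarith
  qed
  then obtain g where g: "(g, 1) \<in> torus_center val n" "g \<in> congr_subgroup val (m - 1)" "chi (g, 1) \<noteq> 1"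
    by (auto simp: emb_def)
  then obtain t where t: "g = dg t"
    by (auto simp: torus_center_def group_center_def cover_sub_def preim_def torus_def)
  have "t - 1 \<in> pid (m - 1)"
    using g(2) by (simp add: t congr_subgroup_iff mcg_def dg_mk mat_1_mk cg_def)
  moreover have "\<eta>0 (1 + (t - 1)) \<noteq> 1" using g chi0(2) by (simp add: \<eta>0_def t)
  ultimately show ?thesis by (rule that)
qed

definition N :: nat where
  "N = n_red n"

lemma N_pos: "N > 0"
  using n2 by (auto simp: N_def n_red_def)

lemma th_square_order: "t \<in> units \<Longrightarrow> \<epsilon> (th (t\<^sup>2)) ^ N = 1"
proof -
  assume t: "t \<in> units"
  have "n dvd 2 * N" by (auto simp: N_def n_red_def)
  then obtain k where "2 * N = n * k" by blast
  then have "(th t ^ 2) ^ N = (th t ^ n) ^ k" by (simp add: power_mult[symmetric])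
  also have "\<dots> = 1" using th_root[OF t] by (simp add: roots_of_unity_def)
  finally show ?thesis
    using t by (simp add: th_power eps_power[symmetric] root_power th_root eps_one)
qed

text \<open>With \<open>th_square_order\<close>: t |-> \<epsilon>(\<theta>(t^2)) has exact order N.
  On Teichmueller representatives \<open>tame t\<close> is t^d with d = (q-1)/n; a nonzero remainder
  r of 2e modulo n would give t^(r d) = 1 for all of them although r d < q - 1.\<close>

lemma th_faithful:
  assumes "\<And>t. t \<in> units \<Longrightarrow> \<epsilon> (th (t\<^sup>2)) ^ e = 1"
  shows "N dvd e"
proof -
  have tame1: "tame t ^ (2 * e) = 1" if t: "t \<in> units" for t
  proof -
    have "\<epsilon> ((th t ^ 2) ^ e) = \<epsilon> 1"
      using assms[OF t] t by (simp add: th_power eps_power root_power th_root eps_one)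
    then have "(th t ^ 2) ^ e = 1" using t by (intro eps_inj) (simp_all add: root_power th_root)
    then show ?thesis by (simp add: th_def power_mult power_inverse)
  qed
  have "n dvd 2 * e"
  proof (rule ccontr)
    assume nd: "\<not> n dvd 2 * e"
    define r where "r = (2 * e) mod n"
    have r: "0 < r" "r < n" using nd n2 by (auto simp: r_def dvd_eq_mod_eq_0)
    define d where "d = (q - 1) div n"
    have qd: "q - 1 = n * d" using n_dvd by (simp add: d_def)
    have "q - 1 > 0" using q_pos by simp
    then have d: "d > 0" unfolding qd by simp
    have "r * d < q - 1" unfolding qd using r d by simp
    then obtain t where t: "t \<in> teich" "t \<noteq> 0" "t ^ (r * d) \<noteq> 1"
      using teich_nonroot[of "r * d"] r d by auto
    have tu: "t \<in> units" using teich_units t by blast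
    have "tame t = t ^ d"
      using tame_cg[OF tu] t root_teich[OF tame_root[OF tu]] by (intro teich_inj teich_power) (simp_all add: d_def)
    moreover have "tame t ^ r = 1"
    proof -
      have "tame t ^ (2 * e) = (tame t ^ n) ^ (2 * e div n) * tame t ^ r"
        unfolding r_def by (metis power_add power_mult mult_div_mod_eq)
      then show ?thesis using tame1[OF tu] tame_root[OF tu] by (simp add: roots_of_unity_def)
    qed
    ultimately show False using t(3) by (simp add: power_mult[symmetric] mult.commute)
  qed
  then show ?thesis
    by (cases "odd n") (auto simp: N_def n_red_def coprime_dvd_mult_right_iff elim!: evenE)
qed

lemma \<eta>_inj:
  assumes "i < N" "k < N" "\<And>t. t \<in> units \<Longrightarrow> \<eta> i t = \<eta> k t"
  shows "i = k"
proof -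
  have *: "i = k" if ik: "i \<le> k" and k: "k < N" and e: "\<And>t. t \<in> units \<Longrightarrow> \<eta> i t = \<eta> k t" for i k
  proof -
    have "\<epsilon> (th (t\<^sup>2)) ^ (k - i) = 1" if t: "t \<in> units" for t
    proof -
      have "\<epsilon> (th t) ^ (2 * i) = \<epsilon> (th t) ^ (2 * k)"
        using e[OF t] unit_char_nonzero[OF \<eta>0_unit_char t] by (simp add: \<eta>_def)
      also have "\<epsilon> (th t) ^ (2 * k) = \<epsilon> (th t) ^ (2 * i) * \<epsilon> (th t) ^ (2 * (k - i))"
        using ik by (simp add: power_add[symmetric] algebra_simps)
      finally have "\<epsilon> (th t) ^ (2 * (k - i)) = 1" using eps_nonzero[OF th_root[OF t]] by simp
      then show ?thesis using t by (simp add: th_power eps_power th_root power_mult)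
    qed
    then have "N dvd k - i" by (rule th_faithful)
    then have "k - i = 0" using k by (metis dvd_imp_le gr0I le_less_trans less_irrefl diff_le_self)
    then show "i = k" using ik by simp
  qed
  show ?thesis using *[of i k] *[of k i] assms by (metis linear)
qed

text \<open>The exceptional condition in the shape of \<open>\<eta>_product\<close>: for j = i + k
  it says \<eta>_i \<eta>_k = 1.\<close>

lemma squares_match_iff:
  "squares_match val \<omega> n \<epsilon> chi0 j \<longleftrightarrow> (\<forall>t\<in>units. \<eta>0 t ^ 2 * \<epsilon> (th (t\<^sup>2)) ^ j = 1)"
proof -
  have "chi0 (emb (dg (t\<^sup>2))) = \<epsilon> (theta val \<omega> n (t\<^sup>2) powi (- int j)) \<longleftrightarrow> \<eta>0 t ^ 2 * \<epsilon> (th (t\<^sup>2)) ^ j = 1"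
    if t: "t \<in> units" for t
  proof -
    have t2: "t\<^sup>2 \<in> units" using t by (rule units_power)
    have e1: "chi0 (emb (dg (t\<^sup>2))) = \<eta>0 t ^ 2"
      using unit_char_mult[OF \<eta>0_unit_char t t] by (simp add: emb_def \<eta>0_def power2_eq_square)
    have e2: "\<epsilon> (theta val \<omega> n (t\<^sup>2) powi (- int j)) = inverse (\<epsilon> (th (t\<^sup>2)) ^ j)"
    proof -
      have "th (t\<^sup>2) powi (- int j) = inverse (th (t\<^sup>2) ^ j)" by (simp add: power_int_minus)
      then show ?thesis
        using th_root[OF t2] by (simp add: theta_th[OF t2] eps_inverse eps_power root_power)
    qed
    have "\<epsilon> (th (t\<^sup>2)) ^ j \<noteq> 0" using eps_nonzero[OF th_root[OF t2]] by simp
    then show ?thesis unfolding e1 e2 by (simp add: inverse_eq_divide eq_divide_eq)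
  qed
  then show ?thesis by (simp add: squares_match_def)
qed

lemma \<eta>_product: "t \<in> units \<Longrightarrow> \<eta> i t * \<eta> k t = \<eta>0 t ^ 2 * \<epsilon> (th (t\<^sup>2)) ^ (i + k)"
proof -
  assume t: "t \<in> units"
  have "\<epsilon> (th (t\<^sup>2)) = \<epsilon> (th t) ^ 2" using t by (simp add: th_power eps_power th_root)
  then show ?thesis by (simp add: \<eta>_def power_mult power_add power2_eq_square power_mult_distrib mult_ac)
qed

text \<open>On 1 + p all \<eta>_i agree with \<eta>_0, whose square would be trivial there. For m >=
  2 every 1 + x with x in p^(m-1) is the square of 1 + x/2 modulo p^m, so \<eta>_0 would be trivial
  on 1 + p^(m-1), against primitivity.\<close>

lemma \<eta>_inverse_level:
  assumes "\<And>t. t \<in> units \<Longrightarrow> \<eta> i t * \<eta> k t = 1"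
  shows "m = 1"
proof (rule ccontr)
  assume "m \<noteq> 1"
  then have m2: "2 \<le> m" using m_ge_1 by simp
  obtain x where x: "x \<in> pid (m - 1)" "\<eta>0 (1 + x) \<noteq> 1" using \<eta>0_nontrivial[OF m2] by blast
  have x1: "x \<in> pid 1" using x(1) m2 by (elim pid_mono) simp
  define y where "y = x / 2"
  have y: "y \<in> pid (m - 1)" "y \<in> pid 1"
    unfolding y_def divide_inverse
    by (intro pid_multR x(1) x1 units_pid[OF units_inverse[OF two_unit]])+
  have u: "1 + x \<in> units" "1 + y \<in> units" using one_add_pid_units x1 y(2) by blast+
  have "y * y \<in> pid (1 + (m - 1))" using pid_mult[OF y(2,1)] .
  then have "cg m ((1 + y) * (1 + y)) (1 + x)"
    using m2 two_nonzero by (simp add: cg_def y_def algebra_simps)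
  then have "\<eta>0 ((1 + y) * (1 + y)) = \<eta>0 (1 + x)"
    using unit_char_cong[OF \<eta>0_unit_char units_mult[OF u(2) u(2)] u(1)] by blast
  moreover have "\<eta>0 (1 + y) * \<eta>0 (1 + y) = 1"
    using assms[OF u(2)] \<eta>_principal[of "1 + y"] y(2) by (simp add: cg_def)
  ultimately show False using x(2) unit_char_mult[OF \<eta>0_unit_char u(2) u(2)] by simp
qed

end

section \<open>The representations of the covering group\<close>

context cover_setting
begin

abbreviation G :: "'a cov monoid" where
  "G \<equiv> K_cover val n"

text \<open>The element (g, z) is (g, s(g)) times the central element z / s(g): the first acts by
  right translation, the second by \<epsilon>.\<close>

definition twist_act :: "'a cov \<Rightarrow> ('a mat2 \<Rightarrow> complex) \<Rightarrow> 'a mat2 \<Rightarrow> complex" where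
  "twist_act x F = (\<lambda>k. \<epsilon> (snd x / spl (fst x)) * rt (fst x) F k)"

abbreviation model :: "('a mat2 \<Rightarrow> complex) set \<Rightarrow> ('a cov, 'a mat2 \<Rightarrow> complex) rep" where
  "model C \<equiv> fun_rep C twist_act"

lemma twist_act_spl: "g \<in> K \<Longrightarrow> twist_act (g, spl g) F = rt g F"
  using spl_nonzero by (simp add: twist_act_def eps_one)

lemma rt_scale: "rt g (\<lambda>x. c * F x) = (\<lambda>x. c * rt g F x)"
  by (auto simp: rt_def fun_eq_iff)

lemma rt_add: "rt g (\<lambda>x. F x + H x) = (\<lambda>x. rt g F x + rt g H x)"
  by (auto simp: rt_def fun_eq_iff)

lemma model_representation:
  assumes "(\<lambda>_. 0) \<in> C" "\<And>F H. F \<in> C \<Longrightarrow> H \<in> C \<Longrightarrow> (\<lambda>x. F x + H x) \<in> C"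
    and scale: "\<And>c F. F \<in> C \<Longrightarrow> (\<lambda>x. c * F x) \<in> C" and rtC: "\<And>g F. g \<in> K \<Longrightarrow> F \<in> C \<Longrightarrow> rt g F \<in> C"
    and out: "\<And>F x. F \<in> C \<Longrightarrow> x \<notin> K \<Longrightarrow> F x = 0"
  shows "representation G (model C)"
proof (rule fun_rep_representation)
  show "twist_act x F \<in> C" if "x \<in> carrier G" "F \<in> C" for x F
    unfolding twist_act_def using that by (intro scale rtC) (auto simp: K_cover_simps)
  show "twist_act \<one>\<^bsub>G\<^esub> F = F" if "F \<in> C" for F
    using rt_one[of F] out[OF that] spl_congr[of "mat 1" 1] K_one
    by (simp add: twist_act_def K_cover_simps congr_subgroup_iff eps_one)
  show "twist_act (x \<otimes>\<^bsub>G\<^esub> y) F = twist_act x (twist_act y F)"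
    if x: "x \<in> carrier G" and y: "y \<in> carrier G" and F: "F \<in> C" for x y F
  proof -
    obtain g z h w where xy: "x = (g, z)" "y = (h, w)" by (cases x, cases y)
    then have gh: "g \<in> K" "h \<in> K" and zw: "z \<in> roots_of_unity n" "w \<in> roots_of_unity n"
      using x y by (auto simp: K_cover_simps)
    have "kubota val n g h * z * w / spl (g ** h) = (z / spl g) * (w / spl h)"
      using kubota_spl[OF gh] spl_nonzero gh K_mult by (simp add: field_simps)
    then have "\<epsilon> (kubota val n g h * z * w / spl (g ** h)) = \<epsilon> (z / spl g) * \<epsilon> (w / spl h)"
      by (simp only: eps_mult[OF root_divide[OF zw(1) spl_root[OF gh(1)]] root_divide[OF zw(2) spl_root[OF gh(2)]]])
    then show ?thesis
      using gh by (simp add: xy K_cover_simps twist_act_def rt_scale rt_rt[symmetric] mult.assoc)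
  qed
qed (use assms in \<open>auto simp: twist_act_def rt_add rt_scale distrib_left mult.left_commute\<close>)

lemma ps_model: "representation G (model (ps \<eta>' l))"
  by (rule model_representation) (auto intro: ps_zero ps_add ps_scale rt_ps dest: ps_outside)

section \<open>Passage between functions on K and genuine functions on its cover\<close>

definition lift :: "('a mat2 \<Rightarrow> complex) \<Rightarrow> 'a cov \<Rightarrow> complex" where
  "lift F x = (if x \<in> carrier G then \<epsilon> (snd x / spl (fst x)) * F (fst x) else 0)"

lemma lift_eq: "k \<in> K \<Longrightarrow> z \<in> roots_of_unity n \<Longrightarrow> lift F (k, z) = \<epsilon> (z / spl k) * F k"
  by (simp add: lift_def K_cover_simps)

lemma lift_spl: "k \<in> K \<Longrightarrow> lift F (k, spl k) = F k"
  using spl_nonzero spl_root by (simp add: lift_eq eps_one)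

lemma lift_act:
  "x \<in> carrier G \<Longrightarrow> lift (twist_act x F) = (\<lambda>y. if y \<in> carrier G then lift F (y \<otimes>\<^bsub>G\<^esub> x) else 0)"
proof
  fix y assume x: "x \<in> carrier G"
  show "lift (twist_act x F) y = (if y \<in> carrier G then lift F (y \<otimes>\<^bsub>G\<^esub> x) else 0)"
  proof (cases "y \<in> carrier G")
    case True
    obtain g z k w where xy: "x = (g, z)" "y = (k, w)" by (cases x, cases y)
    then have gk: "g \<in> K" "k \<in> K" and zw: "z \<in> roots_of_unity n" "w \<in> roots_of_unity n"
      using x True by (auto simp: K_cover_simps)
    have "kubota val n k g * w * z / spl (k ** g) = (w / spl k) * (z / spl g)"
      using kubota_spl[OF gk(2,1)] spl_nonzero gk K_mult by (simp add: field_simps)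
    then have "\<epsilon> (kubota val n k g * w * z / spl (k ** g)) = \<epsilon> (w / spl k) * \<epsilon> (z / spl g)"
      by (simp only: eps_mult[OF root_divide[OF zw(2) spl_root[OF gk(2)]] root_divide[OF zw(1) spl_root[OF gk(1)]]])
    moreover have "kubota val n k g * w * z \<in> roots_of_unity n"
      using gk zw by (simp add: root_mult kubota_root)
    ultimately show ?thesis
      using gk zw K_mult[OF gk(2,1)] True unfolding xy
      by (simp add: K_cover_simps lift_eq twist_act_def rt_eq)
  qed (simp add: lift_def)
qed

lemma borel_character:
  assumes b: "b \<in> borel" "b \<in> K" and z: "z \<in> roots_of_unity n"
  shows "extend_borel (chi_twist val \<omega> n chi0 i) (b, z) = \<eta> i (b $ 1 $ 1) * \<epsilon> z"
proof -
  obtain t y v t' where bm: "b = mk t y v t'" by (rule mk_cases)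
  have t: "t \<in> units" using b units_mult_iff[of t t'] by (auto simp: bm borel_mk mk_K)
  have "extend_borel (chi_twist val \<omega> n chi0 i) (b, z) = chi0 (dg t, th t ^ (2 * i) * z)"
    using t by (simp add: extend_borel_def chi_twist_def bm dg_mk theta_th units_iff Let_def)
  also have "\<dots> = \<eta>0 t * \<epsilon> (th t ^ (2 * i) * z)"
    using t z by (intro chi0_eq root_mult root_power th_root)
  also have "\<dots> = \<eta> i t * \<epsilon> z"
    using t z by (simp add: \<eta>_def eps_mult root_power th_root eps_power)
  finally show ?thesis by (simp add: bm)
qed

lemma V_fixed_simps:
  "carrier (V_fixed val \<omega> n chi0 i l) = {f \<in> carrier (V_rep val \<omega> n chi0 i).
     \<forall>h \<in> emb ` congr_subgroup val l. act (V_rep val \<omega> n chi0 i) h f = f}"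
  "ring.zero (V_fixed val \<omega> n chi0 i l) = (\<lambda>_. 0)"
  "ring.add (V_fixed val \<omega> n chi0 i l) = (\<lambda>f g x. f x + g x)"
  "smult (V_fixed val \<omega> n chi0 i l) = (\<lambda>c f x. c * f x)"
  "act (V_fixed val \<omega> n chi0 i l) = (\<lambda>g f x. if x \<in> carrier G then f (x \<otimes>\<^bsub>G\<^esub> g) else 0)"
  by (simp_all add: V_fixed_def fixed_rep_def sub_rep_def V_rep_def smooth_ind_def)

lemma V_fixed_carrier_iff:
  "f \<in> carrier (V_fixed val \<omega> n chi0 i l) \<longleftrightarrow>
    (\<forall>x. x \<notin> carrier G \<longrightarrow> f x = 0) \<and>
    (\<forall>h \<in> preim n (borel \<inter> K). \<forall>x \<in> carrier G. f (h \<otimes>\<^bsub>G\<^esub> x) = extend_borel (chi_twist val \<omega> n chi0 i) h * f x) \<and>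
    (\<exists>U \<in> congr_basis val. \<forall>k \<in> U \<inter> carrier G. \<forall>x \<in> carrier G. f (x \<otimes>\<^bsub>G\<^esub> k) = f x) \<and>
    (\<forall>h \<in> emb ` congr_subgroup val l. (\<lambda>x. if x \<in> carrier G then f (x \<otimes>\<^bsub>G\<^esub> h) else 0) = f)"
  by (simp add: V_fixed_simps) (simp add: V_rep_def smooth_ind_def)

text \<open>A vector is determined by its values on the section k |-> (k, s(k)).
  \<open>kubota_spl\<close> turns products with Borel and congruence elements on the cover into
  products in K along this section.\<close>

lemma V_fixed_lift:
  assumes l: "1 \<le> l"
  shows "carrier (V_fixed val \<omega> n chi0 i l) = lift ` ps (\<eta> i) l"
proof (intro equalityI subsetI)
  fix f assume f: "f \<in> carrier (V_fixed val \<omega> n chi0 i l)"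
  note D = f[unfolded V_fixed_carrier_iff]
  have out: "f x = 0" if "x \<notin> carrier G" for x using D that by blast
  have bor: "f ((b, z) \<otimes>\<^bsub>G\<^esub> x) = \<eta> i (b $ 1 $ 1) * \<epsilon> z * f x"
    if "b \<in> borel" "b \<in> K" "z \<in> roots_of_unity n" "x \<in> carrier G" for b z x
    using D that borel_character[OF that(1-3), of i] by (auto simp: preim_def)
  have fx: "f (x \<otimes>\<^bsub>G\<^esub> (g, 1)) = f x" if "g \<in> congr_subgroup val l" "x \<in> carrier G" for g x
  proof -
    have "(\<lambda>x. if x \<in> carrier G then f (x \<otimes>\<^bsub>G\<^esub> (g, 1)) else 0) = f"
      using D that(1) by (auto simp: emb_def)
    from fun_cong[OF this, of x] show ?thesis by (simp only: that(2) if_True)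
  qed
  define F where "F k = (if k \<in> K then f (k, spl k) else 0)" for k
  have sc: "(k, spl k) \<in> carrier G" if "k \<in> K" for k using that spl_root by (simp add: K_cover_simps)
  have mul: "(b, z) \<otimes>\<^bsub>G\<^esub> (k, spl k) = (b ** k, spl (b ** k) * z)" if "b \<in> borel" "b \<in> K" "k \<in> K" for b z k
    using kubota_spl[OF that(2,3)] spl_borel[OF that(1)] by (simp add: K_cover_simps mult_ac)
  have F: "F \<in> ps (\<eta> i) l"
  proof (rule ps_I)
    fix b k assume b: "b \<in> borel" "b \<in> K" and k: "k \<in> K"
    show "F (b ** k) = \<eta> i (b $ 1 $ 1) * F k"
      using bor[OF b root_one sc[OF k]] mul[OF b k, of 1] K_mult[OF b(2) k] k by (simp add: F_def eps_one)
  next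
    fix x y assume xy: "mcg l x y" "x \<in> K" "y \<in> K"
    define g where "g = adj2 x ** y"
    have g: "g \<in> congr_subgroup val l" using mcg_congr_subgroup[OF xy(2,3)] xy(1) by (simp add: g_def)
    have gK: "g \<in> K" using g by (simp add: congr_subgroup_iff)
    have y: "x ** g = y" using K_adj2(2)[OF xy(2)] by (simp add: g_def matrix_mul_assoc)
    have "(x, spl x) \<otimes>\<^bsub>G\<^esub> (g, 1) = (y, spl y)"
      using kubota_spl[OF xy(2) gK] spl_congr[OF g l] y by (simp add: K_cover_simps)
    then show "F x = F y" using fx[OF g sc[OF xy(2)]] xy by (simp add: F_def)
  qed (simp add: F_def)
  moreover have "f = lift F"
  proof
    fix x
    show "f x = lift F x"
    proof (cases "x \<in> carrier G")
      case True
      then obtain k z where x: "x = (k, z)" "k \<in> K" "z \<in> roots_of_unity n" by (auto simp: K_cover_simps)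
      have b1: "mat 1 \<in> borel" "mat 1 \<in> K" by (simp_all add: mat_1_mk borel_mk mk_K)
      have zs: "z / spl k \<in> roots_of_unity n" using x spl_root by (simp add: root_divide)
      \<comment> \<open>Central elements lie in the preimage of the Borel subgroup, so genuineness
        is part of Borel equivariance and gives the values off the section.\<close>
      have "(mat 1, z / spl k) \<otimes>\<^bsub>G\<^esub> (k, spl k) = (k, z)"
        using mul[OF b1 x(2), of "z / spl k"] spl_nonzero[OF x(2)] by simp
      then have "f (k, z) = \<eta> i 1 * \<epsilon> (z / spl k) * f (k, spl k)"
        using bor[OF b1 zs sc[OF x(2)]] by (simp add: mat_1_mk)
      then show ?thesis
        using x unit_char_one[OF \<eta>_unit_char] by (simp add: lift_eq F_def)
    qed (simp add: out lift_def)
  qed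
  ultimately show "f \<in> lift ` ps (\<eta> i) l" by blast
next
  fix f assume "f \<in> lift ` ps (\<eta> i) l"
  then obtain F where F: "F \<in> ps (\<eta> i) l" and f: "f = lift F" by blast
  have fx: "f (x \<otimes>\<^bsub>G\<^esub> (g, 1)) = f x" if g: "g \<in> congr_subgroup val l" and x: "x \<in> carrier G" for g x
  proof -
    have gK: "g \<in> K" using g by (simp add: congr_subgroup_iff)
    have gG: "(g, 1) \<in> carrier G" using gK by (simp add: K_cover_simps)
    have "twist_act (g, 1) F = F"
    proof
      fix k
      have "F (k ** g) = F k" if k: "k \<in> K"
      proof (rule ps_mcg[OF F _ K_mult[OF k gK] k])
        have "mcg l (k ** g) (k ** mat 1)" using g k gK by (intro mcg_multL) (auto simp: congr_subgroup_iff)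
        then show "mcg l (k ** g) k" by simp
      qed
      then show "twist_act (g, 1) F k = F k"
        using spl_congr[OF g l] ps_outside[OF F] by (auto simp: twist_act_def rt_def eps_one)
    qed
    then show ?thesis using lift_act[OF gG, of F] x unfolding f by metis
  qed
  show "f \<in> carrier (V_fixed val \<omega> n chi0 i l)"
    unfolding V_fixed_carrier_iff
  proof (intro conjI allI impI ballI)
    show "f x = 0" if "x \<notin> carrier G" for x using that by (simp add: f lift_def)
    show "f (h \<otimes>\<^bsub>G\<^esub> x) = extend_borel (chi_twist val \<omega> n chi0 i) h * f x"
      if h: "h \<in> preim n (borel \<inter> K)" and x: "x \<in> carrier G" for h x
    proof -
      obtain b z k w where hx: "h = (b, z)" "x = (k, w)" by (cases h, cases x)
      then have b: "b \<in> borel" "b \<in> K" and k: "k \<in> K" and zw: "z \<in> roots_of_unity n" "w \<in> roots_of_unity n"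
        using h x by (auto simp: preim_def K_cover_simps)
      have "kubota val n b k * z * w / spl (b ** k) = z * (w / spl k)"
        using kubota_spl[OF b(2) k] spl_nonzero k K_mult[OF b(2) k] spl_borel[OF b(1)] by (simp add: field_simps)
      then have "\<epsilon> (kubota val n b k * z * w / spl (b ** k)) = \<epsilon> z * \<epsilon> (w / spl k)"
        by (simp only: eps_mult[OF zw(1) root_divide[OF zw(2) spl_root[OF k]]])
      moreover have "kubota val n b k * z * w \<in> roots_of_unity n"
        using b k zw by (simp add: root_mult kubota_root)
      ultimately show ?thesis
        using ps_borel[OF F b k] borel_character[OF b zw(1), of i] K_mult[OF b(2) k] k zw unfolding hx f
        by (simp add: K_cover_simps lift_eq)
    qed
    show "\<exists>U \<in> congr_basis val. \<forall>k \<in> U \<inter> carrier G. \<forall>x \<in> carrier G. f (x \<otimes>\<^bsub>G\<^esub> k) = f x"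
    proof (intro bexI[of _ "emb ` congr_subgroup val l"] ballI)
      show "emb ` congr_subgroup val l \<in> congr_basis val" using l by (auto simp: congr_basis_def)
      fix k x assume k: "k \<in> emb ` congr_subgroup val l \<inter> carrier G" and x: "x \<in> carrier G"
      then obtain g where "g \<in> congr_subgroup val l" "k = (g, 1)" by (auto simp: emb_def)
      then show "f (x \<otimes>\<^bsub>G\<^esub> k) = f x" using fx[OF _ x] by simp
    qed
    show "(\<lambda>x. if x \<in> carrier G then f (x \<otimes>\<^bsub>G\<^esub> h) else 0) = f" if h: "h \<in> emb ` congr_subgroup val l" for h
    proof
      fix x
      obtain g where g: "g \<in> congr_subgroup val l" "h = (g, 1)" using h by (auto simp: emb_def)
      show "(if x \<in> carrier G then f (x \<otimes>\<^bsub>G\<^esub> h) else 0) = f x"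
        using fx[OF g(1)] g(2) by (auto simp: f lift_def)
    qed
  qed
qed

definition restr :: "('a cov \<Rightarrow> complex) \<Rightarrow> 'a mat2 \<Rightarrow> complex" where
  "restr f k = (if k \<in> K then f (k, spl k) else 0)"

lemma restr_lift: "F \<in> ps \<eta>' l \<Longrightarrow> restr (lift F) = F"
  using ps_outside by (auto simp: restr_def fun_eq_iff lift_spl)

lemma lift_inj: "inj_on lift (ps \<eta>' l)"
  by (rule inj_on_inverseI[of _ restr]) (rule restr_lift)

lemma V_fixed_representation:
  assumes l: "1 \<le> l"
  shows "representation G (V_fixed val \<omega> n chi0 i l)"
proof (rule representation_image[OF ps_model[of "\<eta> i" l], where p = lift])
  show "carrier (V_fixed val \<omega> n chi0 i l) = lift ` carrier (model (ps (\<eta> i) l))"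
    using V_fixed_lift[OF l] by simp
qed (auto simp: V_fixed_simps lift_def[abs_def] fun_eq_iff distrib_left K_cover_one K_cover_mult
    lift_act[unfolded lift_def[abs_def] fun_eq_iff, simplified])

lemma V_fixed_equiv:
  assumes l: "1 \<le> l"
  shows "rep_equiv G (model (ps (\<eta> i) l)) (V_fixed val \<omega> n chi0 i l)"
  unfolding rep_equiv_def
proof (intro exI[of _ lift] conjI ballI)
  show "bij_betw lift (carrier (model (ps (\<eta> i) l))) (carrier (V_fixed val \<omega> n chi0 i l))"
    using V_fixed_lift[OF l] lift_inj by (simp add: bij_betw_def)
  show "linear_between (model (ps (\<eta> i) l)) (V_fixed val \<omega> n chi0 i l) lift"
    unfolding linear_between_def using V_fixed_lift[OF l]
    by (auto simp: V_fixed_simps(2-5) lift_def fun_eq_iff distrib_left)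
  fix x F assume "x \<in> carrier G"
  then show "lift (act (model (ps (\<eta> i) l)) x F) = act (V_fixed val \<omega> n chi0 i l) x (lift F)"
    by (simp add: V_fixed_simps lift_act)
qed

text \<open>The covering group acts by right translations times scalars, so a linear bijection
  commuting with \<open>rt\<close> is an equivalence.\<close>

lemma model_equivI:
  assumes "bij_betw f C C'" "\<And>F H. F \<in> C \<Longrightarrow> H \<in> C \<Longrightarrow> f (\<lambda>x. F x + H x) = (\<lambda>x. f F x + f H x)"
    and scale: "\<And>c F. F \<in> C \<Longrightarrow> f (\<lambda>x. c * F x) = (\<lambda>x. c * f F x)"
    and rtf: "\<And>g F. g \<in> K \<Longrightarrow> F \<in> C \<Longrightarrow> f (rt g F) = rt g (f F)" and rtC: "\<And>g F. g \<in> K \<Longrightarrow> F \<in> C \<Longrightarrow> rt g F \<in> C"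
  shows "rep_equiv G (model C) (model C')"
  unfolding rep_equiv_def
proof (intro exI[of _ f] conjI ballI)
  show "linear_between (model C) (model C') f"
    using assms by (auto simp: linear_between_def bij_betw_def)
  fix x F assume "x \<in> carrier G" "F \<in> carrier (model C)"
  then show "f (act (model C) x F) = act (model C') x (f F)"
    using scale[OF rtC] rtf by (auto simp: twist_act_def K_cover_simps)
qed (use assms in simp)

text \<open>The equivalence is carried over to the function models, where elements (g, s(g)) act by
  plain right translation and \<open>ps_intertwiner\<close> applies.\<close>

lemma V_fixed_equiv_cases:
  assumes e: "rep_equiv G (V_fixed val \<omega> n chi0 i m) (V_fixed val \<omega> n chi0 k m)"
  shows "(\<forall>t\<in>units. \<eta> i t = \<eta> k t) \<or> (\<forall>t\<in>units. \<eta> i t * \<eta> k t = 1)"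
proof -
  have "rep_equiv G (model (ps (\<eta> i) m)) (model (ps (\<eta> k) m))"
    using rep_equiv_trans[OF rep_equiv_trans[OF V_fixed_equiv[OF m_ge_1] e]
        rep_equiv_sym[OF ps_model V_fixed_equiv[OF m_ge_1]]] .
  then obtain f where f: "bij_betw f (ps (\<eta> i) m) (ps (\<eta> k) m)" "linear_between (model (ps (\<eta> i) m)) (model (ps (\<eta> k) m)) f"
    "\<And>x F. x \<in> carrier G \<Longrightarrow> F \<in> ps (\<eta> i) m \<Longrightarrow> f (twist_act x F) = twist_act x (f F)"
    by (auto simp: rep_equiv_def)
  show ?thesis
  proof (rule ps_intertwiner[OF m_ge_1 \<eta>_unit_char \<eta>_unit_char, where f = f])
    show "f F \<in> ps (\<eta> k) m" if "F \<in> ps (\<eta> i) m" for F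
      using f(1) that by (auto simp: bij_betw_def)
    show "f (\<lambda>x. c * F x) = (\<lambda>x. c * f F x)" if "F \<in> ps (\<eta> i) m" for c F
      using f(2) that by (simp add: linear_between_def)
    show "f (rt g F) = rt g (f F)" if g: "g \<in> K" "F \<in> ps (\<eta> i) m" for g F
      using f(3)[of "(g, spl g)" F] that spl_root[OF g(1)] by (simp add: twist_act_spl K_cover_simps)
    assume m: "2 \<le> m"
    obtain x where x: "x \<in> pid (m - 1)" "\<eta>0 (1 + x) \<noteq> 1" using \<eta>0_nontrivial[OF m] by blast
    have "x \<in> pid 1" using x(1) m by (elim pid_mono) simp
    then have "\<eta> k (1 + x) = \<eta>0 (1 + x)" by (intro \<eta>_principal) (simp add: cg_def)
    then have "\<eta> k (1 + x) \<noteq> 1" using x(2) by (simp only:) simp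
    then show "\<exists>x\<in>pid (m - 1). \<eta> k (1 + x) \<noteq> 1" using x(1) by blast
  next
    have "inj_on f (ps (\<eta> i) m)" using f(1) by (simp add: bij_betw_def)
    then show "inj_on f (ps (\<eta> i) m)" .
  qed
qed

section \<open>Comparison of the pieces of level m and decomposition of the higher pieces\<close>

lemma inequivalent:
  assumes ik: "i < N" "k < N" "i \<noteq> k" and e: "rep_equiv G (V_fixed val \<omega> n chi0 i m) (V_fixed val \<omega> n chi0 k m)"
  shows "m = 1" "squares_match val \<omega> n \<epsilon> chi0 (i + k)"
proof -
  have inv: "\<forall>t\<in>units. \<eta> i t * \<eta> k t = 1"
    using V_fixed_equiv_cases[OF e] \<eta>_inj[OF ik(1,2)] ik(3) by blast
  then show "m = 1" by (intro \<eta>_inverse_level) blast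
  show "squares_match val \<omega> n \<epsilon> chi0 (i + k)"
    unfolding squares_match_iff using inv \<eta>_product by simp
qed

text \<open>As \<epsilon>(\<theta>(t^2)) has exact order N, the matching exponents form a single
  residue class modulo N.\<close>

lemma squares_match_cong:
  assumes "squares_match val \<omega> n \<epsilon> chi0 j"
  shows "squares_match val \<omega> n \<epsilon> chi0 i \<longleftrightarrow> [i = j] (mod N)"
proof -
  have *: "squares_match val \<omega> n \<epsilon> chi0 i \<longleftrightarrow> (\<forall>t\<in>units. \<epsilon> (th (t\<^sup>2)) ^ i = \<epsilon> (th (t\<^sup>2)) ^ j)"
  proof -
    have "\<eta>0 t ^ 2 * \<epsilon> (th (t\<^sup>2)) ^ i = 1 \<longleftrightarrow> \<epsilon> (th (t\<^sup>2)) ^ i = \<epsilon> (th (t\<^sup>2)) ^ j" if t: "t \<in> units" for t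
    proof -
      have "\<eta>0 t ^ 2 * \<epsilon> (th (t\<^sup>2)) ^ j = 1" using assms t by (simp add: squares_match_iff)
      then show ?thesis using unit_char_nonzero[OF \<eta>0_unit_char t] by (metis mult_cancel_left power_not_zero)
    qed
    then show ?thesis by (simp add: squares_match_iff)
  qed
  have red: "\<epsilon> (th (t\<^sup>2)) ^ a = \<epsilon> (th (t\<^sup>2)) ^ (a mod N)" if "t \<in> units" for t a
  proof -
    have "\<epsilon> (th (t\<^sup>2)) ^ a = (\<epsilon> (th (t\<^sup>2)) ^ N) ^ (a div N) * \<epsilon> (th (t\<^sup>2)) ^ (a mod N)"
      by (metis power_add power_mult mult_div_mod_eq)
    then show ?thesis using th_square_order[OF that] by simp
  qed
  have dvd: "N dvd b - a" if ab: "a \<le> b" "\<And>t. t \<in> units \<Longrightarrow> \<epsilon> (th (t\<^sup>2)) ^ a = \<epsilon> (th (t\<^sup>2)) ^ b" for a b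
  proof (rule th_faithful)
    fix t assume t: "t \<in> units"
    have "\<epsilon> (th (t\<^sup>2)) ^ a = \<epsilon> (th (t\<^sup>2)) ^ a * \<epsilon> (th (t\<^sup>2)) ^ (b - a)"
      using ab(1) ab(2)[OF t] power_add[of "\<epsilon> (th (t\<^sup>2))" a "b - a"] by simp
    then show "\<epsilon> (th (t\<^sup>2)) ^ (b - a) = 1"
      using eps_nonzero[OF th_root[OF units_power[OF t]]] by simp
  qed
  show ?thesis
  proof
    assume "squares_match val \<omega> n \<epsilon> chi0 i"
    then have "\<And>t. t \<in> units \<Longrightarrow> \<epsilon> (th (t\<^sup>2)) ^ i = \<epsilon> (th (t\<^sup>2)) ^ j" using * by blast
    then have "(i \<le> j \<longrightarrow> N dvd j - i) \<and> (j \<le> i \<longrightarrow> N dvd i - j)" using dvd by metis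
    then show "[i = j] (mod N)" by (metis cong_altdef_nat' cong_sym nat_le_linear cong_altdef_nat)
  next
    assume "[i = j] (mod N)"
    then show "squares_match val \<omega> n \<epsilon> chi0 i" unfolding * cong_def using red by metis
  qed
qed

lemma equivalent_at_level_one:
  assumes m: "m = 1" and ik: "i < N" "k < N" "i \<noteq> k" and sm: "squares_match val \<omega> n \<epsilon> chi0 (i + k)"
  shows "rep_equiv G (V_fixed val \<omega> n chi0 i 1) (V_fixed val \<omega> n chi0 k 1)"
proof -
  have inv: "\<eta> i t * \<eta> k t = 1" if "t \<in> units" for t
    using sm that \<eta>_product by (simp add: squares_match_iff)
  \<comment> \<open>If \<eta>_i were trivial, its inverse \<eta>_k would be too, and
    \<open>\<eta>_inj\<close> would give i = k. Nontriviality is what makes the double intertwining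
    operator a scalar.\<close>
  have nt: "\<exists>t\<in>units. \<eta> i t \<noteq> 1"
  proof (rule ccontr)
    assume "\<not> ?thesis"
    then have "\<eta> i t = \<eta> k t" if "t \<in> units" for t using inv[OF that] that by simp
    then show False using \<eta>_inj[OF ik(1,2)] ik(3) by blast
  qed
  note u = \<eta>_unit_char[unfolded m]
  have "rep_equiv G (model (ps (\<eta> i) 1)) (model (ps (\<eta> k) 1))"
    by (rule model_equivI[OF intertwine_bij[OF u u inv nt]])
      (simp_all add: intertwine_add intertwine_scale intertwine_rt rt_ps)
  then show ?thesis
    using rep_equiv_trans[OF rep_equiv_trans[OF rep_equiv_sym[OF ps_model V_fixed_equiv]] V_fixed_equiv] by simp
qed

text \<open>The non-square \<open>\<delta>\<close> is chosen once per level, so the labels of the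
  two halves are consistent for all i. Each half is compared with its model \<open>M d i\<close>,
  and the models for different i are linked by the twist.\<close>

lemma level_pieces:
  assumes l: "l > m"
  shows "\<exists>P Q. (\<forall>i.
      internal_direct_sum G (W_rep val \<omega> n chi0 i l) (P i) (Q i) \<and>
      irreducible_rep G (sub_rep (W_rep val \<omega> n chi0 i l) (P i)) \<and>
      irreducible_rep G (sub_rep (W_rep val \<omega> n chi0 i l) (Q i))) \<and>
    (\<forall>i j. rep_equiv G (sub_rep (W_rep val \<omega> n chi0 i l) (P i)) (sub_rep (W_rep val \<omega> n chi0 j l) (P j)) \<and>
      rep_equiv G (sub_rep (W_rep val \<omega> n chi0 i l) (Q i)) (sub_rep (W_rep val \<omega> n chi0 j l) (Q j)))"
proof -
  define L where "L = l - 1"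
  have L: "1 \<le> L" "m \<le> L" "l = L + 1" using l m_ge_1 by (auto simp: L_def)
  obtain \<Lambda> where \<Lambda>: "prim_char L \<Lambda>" using prim_char_exists[OF L(1)] by blast
  interpret level_char val \<omega> L \<Lambda> by unfold_locales (rule \<Lambda>)
  obtain \<delta> where \<delta>: "\<delta> \<in> units" "\<And>s. s \<in> units \<Longrightarrow> s \<in> sq_class 1 \<longleftrightarrow> s \<notin> sq_class \<delta>"
    by (rule sq_class_dichotomy) (rule that)
  have u: "unit_char (\<eta> i) L" for i using unit_char_mono[OF \<eta>_unit_char L(2)] .
  define M where "M d i = model (psC (\<eta> i) (sq_class d))" for d i
  have psC0: "(\<lambda>_. 0) \<in> psC (\<eta> i) (sq_class d)" for i d
    by (rule psC_I[OF ps_zero]) (simp add: hat_def)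
  have M: "representation G (M d i)" for d i
    unfolding M_def by (rule model_representation) (auto intro: psC0 psC_add psC_scale psC_rt dest: ps_outside[OF psC_ps])
  have irr: "irreducible_rep G (M d i)" if d: "d \<in> units" for d i
    unfolding irreducible_rep_def
  proof (intro conjI allI impI M)
    show "carrier (M d i) \<noteq> {\<zero>\<^bsub>M d i\<^esub>}" using psC_nontrivial[OF u d, of i] by (auto simp: M_def)
    fix U assume U: "invariant_subspace G (M d i) U"
    note D = invariant_subspaceD[OF U]
    show "U = {\<zero>\<^bsub>M d i\<^esub>} \<or> U = carrier (M d i)"
    proof (cases "U = {\<zero>\<^bsub>M d i\<^esub>}")
      case False
      then obtain F where F: "F \<in> U" "F \<noteq> (\<lambda>_. 0)" using D(2) by (auto simp: M_def)
      have "psC (\<eta> i) (sq_class d) \<subseteq> U"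
      proof (rule psC_irreducible[OF u d _ _ _ _ F])
        show "U \<subseteq> psC (\<eta> i) (sq_class d)" using D(1) by (simp add: M_def)
        show "(\<lambda>x. F x + H x) \<in> U" if "F \<in> U" "H \<in> U" for F H using D(3)[OF that] by (simp add: M_def)
        show "(\<lambda>x. c * F x) \<in> U" if "F \<in> U" for c F using D(4)[OF that, of c] by (simp add: M_def)
        show "rt g F \<in> U" if "g \<in> K" "F \<in> U" for g F
          using D(5)[of "(g, spl g)" F] that spl_root[OF that(1)] by (simp add: M_def twist_act_spl K_cover_simps)
      qed
      then show ?thesis using D(1) by (auto simp: M_def)
    qed simp
  qed
  have Meq: "rep_equiv G (M d i) (M d j)" if d: "d \<in> units" for d i j
  proof -
    \<comment> \<open>The ratio of \<eta>_j and \<eta>_i, written as a quotient since j - i may be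
      negative. The exponents are even and \<theta>(-1)^2 = 1, which gives the value 1 at
      -1.\<close>
    define \<alpha> where "\<alpha> t = \<epsilon> (th t) ^ (2 * j) / \<epsilon> (th t) ^ (2 * i)" for t
    have \<alpha>: "unit_char \<alpha> 1"
      unfolding unit_char_def \<alpha>_def
      by (auto simp: th_mult eps_mult th_root power_mult_distrib eps_nonzero th_principal eps_one)
    have \<alpha>1: "\<alpha> (- 1) = 1"
    proof -
      have "th (- 1) ^ 2 = 1" using th_power[of "- 1" 2] by (simp add: th_def)
      then have "\<epsilon> (th (- 1)) ^ 2 = 1" using eps_power[OF th_root[of "- 1"], of 2] by (simp add: eps_one)
      then show ?thesis by (simp add: \<alpha>_def power_mult)
    qed
    have tw: "\<eta> j t = \<eta> i t * \<alpha> t" if "t \<in> units" for t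
      using eps_nonzero[OF th_root[OF that]] by (simp add: \<eta>_def \<alpha>_def)
    obtain a where "bij_betw (op a) (psC (\<eta> i) (sq_class d)) (psC (\<eta> j) (sq_class d))"
      using psC_iso[OF u u \<alpha> \<alpha>1 tw d] by blast
    then show ?thesis
      unfolding M_def by (rule model_equivI) (simp_all add: op_add op_scale op_rt psC_rt)
  qed
  have "\<exists>P Q. internal_direct_sum G (W_rep val \<omega> n chi0 i l) P Q \<and>
      representation G (sub_rep (W_rep val \<omega> n chi0 i l) P) \<and> rep_equiv G (sub_rep (W_rep val \<omega> n chi0 i l) P) (M 1 i) \<and>
      representation G (sub_rep (W_rep val \<omega> n chi0 i l) Q) \<and> rep_equiv G (sub_rep (W_rep val \<omega> n chi0 i l) Q) (M \<delta> i)" for i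
  proof -
    let ?V = "V_fixed val \<omega> n chi0 i l"
    have l1: "1 \<le> l" using L by simp
    have carV: "carrier ?V = lift ` ps (\<eta> i) (L + 1)" using V_fixed_lift[OF l1, of i] by (simp add: L)
    have rl: "restr (lift F) = F" if "F \<in> ps (\<eta> i) (L + 1)" for F using restr_lift[OF that] .
    have lin: "linear_between ?V (M d i) (\<lambda>f. pr d (restr f))" if d: "d \<in> units" for d
    proof -
      have "pr d (restr (lift F)) \<in> psC (\<eta> i) (sq_class d)" if "F \<in> ps (\<eta> i) (L + 1)" for F
        using rl[OF that] pr_psC[OF that u d] by simp
      moreover have "restr (\<lambda>x. f x + h x) = (\<lambda>x. restr f x + restr h x)" for f h
        by (auto simp: restr_def fun_eq_iff)
      moreover have "restr (\<lambda>x. c * f x) = (\<lambda>x. c * restr f x)" for c f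
        by (auto simp: restr_def fun_eq_iff)
      ultimately show ?thesis
        unfolding linear_between_def using carV
        by (auto simp: V_fixed_simps(2-5) M_def pr_def op_add op_scale)
    qed
    have eqv: "pr d (restr (act ?V x f)) = act (M d i) x (pr d (restr f))"
      if x: "x \<in> carrier G" and f: "f \<in> carrier ?V" for x f d
    proof -
      obtain F where F: "F \<in> ps (\<eta> i) (L + 1)" "f = lift F" using f carV by auto
      have g: "fst x \<in> K" using x by (auto simp: K_cover_simps)
      have T: "twist_act x F \<in> ps (\<eta> i) (L + 1)"
        unfolding twist_act_def by (intro ps_scale rt_ps g F)
      have "act ?V x f = lift (twist_act x F)" using lift_act[OF x] F by (simp add: V_fixed_simps)
      then have "pr d (restr (act ?V x f)) = pr d (twist_act x F)" using rl[OF T] by simp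
      also have "\<dots> = twist_act x (pr d F)"
        unfolding twist_act_def pr_def op_scale op_rt[OF g] ..
      finally show ?thesis using rl[OF F(1)] F(2) by (simp add: M_def)
    qed
    have other: "pr d F = (\<lambda>_. 0)" if F: "F \<in> psC (\<eta> i) (sq_class d')" and dd: "(d, d') = (1, \<delta>) \<or> (d, d') = (\<delta>, 1)" for d d' F
    proof (rule pr_other[OF F])
      fix s assume "s \<in> sq_class d'"
      then show "s \<notin> sq_class d" using \<delta> dd sq_class_units[of d' s] by auto
    qed
    have onto: "\<exists>f\<in>carrier ?V. pr 1 (restr f) = A \<and> pr \<delta> (restr f) = B"
      if A: "A \<in> carrier (M 1 i)" and B: "B \<in> carrier (M \<delta> i)" for A B
    proof -
      have AB: "A \<in> psC (\<eta> i) (sq_class 1)" "B \<in> psC (\<eta> i) (sq_class \<delta>)" using A B by (auto simp: M_def)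
      have ps: "(\<lambda>x. A x + B x) \<in> ps (\<eta> i) (L + 1)" using AB by (intro ps_add psC_ps)
      have "pr 1 (\<lambda>x. A x + B x) = A" "pr \<delta> (\<lambda>x. A x + B x) = B"
        using pr_id[OF AB(1)] pr_id[OF AB(2)] other[OF AB(1), of \<delta>] other[OF AB(2), of 1]
        unfolding pr_def op_add by auto
      then show ?thesis using ps rl[OF ps] unfolding carV by (intro bexI[of _ "lift (\<lambda>x. A x + B x)"]) auto
    qed
    \<comment> \<open>The space divided out is exactly the common kernel of the two projections, by
      \<open>pr_kernel\<close>.\<close>
    have ker: "carrier (V_fixed val \<omega> n chi0 i (l - 1)) =
        {f \<in> carrier ?V. pr 1 (restr f) = \<zero>\<^bsub>M 1 i\<^esub> \<and> pr \<delta> (restr f) = \<zero>\<^bsub>M \<delta> i\<^esub>}"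
    proof -
      have sub: "ps (\<eta> i) L \<subseteq> ps (\<eta> i) (L + 1)" using ps_lower[OF u] psC_ps by blast
      have "carrier (V_fixed val \<omega> n chi0 i (l - 1)) = lift ` ps (\<eta> i) L"
        using V_fixed_lift[OF L(1), of i] by (simp add: L_def)
      also have "\<dots> = lift ` {F \<in> ps (\<eta> i) (L + 1). pr 1 F = (\<lambda>_. 0) \<and> pr \<delta> F = (\<lambda>_. 0)}"
        using pr_kernel[OF _ u \<delta>] sub by blast
      also have "\<dots> = {f \<in> carrier ?V. pr 1 (restr f) = (\<lambda>_. 0) \<and> pr \<delta> (restr f) = (\<lambda>_. 0)}"
        unfolding carV using rl by auto
      finally show ?thesis by (simp add: M_def)
    qed
    show ?thesis
      unfolding W_rep_def
      by (rule quotient_direct_sum[OF V_fixed_representation[OF l1] M M lin[OF units_one] lin[OF \<delta>(1)]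
            eqv eqv onto ker K_cover_one K_cover_mult])
  qed
  then obtain P Q where PQ: "\<And>i. internal_direct_sum G (W_rep val \<omega> n chi0 i l) (P i) (Q i)"
      "\<And>i. representation G (sub_rep (W_rep val \<omega> n chi0 i l) (P i))"
      "\<And>i. rep_equiv G (sub_rep (W_rep val \<omega> n chi0 i l) (P i)) (M 1 i)"
      "\<And>i. representation G (sub_rep (W_rep val \<omega> n chi0 i l) (Q i))"
      "\<And>i. rep_equiv G (sub_rep (W_rep val \<omega> n chi0 i l) (Q i)) (M \<delta> i)"
    by metis
  have eP: "rep_equiv G (sub_rep (W_rep val \<omega> n chi0 i l) (P i)) (sub_rep (W_rep val \<omega> n chi0 j l) (P j))" for i j
    using rep_equiv_trans[OF rep_equiv_trans[OF PQ(3) Meq[OF units_one]] rep_equiv_sym[OF PQ(2,3)]] .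
  have eQ: "rep_equiv G (sub_rep (W_rep val \<omega> n chi0 i l) (Q i)) (sub_rep (W_rep val \<omega> n chi0 j l) (Q j))" for i j
    using rep_equiv_trans[OF rep_equiv_trans[OF PQ(5) Meq[OF \<delta>(1)]] rep_equiv_sym[OF PQ(4,5)]] .
  show ?thesis
    using PQ(1) irreducible_rep_equiv[OF PQ(2,3) irr[OF units_one]] irreducible_rep_equiv[OF PQ(4,5) irr[OF \<delta>(1)]] eP eQ
    by (intro exI[of _ P] exI[of _ Q]) blast
qed

end

theorem corollary2:
  fixes val :: "'a::field \<Rightarrow> int" and \<omega> :: 'a and n m :: nat
    and \<epsilon> :: "'a \<Rightarrow> complex" and chi chi0 :: "'a cov \<Rightarrow> complex"
    and \<rho> :: "('a cov, 'v) rep"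
  assumes local_field: "nonarch_local_field val \<omega>"
    and odd_residue: "odd (residue_card val)"
    and n: "n \<ge> 2" "n dvd residue_card val - 1"
    and eps: "faithful_character n \<epsilon>"
    and chi: "genuine_character val n \<epsilon> (torus_center val n) chi"
      "smooth_character val (torus_center val n) chi"
    and primitive: "primitive_mod val n chi m"
    and rho: "irreducible_rep (cover_sub val n torus) \<rho>"
      "smooth_rep (cover_sub val n torus) (congr_basis val) \<rho>"
      "genuine_rep n \<epsilon> \<rho>"
      "has_central_character (cover_sub val n torus) \<rho> chi"
    and chi0: "genuine_character val n \<epsilon> (torus_maxab val n) chi0"
      "\<forall>z \<in> torus_center val n. chi0 z = chi z"
  shows "(\<exists>Wp Wm :: nat \<Rightarrow> nat \<Rightarrow> ('a cov \<Rightarrow> complex) set set.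
            (\<forall>i < n_red n. \<forall>l > m.
               internal_direct_sum (K_cover val n) (W_rep val \<omega> n chi0 i l) (Wp i l) (Wm i l) \<and>
               irreducible_rep (K_cover val n) (sub_rep (W_rep val \<omega> n chi0 i l) (Wp i l)) \<and>
               irreducible_rep (K_cover val n) (sub_rep (W_rep val \<omega> n chi0 i l) (Wm i l))) \<and>
            (\<forall>l > m. \<forall>i < n_red n. \<forall>j < n_red n.
               rep_equiv (K_cover val n) (sub_rep (W_rep val \<omega> n chi0 i l) (Wp i l))
                                         (sub_rep (W_rep val \<omega> n chi0 j l) (Wp j l)) \<and>
               rep_equiv (K_cover val n) (sub_rep (W_rep val \<omega> n chi0 i l) (Wm i l))
                                         (sub_rep (W_rep val \<omega> n chi0 j l) (Wm j l))))
       \<and> (\<not> (m = 1 \<and> (\<exists>j < n_red n. squares_match val \<omega> n \<epsilon> chi0 j)) \<longrightarrow>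
            (\<forall>i < n_red n. \<forall>k < n_red n. i \<noteq> k \<longrightarrow>
               \<not> rep_equiv (K_cover val n) (V_fixed val \<omega> n chi0 i m) (V_fixed val \<omega> n chi0 k m)))
       \<and> (\<forall>j < n_red n. m = 1 \<and> squares_match val \<omega> n \<epsilon> chi0 j \<longrightarrow>
            (\<forall>i < n_red n. \<forall>k < n_red n. i \<noteq> k \<longrightarrow>
               (rep_equiv (K_cover val n) (V_fixed val \<omega> n chi0 i 1) (V_fixed val \<omega> n chi0 k 1)
                  \<longleftrightarrow> [i + k = j] (mod n_red n))))"
proof -
  interpret nonarch_local_field val \<omega> by (rule local_field)
  interpret cover_setting val \<omega> n \<epsilon> chi chi0 m
    by unfold_locales (use odd_residue n eps primitive chi0 in auto)
  have "\<forall>l. \<exists>P Q. l > m \<longrightarrow> (\<forall>i.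
      internal_direct_sum (K_cover val n) (W_rep val \<omega> n chi0 i l) (P i) (Q i) \<and>
      irreducible_rep (K_cover val n) (sub_rep (W_rep val \<omega> n chi0 i l) (P i)) \<and>
      irreducible_rep (K_cover val n) (sub_rep (W_rep val \<omega> n chi0 i l) (Q i))) \<and>
    (\<forall>i j. rep_equiv (K_cover val n) (sub_rep (W_rep val \<omega> n chi0 i l) (P i)) (sub_rep (W_rep val \<omega> n chi0 j l) (P j)) \<and>
      rep_equiv (K_cover val n) (sub_rep (W_rep val \<omega> n chi0 i l) (Q i)) (sub_rep (W_rep val \<omega> n chi0 j l) (Q j)))"
    using level_pieces by blast
  then obtain P Q where PQ: "\<And>l. l > m \<Longrightarrow> (\<forall>i.
      internal_direct_sum (K_cover val n) (W_rep val \<omega> n chi0 i l) (P l i) (Q l i) \<and>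
      irreducible_rep (K_cover val n) (sub_rep (W_rep val \<omega> n chi0 i l) (P l i)) \<and>
      irreducible_rep (K_cover val n) (sub_rep (W_rep val \<omega> n chi0 i l) (Q l i))) \<and>
    (\<forall>i j. rep_equiv (K_cover val n) (sub_rep (W_rep val \<omega> n chi0 i l) (P l i)) (sub_rep (W_rep val \<omega> n chi0 j l) (P l j)) \<and>
      rep_equiv (K_cover val n) (sub_rep (W_rep val \<omega> n chi0 i l) (Q l i)) (sub_rep (W_rep val \<omega> n chi0 j l) (Q l j)))"
    by metis
  show ?thesis
  proof (intro conjI, rule exI[of _ "\<lambda>i l. P l i"], rule exI[of _ "\<lambda>i l. Q l i"])
    show "\<not> (m = 1 \<and> (\<exists>j < n_red n. squares_match val \<omega> n \<epsilon> chi0 j)) \<longrightarrow>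
        (\<forall>i < n_red n. \<forall>k < n_red n. i \<noteq> k \<longrightarrow>
          \<not> rep_equiv (K_cover val n) (V_fixed val \<omega> n chi0 i m) (V_fixed val \<omega> n chi0 k m))"
    proof (intro impI allI notI)
      fix i k
      assume none: "\<not> (m = 1 \<and> (\<exists>j < n_red n. squares_match val \<omega> n \<epsilon> chi0 j))"
        and ik: "i < n_red n" "k < n_red n" "i \<noteq> k"
        and e: "rep_equiv (K_cover val n) (V_fixed val \<omega> n chi0 i m) (V_fixed val \<omega> n chi0 k m)"
      note ine = inequivalent[OF ik[folded N_def] e]
      \<comment> \<open>The match is first found at i + k, which may exceed the range of j;
        reduction modulo N brings it below \<open>n_red n\<close>.\<close>
      have "squares_match val \<omega> n \<epsilon> chi0 ((i + k) mod N)"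
        using squares_match_cong[OF ine(2)] by (simp add: cong_def)
      then show False using none ine(1) mod_less_divisor[OF N_pos] unfolding N_def by blast
    qed
    show "\<forall>j < n_red n. m = 1 \<and> squares_match val \<omega> n \<epsilon> chi0 j \<longrightarrow>
        (\<forall>i < n_red n. \<forall>k < n_red n. i \<noteq> k \<longrightarrow>
          (rep_equiv (K_cover val n) (V_fixed val \<omega> n chi0 i 1) (V_fixed val \<omega> n chi0 k 1)
             \<longleftrightarrow> [i + k = j] (mod n_red n)))"
    proof (intro allI impI)
      fix j i k
      assume mj: "m = 1 \<and> squares_match val \<omega> n \<epsilon> chi0 j" and ik: "i < n_red n" "k < n_red n" "i \<noteq> k"
      note ik' = ik[folded N_def]
      have "rep_equiv (K_cover val n) (V_fixed val \<omega> n chi0 i 1) (V_fixed val \<omega> n chi0 k 1) \<longleftrightarrow>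
          squares_match val \<omega> n \<epsilon> chi0 (i + k)"
        using inequivalent(2)[OF ik'] equivalent_at_level_one[OF _ ik'] mj by blast
      then show "rep_equiv (K_cover val n) (V_fixed val \<omega> n chi0 i 1) (V_fixed val \<omega> n chi0 k 1)
          \<longleftrightarrow> [i + k = j] (mod n_red n)"
        using squares_match_cong mj unfolding N_def by blast
    qed
  qed (simp_all add: PQ)
qed

end
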